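(* Let $n\ge 1$. The collection $\{B(\mathbb{C}_{[n-k+1,\,n+1]}) : k\le n\}$ of bounded flag manifolds is a Bott tower of height $n$, where $B(\mathbb{C}_{[n-k+1,\,n+1]})$ denotes the set of bounded flags in $\mathbb{C}_{[n-k+1,\,n+1]}$.
   Context: Bott towers. Let $N_0$ be a point with trivial line bundle $\xi_0$, and inductively let $N_k=\mathbb{C}P(\mathbb{C}\oplus\xi_{k-1})$ (the space of lines in the fibres of $\mathbb{C}\oplus\xi_{k-1}$), where $\mathbb{C}$ denotes the trivial line bundle and $\xi_{k-1}$ is an arbitrary holomorphic line bundle over $N_{k-1}$. A Bott tower of height $n$ is a collection $\{N_k:k\le n\}$ of complex manifolds constructed in this way (manifolds are considered up to isomorphism). Bounded flags. Let $\omega_1,\ldots,\omega_{n+1}$ be the standard basis of $\mathbb{C}^{n+1}$, and for $I\subset\{1,\ldots,n+1\}$ let $\mathbb{C}_I$ be the span of $\{\omega_i:i\in I\}$; $[i,j]$ is the interval $\{i,i+1,\ldots,j\}$ and $[m]=\{1,\ldots,m\}$. A complete flag $U: 0<U_1<\cdots<U_n<\mathbb{C}^{n+1}$ is bounded if $\mathbb{C}_{[i-1]}<U_i$ for each $1\le i\le n$. The space $B(\mathbb{C}^{n+1})$ of all bounded flags is an $n$-dimensional complex manifold, the bounded flag manifold. Equivalently $U_i=\mathbb{C}_{[i-1]}\oplus L_i$ where $L_{n+1}=\mathbb{C}_{n+1}$ and $L_i$ is a line in $\mathbb{C}_i\oplus L_{i+1}$ for $1\le i\le n$. The space $B(\mathbb{C}_{[n-k+1,n+1]})$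 is defined in the same way for the $(k+1)$-dimensional space $\mathbb{C}_{[n-k+1,n+1]}$ with its ordered basis $\omega_{n-k+1},\ldots,\omega_{n+1}$: its elements are the flags $0<L_{n-k+1}<\mathbb{C}_{n-k+1}\oplus L_{n-k+2}<\cdots<\mathbb{C}_{[n-k+1,n-1]}\oplus L_n<\mathbb{C}_{[n-k+1,n+1]}$. *)

theory Defs
  imports "HOL-Analysis.Analysis" "HOL-Library.Function_Algebras"
begin

section \<open>Holomorphic functions of several complex variables\<close>

text \<open>
  Dimensions vary inside the statement, so the complex coordinate space with coordinates indexed
  by a finite set \<open>I\<close> is the set of families vanishing outside \<open>I\<close>. It carries the topology
  inherited from the product topology, which for finite \<open>I\<close> is the usual one. In particular
  \<open>cspace {..<d}\<close> plays the role of the \<open>d\<close>-dimensional complex space.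
\<close>

definition cspace :: "'i set \<Rightarrow> ('i \<Rightarrow> complex) set" where
  "cspace I = {z. \<forall>i. i \<notin> I \<longrightarrow> z i = 0}"

abbreviation open_in_cspace :: "'i set \<Rightarrow> ('i \<Rightarrow> complex) set \<Rightarrow> bool" where
  "open_in_cspace I Z \<equiv> openin (top_of_set (cspace I)) Z"

text \<open>
  Complex Frechet differentiability at every point of an open set; \<open>a\<close> is the vector of complex
  partial derivatives.
\<close>

definition holo_on :: "'i set \<Rightarrow> ('i \<Rightarrow> complex) set \<Rightarrow> (('i \<Rightarrow> complex) \<Rightarrow> complex) \<Rightarrow> bool" where
  "holo_on I Z f \<longleftrightarrow> open_in_cspace I Z \<and>
     (\<forall>z\<in>Z. \<exists>a. ((\<lambda>w. (f w - f z - (\<Sum>i\<in>I. a i * (w i - z i)))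
                       / of_real (L2_set (\<lambda>i. cmod (w i - z i)) I)) \<longlongrightarrow> 0) (at z within Z))"

definition holo_map_on ::
    "'i set \<Rightarrow> ('i \<Rightarrow> complex) set \<Rightarrow> (('i \<Rightarrow> complex) \<Rightarrow> ('j \<Rightarrow> complex)) \<Rightarrow> bool" where
  "holo_map_on I Z f \<longleftrightarrow> (\<forall>j. holo_on I Z (\<lambda>z. f z j))"


section \<open>Complex manifolds\<close>

record 'a cmanifold =
  pts :: "'a set"
  cdim :: nat
  charts :: "('a set \<times> ('a \<Rightarrow> nat \<Rightarrow> complex)) set"

abbreviation model_coords :: "'a cmanifold \<Rightarrow> nat set" where
  "model_coords M \<equiv> {..<cdim M}"

text \<open>For a complex manifold the family below is indeed a topology.\<close>

definition manifold_topology :: "'a cmanifold \<Rightarrow> 'a topology" where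
  "manifold_topology M = topology (\<lambda>S. S \<subseteq> pts M \<and>
     (\<forall>(W, \<phi>)\<in>charts M. open_in_cspace (model_coords M) (\<phi> ` (S \<inter> W))))"

text \<open>
  Recall that \<open>holo_map_on\<close> includes openness of the domain, so the last condition of the
  definition says that chart overlaps are open and that the transition maps are holomorphic.
\<close>

definition complex_manifold :: "'a cmanifold \<Rightarrow> bool" where
  "complex_manifold M \<longleftrightarrow>
     (\<forall>(W, \<phi>)\<in>charts M. W \<subseteq> pts M \<and> inj_on \<phi> W \<and> open_in_cspace (model_coords M) (\<phi> ` W)) \<and>
     (\<Union>(W, \<phi>)\<in>charts M. W) = pts M \<and>
     (\<forall>(W, \<phi>)\<in>charts M. \<forall>(W', \<phi>')\<in>charts M.
        holo_map_on (model_coords M) (\<phi> ` (W \<inter> W')) (\<lambda>z. \<phi>' (inv_into W \<phi> z))) \<and>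
     Hausdorff_space (manifold_topology M) \<and>
     second_countable (manifold_topology M)"

definition holomorphic_function :: "'a cmanifold \<Rightarrow> 'a set \<Rightarrow> ('a \<Rightarrow> complex) \<Rightarrow> bool" where
  "holomorphic_function M S f \<longleftrightarrow> openin (manifold_topology M) S \<and>
     (\<forall>(W, \<phi>)\<in>charts M. holo_on (model_coords M) (\<phi> ` (S \<inter> W)) (\<lambda>z. f (inv_into W \<phi> z)))"

definition holomorphic_map :: "'a cmanifold \<Rightarrow> 'b cmanifold \<Rightarrow> ('a \<Rightarrow> 'b) \<Rightarrow> bool" where
  "holomorphic_map M N f \<longleftrightarrow> f ` pts M \<subseteq> pts N \<and>
     (\<forall>(W, \<phi>)\<in>charts M. \<forall>(W', \<phi>')\<in>charts N.
        holo_map_on (model_coords M) (\<phi> ` {x \<in> W. f x \<in> W'}) (\<lambda>z. \<phi>' (f (inv_into W \<phi> z))))"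

definition biholomorphic :: "'a cmanifold \<Rightarrow> 'b cmanifold \<Rightarrow> bool" where
  "biholomorphic M N \<longleftrightarrow> (\<exists>f. bij_betw f (pts M) (pts N) \<and>
     holomorphic_map M N f \<and> holomorphic_map N M (inv_into (pts M) f))"


section \<open>Holomorphic line bundles and their projectivizations\<close>

text \<open>
  A local trivialization is a pair \<open>(U, \<tau>)\<close>, where \<open>\<tau>\<close> is the fibre coordinate over \<open>U\<close>, so that
  \<open>e \<mapsto> (bproj e, \<tau> e)\<close> is the trivializing bijection.
\<close>

record ('a, 'e) line_bundle =
  btotal :: "'e set"
  bproj :: "'e \<Rightarrow> 'a"
  badd :: "'e \<Rightarrow> 'e \<Rightarrow> 'e"
  bscale :: "complex \<Rightarrow> 'e \<Rightarrow> 'e"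
  btriv :: "('a set \<times> ('e \<Rightarrow> complex)) set"

text \<open>
  The vector space axioms in the fibres follow from the linearity and bijectivity of the
  trivializations. The transition functions \<open>g\<close> are automatically nowhere zero.
\<close>

definition holomorphic_line_bundle :: "'a cmanifold \<Rightarrow> ('a, 'e) line_bundle \<Rightarrow> bool" where
  "holomorphic_line_bundle M \<xi> \<longleftrightarrow>
     bproj \<xi> ` btotal \<xi> \<subseteq> pts M \<and>
     (\<forall>e\<in>btotal \<xi>. \<forall>e'\<in>btotal \<xi>. bproj \<xi> e = bproj \<xi> e' \<longrightarrow>
        badd \<xi> e e' \<in> btotal \<xi> \<and> bproj \<xi> (badd \<xi> e e') = bproj \<xi> e) \<and>
     (\<forall>c. \<forall>e\<in>btotal \<xi>. bscale \<xi> c e \<in> btotal \<xi> \<and> bproj \<xi> (bscale \<xi> c e) = bproj \<xi> e) \<and>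
     (\<Union>(U, \<tau>)\<in>btriv \<xi>. U) = pts M \<and>
     (\<forall>(U, \<tau>)\<in>btriv \<xi>.
        openin (manifold_topology M) U \<and>
        bij_betw (\<lambda>e. (bproj \<xi> e, \<tau> e)) {e \<in> btotal \<xi>. bproj \<xi> e \<in> U} (U \<times> UNIV) \<and>
        (\<forall>e\<in>btotal \<xi>. \<forall>e'\<in>btotal \<xi>. bproj \<xi> e \<in> U \<and> bproj \<xi> e = bproj \<xi> e' \<longrightarrow>
           \<tau> (badd \<xi> e e') = \<tau> e + \<tau> e') \<and>
        (\<forall>c. \<forall>e\<in>btotal \<xi>. bproj \<xi> e \<in> U \<longrightarrow> \<tau> (bscale \<xi> c e) = c * \<tau> e)) \<and>
     (\<forall>(U, \<tau>)\<in>btriv \<xi>. \<forall>(U', \<tau>')\<in>btriv \<xi>.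
        \<exists>g. holomorphic_function M (U \<inter> U') g \<and>
            (\<forall>e\<in>btotal \<xi>. bproj \<xi> e \<in> U \<inter> U' \<longrightarrow> \<tau>' e = g (bproj \<xi> e) * \<tau> e))"

text \<open>
  A vector of the fibre of \<open>\<complex> \<oplus> \<xi>\<close> over \<open>x\<close> is a pair \<open>(c, e)\<close> with \<open>e\<close> in the fibre of \<open>\<xi>\<close>
  over \<open>x\<close>; it is nonzero iff \<open>c \<noteq> 0\<close> or \<open>e\<close> is not the zero vector \<open>bscale \<xi> 0 e\<close> of its fibre.
\<close>

definition fibre_line :: "('a, 'e) line_bundle \<Rightarrow> complex \<Rightarrow> 'e \<Rightarrow> (complex \<times> 'e) set" where
  "fibre_line \<xi> c e = range (\<lambda>t. (t * c, bscale \<xi> t e))"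

definition fibre_lines :: "('a, 'e) line_bundle \<Rightarrow> (complex \<times> 'e) set set" where
  "fibre_lines \<xi> = {fibre_line \<xi> c e | c e. e \<in> btotal \<xi> \<and> (c \<noteq> 0 \<or> e \<noteq> bscale \<xi> 0 e)}"

text \<open>
  Each chart \<open>(W, \<phi>)\<close> of the base and each trivialization \<open>(U, \<tau>)\<close> give two affine charts: lines
  spanned by some \<open>(1, e)\<close>, with new coordinate \<open>\<tau> e\<close>, and lines spanned by some \<open>(c, e)\<close> with
  \<open>\<tau> e = 1\<close>, with new coordinate \<open>c\<close>. The new coordinate gets the index \<open>cdim M\<close>.
\<close>

definition proj_charts :: "'a cmanifold \<Rightarrow> ('a, 'e) line_bundle \<Rightarrow>
    ((complex \<times> 'e) set set \<times> ((complex \<times> 'e) set \<Rightarrow> nat \<Rightarrow> complex)) set" where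
  "proj_charts M \<xi> =
     (\<Union>(W, \<phi>)\<in>charts M. \<Union>(U, \<tau>)\<in>btriv \<xi>.
        {({l \<in> fibre_lines \<xi>. \<exists>e. (1, e) \<in> l \<and> bproj \<xi> e \<in> W \<inter> U},
          (\<lambda>l. let e = (THE e. (1, e) \<in> l) in (\<phi> (bproj \<xi> e))(cdim M := \<tau> e))),
         ({l \<in> fibre_lines \<xi>. \<exists>c e. (c, e) \<in> l \<and> bproj \<xi> e \<in> W \<inter> U \<and> \<tau> e = 1},
          (\<lambda>l. let (c, e) = (THE p. p \<in> l \<and> \<tau> (snd p) = 1) in (\<phi> (bproj \<xi> e))(cdim M := c)))})"

definition projectivization ::
    "'a cmanifold \<Rightarrow> ('a, 'e) line_bundle \<Rightarrow> (complex \<times> 'e) set cmanifold" where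
  "projectivization M \<xi> =
     \<lparr>pts = fibre_lines \<xi>, cdim = Suc (cdim M), charts = proj_charts M \<xi>\<rparr>"


section \<open>Bott towers\<close>

text \<open>
  Every line bundle over a manifold with points of type \<open>'a\<close> is isomorphic to one whose total
  space lies in the type \<open>'a \<times> complex\<close> (choose a basis vector in each fibre; the holomorphic
  structure is transported along), so fixing this type for \<open>\<xi>\<close> loses no generality. A line bundle
  over a point is trivial, so no separate condition is needed for the first stage.
\<close>

definition bott_tower :: "nat \<Rightarrow> (nat \<Rightarrow> 'a cmanifold) \<Rightarrow> bool" where
  "bott_tower n N \<longleftrightarrow>
     (\<forall>k\<le>n. complex_manifold (N k)) \<and>
     (\<exists>x. pts (N 0) = {x}) \<and>
     (\<forall>k\<in>{1..n}. \<exists>\<xi> :: ('a, 'a \<times> complex) line_bundle.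
        holomorphic_line_bundle (N (k - 1)) \<xi> \<and>
        biholomorphic (N k) (projectivization (N (k - 1)) \<xi>))"


section \<open>Bounded flags\<close>

definition cscale :: "complex \<Rightarrow> (nat \<Rightarrow> complex) \<Rightarrow> nat \<Rightarrow> complex" where
  "cscale c v = (\<lambda>j. c * v j)"

interpretation cvec: vector_space cscale
  by unfold_locales (auto simp: cscale_def fun_eq_iff algebra_simps)

definition basis_vec :: "nat \<Rightarrow> nat \<Rightarrow> complex" where
  "basis_vec i = (\<lambda>j. if j = i then 1 else 0)"

definition coord_subspace :: "nat set \<Rightarrow> (nat \<Rightarrow> complex) set" where
  "coord_subspace I = cvec.span (basis_vec ` I)"

text \<open>
  Flags in the space \<open>coord_subspace {a..b}\<close> of dimension \<open>b - a + 1\<close>. A complete flag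
  \<open>0 < U 1 < \<dots> < U (b - a) < coord_subspace {a..b}\<close> is stored together with both of its ends;
  beyond the upper end the sequence is constant.
\<close>

definition complete_flags :: "nat \<Rightarrow> nat \<Rightarrow> (nat \<Rightarrow> (nat \<Rightarrow> complex) set) set" where
  "complete_flags a b = {U. U 0 = {0} \<and> (\<forall>i>b - a. U i = coord_subspace {a..b}) \<and>
     (\<forall>i. cvec.subspace (U i)) \<and> (\<forall>i\<le>b - a. U i \<subset> U (Suc i))}"

text \<open>The first \<open>i - 1\<close> basis vectors have the indices \<open>a, \<dots>, a + i - 2\<close>.\<close>

definition bounded_flags :: "nat \<Rightarrow> nat \<Rightarrow> (nat \<Rightarrow> (nat \<Rightarrow> complex) set) set" where
  "bounded_flags a b =
     {U \<in> complete_flags a b. \<forall>i\<in>{1..b - a}. coord_subspace {a..<a + i - 1} \<subset> U i}"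

text \<open>
  A frame of \<open>U\<close> is a sequence of \<open>b - a\<close> vectors of \<open>coord_subspace {a..b}\<close> the first \<open>i\<close> of which
  span \<open>U i\<close>; the entry \<open>v (i, j)\<close> is the \<open>j\<close>-th coordinate of the \<open>i\<close>-th vector.
\<close>

definition frame_coords :: "nat \<Rightarrow> nat \<Rightarrow> (nat \<times> nat) set" where
  "frame_coords a b = {1..b - a} \<times> {a..b}"

definition is_frame ::
    "nat \<Rightarrow> nat \<Rightarrow> (nat \<times> nat \<Rightarrow> complex) \<Rightarrow> (nat \<Rightarrow> (nat \<Rightarrow> complex) set) \<Rightarrow> bool" where
  "is_frame a b v U \<longleftrightarrow> v \<in> cspace (frame_coords a b) \<and>
     (\<forall>i\<le>b - a. U i = cvec.span ((\<lambda>l j. v (l, j)) ` {1..i}))"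

text \<open>
  The complete flag manifold has the quotient complex structure of the (open) set of frames, and
  a submanifold \<open>X\<close> of it of dimension \<open>d\<close> has the induced structure. The definition below is the
  resulting maximal atlas: its charts are the bijections \<open>\<phi>\<close> from a subset \<open>W\<close> of \<open>X\<close> to an open
  set of the \<open>d\<close>-dimensional complex space such that
  \<^item> the inverse of \<open>\<phi>\<close> is holomorphic as a map to the flag manifold, that is, it lifts locally to a
    holomorphic map to the set of frames;
  \<^item> \<open>W\<close> is open in \<open>X\<close> and \<open>\<phi>\<close> is locally the restriction of a holomorphic map, that is, near
    every frame of a member of \<open>W\<close> there is a holomorphic map \<open>G\<close> whose value at any frame of a
    member \<open>U'\<close> of \<open>X\<close> is \<open>\<phi> U'\<close>.
\<close>

definition induced_flag_charts :: "nat \<Rightarrow> nat \<Rightarrow> (nat \<Rightarrow> (nat \<Rightarrow> complex) set) set \<Rightarrow> nat \<Rightarrow>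
    ((nat \<Rightarrow> (nat \<Rightarrow> complex) set) set \<times> ((nat \<Rightarrow> (nat \<Rightarrow> complex) set) \<Rightarrow> nat \<Rightarrow> complex)) set" where
  "induced_flag_charts a b X d = {(W, \<phi>).
     W \<subseteq> X \<and> inj_on \<phi> W \<and> open_in_cspace {..<d} (\<phi> ` W) \<and>
     (\<forall>z\<in>\<phi> ` W. \<exists>Z v. z \<in> Z \<and> Z \<subseteq> \<phi> ` W \<and> holo_map_on {..<d} Z v \<and>
        (\<forall>w\<in>Z. is_frame a b (v w) (inv_into W \<phi> w))) \<and>
     (\<forall>U\<in>W. \<forall>v. is_frame a b v U \<longrightarrow>
        (\<exists>N G. v \<in> N \<and> holo_map_on (frame_coords a b) N G \<and>
           (\<forall>v'\<in>N. \<forall>U'\<in>X. is_frame a b v' U' \<longrightarrow> U' \<in> W \<and> \<phi> U' = G v')))}"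

text \<open>\<open>bounded_flag_manifold a b\<close> is the manifold of bounded flags in \<open>coord_subspace {a..b}\<close>.\<close>

definition bounded_flag_manifold :: "nat \<Rightarrow> nat \<Rightarrow> (nat \<Rightarrow> (nat \<Rightarrow> complex) set) cmanifold" where
  "bounded_flag_manifold a b =
     \<lparr>pts = bounded_flags a b, cdim = b - a,
      charts = induced_flag_charts a b (bounded_flags a b) (b - a)\<rparr>"

end

theory Submission
  imports Defs
begin

text \<open>
  A bounded flag \<open>U\<close> in the space with coordinates \<open>a, \<dots>, b\<close> amounts to a bounded flag \<open>V\<close> in the space
  with coordinates \<open>a + 1, \<dots>, b\<close> (drop \<open>U 1\<close> and the coordinate \<open>a\<close>, which splits off every \<open>U i\<close> with
  \<open>i \<ge> 2\<close>) together with the line \<open>U 1\<close> in the plane spanned by the \<open>a\<close>-th basis vector and \<open>V 1\<close>. Hence the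
  bounded flags form the projectivization of \<open>\<complex> \<oplus> \<xi>\<close>, where \<open>\<xi>\<close> is the line bundle with fibre \<open>V 1\<close> over \<open>V\<close>.
  The affine charts of the projectivization, pulled back to flags, belong to the maximal atlas of the
  bounded flag manifold, because frames of \<open>U\<close> and of \<open>V\<close> can be computed holomorphically from each other. So
  this bijection is biholomorphic, and by induction these charts form finite atlases.
\<close>


section \<open>Calculus of holomorphic functions\<close>

text \<open>The charts are given only by the condition that defines the maximal atlas, so comparing
  explicit coordinates would be laborious at every stage. Everything is phrased instead for
  functions locally holomorphic in the frames (\<open>frame_holo\<close>). One half of the chart
  condition turns such functions into holomorphic functions of chart coordinates, the other half
  says that chart components are of this kind; transition maps, openness of chart overlaps and
  holomorphy of the bijection in both directions all come from this pair. The obstacle is that a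
  line has no canonical generator: \<open>flag_gen\<close> is an arbitrary choice and need not vary
  continuously. Holomorphy is therefore claimed only for ratios of its coordinates, which may be
  evaluated on the first row of any frame. A one-dimensional space is exceptional throughout: a
  frame there has no rows, so its single flag is treated separately. The Hausdorff property does not
  follow from having charts; different lines over the same tail are separated by inequalities
  between minors of generators, which do not depend on the generator either.\<close>

lemma open_in_cspace_subset: "open_in_cspace I Z \<Longrightarrow> Z \<subseteq> cspace I"
  using openin_imp_subset by blast

lemma continuous_at_coordinate:
  "continuous (at z within Z) (\<lambda>w :: 'i::countable \<Rightarrow> complex. w i)"
  using continuous_on_product_coordinates[of i] continuous_on_eq_continuous_within[of UNIV]
    continuous_within_subset by blast

lemma L2_norm_pos:
  assumes "finite I" "w \<in> cspace I" "z \<in> cspace I" "w \<noteq> z"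
  shows "L2_set (\<lambda>i. cmod (w i - z i)) I > 0"
proof -
  obtain i where i: "w i \<noteq> z i" using assms(4) by auto
  then have "i \<in> I" using assms(2,3) by (metis (mono_tags, lifting) cspace_def mem_Collect_eq)
  then have "cmod (w i - z i) \<le> L2_set (\<lambda>i. cmod (w i - z i)) I"
    using assms(1) by (intro member_le_L2_set) auto
  moreover have "0 < cmod (w i - z i)" using i by simp
  ultimately show ?thesis by linarith
qed

text \<open>
  Caratheodory's form of differentiability reduces the chain, product and quotient rules to algebra.
\<close>

lemma difference_quotient_form:
  fixes I :: "'i::countable set"
  assumes I: "finite I" and Z: "Z \<subseteq> cspace I" and z: "z \<in> Z"
  shows "(\<exists>a. ((\<lambda>w. (f w - f z - (\<Sum>i\<in>I. a i * (w i - z i)))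
             / of_real (L2_set (\<lambda>i. cmod (w i - z i)) I)) \<longlongrightarrow> 0) (at z within Z)) \<longleftrightarrow>
         (\<exists>A. (\<forall>i\<in>I. continuous (at z within Z) (A i)) \<and>
              (\<forall>w\<in>Z. f w - f z = (\<Sum>i\<in>I. A i w * (w i - z i))))"
    (is "?L \<longleftrightarrow> ?R")
proof
  define n where "n w = L2_set (\<lambda>i. cmod (w i - z i)) I" for w
  have n_le: "cmod (w i - z i) \<le> n w" if "i \<in> I" for i w
    unfolding n_def using that I by (intro member_le_L2_set) auto
  have n_nonneg: "n w \<ge> 0" for w
    by (simp add: n_def L2_set_nonneg)
  have ratio_le: "norm (cmod (w i - z i) / n w) \<le> 1" if "i \<in> I" for i w
    using n_le[OF that, of w] n_nonneg[of w] by (cases "n w = 0") (auto simp: divide_simps)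
  {
    assume ?L
    then obtain a where a: "((\<lambda>w. (f w - f z - (\<Sum>i\<in>I. a i * (w i - z i))) / of_real (n w)) \<longlongrightarrow> 0) (at z within Z)"
      by (auto simp: n_def)
    define R where "R w = f w - f z - (\<Sum>i\<in>I. a i * (w i - z i))" for w
    \<comment> \<open>The remainder \<open>R\<close> is distributed over the coordinates with
      weights \<open>cnj (w i - z i)\<close>; multiplied by \<open>w i - z i\<close> these add up to
      the squared norm, so \<open>R\<close> is recovered. At \<open>w = z\<close> the correction is
      0, hence \<open>A i z = a i\<close>, the value that continuity requires.\<close>
    define A where "A i w = a i + R w / of_real (n w) * (cnj (w i - z i) / of_real (n w))" for i w
    have "continuous (at z within Z) (A i)" if i: "i \<in> I" for i
    proof -
      have lim: "((\<lambda>w. R w / of_real (n w) * (cnj (w i - z i) / of_real (n w))) \<longlongrightarrow> 0) (at z within Z)"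
      proof (rule Lim_null_comparison)
        show "((\<lambda>w. norm (R w / of_real (n w))) \<longlongrightarrow> 0) (at z within Z)"
          using a tendsto_norm_zero unfolding R_def by blast
        have "norm (R w / of_real (n w) * (cnj (w i - z i) / of_real (n w))) \<le> norm (R w / of_real (n w))" for w
          using mult_left_mono[OF ratio_le[OF i, of w], of "norm (R w / of_real (n w))"]
          by (simp add: norm_mult norm_divide del: complex_cnj_diff)
        then show "\<forall>\<^sub>F w in at z within Z. norm (R w / of_real (n w) * (cnj (w i - z i) / of_real (n w)))
            \<le> norm (R w / of_real (n w))"
          by simp
      qed
      have "(A i \<longlongrightarrow> a i) (at z within Z)"
        unfolding A_def using tendsto_add[OF tendsto_const lim, of "a i"] by simp
      then show ?thesis
        by (simp add: continuous_within A_def)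
    qed
    moreover have "f w - f z = (\<Sum>i\<in>I. A i w * (w i - z i))" if w: "w \<in> Z" for w
    proof (cases "w = z")
      case False
      then have pos: "n w > 0"
        unfolding n_def using I Z z w by (intro L2_norm_pos) auto
      have "(\<Sum>i\<in>I. cnj (w i - z i) * (w i - z i)) = of_real (\<Sum>i\<in>I. (cmod (w i - z i))\<^sup>2)"
        by (simp add: complex_norm_square mult.commute del: complex_cnj_diff of_real_power)
      also have "\<dots> = of_real ((n w)\<^sup>2)"
        unfolding n_def L2_set_def by (simp add: sum_nonneg)
      finally have sq: "(\<Sum>i\<in>I. cnj (w i - z i) * (w i - z i)) = (of_real (n w))\<^sup>2"
        by simp
      have "(\<Sum>i\<in>I. A i w * (w i - z i)) = (\<Sum>i\<in>I. a i * (w i - z i))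
          + R w / (of_real (n w))\<^sup>2 * (\<Sum>i\<in>I. cnj (w i - z i) * (w i - z i))"
        unfolding A_def sum_distrib_left sum.distrib[symmetric]
        by (intro sum.cong refl) (simp add: field_simps power2_eq_square)
      also have "\<dots> = f w - f z"
        using pos by (simp only: sq) (simp add: R_def)
      finally show ?thesis by simp
    qed simp
    ultimately show ?R by blast
  }
  {
    assume ?R
    then obtain A where cont: "\<And>i. i \<in> I \<Longrightarrow> continuous (at z within Z) (A i)"
      and eq: "\<And>w. w \<in> Z \<Longrightarrow> f w - f z = (\<Sum>i\<in>I. A i w * (w i - z i))"
      by blast
    \<comment> \<open>Conversely, the values \<open>A i z\<close> serve as the partial
      derivatives.\<close>
    have "((\<lambda>w. (f w - f z - (\<Sum>i\<in>I. A i z * (w i - z i))) / of_real (n w)) \<longlongrightarrow> 0) (at z within Z)"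
    proof (rule Lim_null_comparison)
      have "((\<lambda>w. norm (A i w - A i z)) \<longlongrightarrow> 0) (at z within Z)" if "i \<in> I" for i
        using cont[OF that] tendsto_norm_zero[OF LIM_zero] by (auto simp: continuous_within)
      then show "((\<lambda>w. \<Sum>i\<in>I. norm (A i w - A i z)) \<longlongrightarrow> 0) (at z within Z)"
        by (intro tendsto_null_sum) auto
      have "norm ((f w - f z - (\<Sum>i\<in>I. A i z * (w i - z i))) / of_real (n w))
          \<le> (\<Sum>i\<in>I. norm (A i w - A i z))" if w: "w \<in> Z" for w
      proof -
        have "(f w - f z - (\<Sum>i\<in>I. A i z * (w i - z i))) / of_real (n w)
            = (\<Sum>i\<in>I. (A i w - A i z) * ((w i - z i) / of_real (n w)))"
          unfolding eq[OF w] sum_subtractf[symmetric] sum_divide_distrib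
          by (intro sum.cong refl) (simp flip: left_diff_distrib)
        also have "norm \<dots> \<le> (\<Sum>i\<in>I. norm ((A i w - A i z) * ((w i - z i) / of_real (n w))))"
          by (rule norm_sum)
        also have "\<dots> \<le> (\<Sum>i\<in>I. norm (A i w - A i z))"
        proof (rule sum_mono)
          fix i assume "i \<in> I"
          from mult_left_mono[OF ratio_le[OF this, of w], of "norm (A i w - A i z)"]
          show "norm ((A i w - A i z) * ((w i - z i) / of_real (n w))) \<le> norm (A i w - A i z)"
            by (simp add: norm_mult norm_divide)
        qed
        finally show ?thesis .
      qed
      then show "\<forall>\<^sub>F w in at z within Z. norm ((f w - f z - (\<Sum>i\<in>I. A i z * (w i - z i))) / of_real (n w))
          \<le> (\<Sum>i\<in>I. norm (A i w - A i z))"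
        by (auto simp: eventually_at_filter)
    qed
    then show ?L by (auto simp: n_def)
  }
qed

section \<open>Closure properties of holomorphic functions\<close>

lemma holo_on_iff:
  fixes I :: "'i::countable set"
  assumes "finite I"
  shows "holo_on I Z f \<longleftrightarrow> open_in_cspace I Z \<and>
     (\<forall>z\<in>Z. \<exists>A. (\<forall>i\<in>I. continuous (at z within Z) (A i)) \<and>
              (\<forall>w\<in>Z. f w - f z = (\<Sum>i\<in>I. A i w * (w i - z i))))"
proof (cases "open_in_cspace I Z")
  case True
  then have "Z \<subseteq> cspace I" by (rule open_in_cspace_subset)
  from difference_quotient_form[OF assms this] True show ?thesis
    unfolding holo_on_def by simp
qed (simp add: holo_on_def)

lemma holo_on_open: "holo_on I Z f \<Longrightarrow> open_in_cspace I Z"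
  by (simp add: holo_on_def)

text \<open>Countable index types make the function space a metric space, in which continuity can be
  transferred along the Caratheodory formula.\<close>

lemma holo_on_imp_continuous_on:
  fixes I :: "'i::countable set"
  assumes "finite I" "holo_on I Z f"
  shows "continuous_on Z f"
  unfolding continuous_on_eq_continuous_within
proof
  fix z assume "z \<in> Z"
  then obtain A where cont: "\<And>i. i \<in> I \<Longrightarrow> continuous (at z within Z) (A i)"
    and eq: "\<And>w. w \<in> Z \<Longrightarrow> f w - f z = (\<Sum>i\<in>I. A i w * (w i - z i))"
    using assms(2) unfolding holo_on_iff[OF assms(1)] by blast
  have c: "continuous (at z within Z) (\<lambda>w. f z + (\<Sum>i\<in>I. A i w * (w i - z i)))"
    by (intro continuous_intros cont continuous_at_coordinate)
  show "continuous (at z within Z) f"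
  proof (rule continuous_transform_within[OF c zero_less_one \<open>z \<in> Z\<close>])
    fix w assume "w \<in> Z"
    from eq[OF this] show "f z + (\<Sum>i\<in>I. A i w * (w i - z i)) = f w"
      by (simp only: diff_eq_eq add.commute)
  qed
qed

text \<open>Openness of \<open>S\<close> is part of the conclusion, so chart images can be shown to
  be open by exhibiting a holomorphic function on them. Since the local domains are relatively open,
  limits within \<open>Z\<close> and within \<open>S\<close> agree.\<close>

lemma holo_on_local:
  assumes "\<And>z. z \<in> S \<Longrightarrow> \<exists>Z f'. z \<in> Z \<and> Z \<subseteq> S \<and> holo_on I Z f' \<and> (\<forall>w\<in>Z. f w = f' w)"
  shows "holo_on I S f"
  unfolding holo_on_def
proof (intro conjI ballI)
  show op: "open_in_cspace I S"
  proof (subst openin_subopen, rule ballI)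
    fix z assume "z \<in> S"
    then obtain Z f' where "z \<in> Z" "Z \<subseteq> S" "holo_on I Z f'" using assms by metis
    then show "\<exists>T. open_in_cspace I T \<and> z \<in> T \<and> T \<subseteq> S"
      using holo_on_open by metis
  qed
  fix z assume "z \<in> S"
  then obtain Z f' where Z: "z \<in> Z" "Z \<subseteq> S" and f': "holo_on I Z f'" and eq: "\<And>w. w \<in> Z \<Longrightarrow> f w = f' w"
    using assms by metis
  obtain T where T: "open T" "Z = cspace I \<inter> T"
    using holo_on_open[OF f'] by (auto simp: openin_open)
  have at_eq: "at z within Z = at z within S"
    using T Z open_in_cspace_subset[OF op] by (intro at_within_nhd[of z T]) auto
  obtain a where "((\<lambda>w. (f' w - f' z - (\<Sum>i\<in>I. a i * (w i - z i)))
      / of_real (L2_set (\<lambda>i. cmod (w i - z i)) I)) \<longlongrightarrow> 0) (at z within Z)"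
    using f' Z by (auto simp: holo_on_def)
  then have "((\<lambda>w. (f w - f z - (\<Sum>i\<in>I. a i * (w i - z i)))
      / of_real (L2_set (\<lambda>i. cmod (w i - z i)) I)) \<longlongrightarrow> 0) (at z within Z)"
    by (rule tendsto_cong[THEN iffD1, rotated]) (use eq Z(1) in \<open>auto simp: eventually_at_filter\<close>)
  then show "\<exists>a. ((\<lambda>w. (f w - f z - (\<Sum>i\<in>I. a i * (w i - z i)))
      / of_real (L2_set (\<lambda>i. cmod (w i - z i)) I)) \<longlongrightarrow> 0) (at z within S)"
    unfolding at_eq by blast
qed

lemma holo_on_subset:
  assumes "holo_on I Z f" "open_in_cspace I Z'" "Z' \<subseteq> Z"
  shows "holo_on I Z' f"
  unfolding holo_on_def
proof (intro conjI ballI)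
  show "open_in_cspace I Z'" by fact
  fix z assume "z \<in> Z'"
  then obtain a where "((\<lambda>w. (f w - f z - (\<Sum>i\<in>I. a i * (w i - z i)))
      / of_real (L2_set (\<lambda>i. cmod (w i - z i)) I)) \<longlongrightarrow> 0) (at z within Z)"
    using assms(1,3) unfolding holo_on_def by blast
  from tendsto_within_subset[OF this assms(3)]
  show "\<exists>a. ((\<lambda>w. (f w - f z - (\<Sum>i\<in>I. a i * (w i - z i)))
      / of_real (L2_set (\<lambda>i. cmod (w i - z i)) I)) \<longlongrightarrow> 0) (at z within Z')"
    by blast
qed

lemma holo_on_cong:
  assumes "holo_on I Z f" "\<And>w. w \<in> Z \<Longrightarrow> g w = f w"
  shows "holo_on I Z g"
proof (rule holo_on_local)
  fix z assume "z \<in> Z"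
  then show "\<exists>Z' f'. z \<in> Z' \<and> Z' \<subseteq> Z \<and> holo_on I Z' f' \<and> (\<forall>w\<in>Z'. g w = f' w)"
    using assms by (intro exI[of _ Z] exI[of _ f]) simp
qed

lemma holo_on_const:
  fixes I :: "'i::countable set"
  assumes "finite I" "open_in_cspace I Z"
  shows "holo_on I Z (\<lambda>w. c)"
  unfolding holo_on_iff[OF assms(1)]
  using assms(2) by (auto intro!: exI[of _ "\<lambda>_ _. 0"])

lemma holo_on_coordinate:
  fixes I :: "'i::countable set"
  assumes "finite I" "open_in_cspace I Z"
  shows "holo_on I Z (\<lambda>w. w i)"
proof (cases "i \<in> I")
  case True
  have "(\<Sum>j\<in>I. (if j = i then 1 else 0) * (w j - z j)) = w i - z i" for w z :: "'i \<Rightarrow> complex"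
  proof -
    have "(\<Sum>j\<in>I. (if j = i then 1 else 0) * (w j - z j)) = (\<Sum>j\<in>I. if j = i then w i - z i else 0)"
      by (intro sum.cong) auto
    then show ?thesis using True assms(1) by simp
  qed
  then show ?thesis
    unfolding holo_on_iff[OF assms(1)]
    using assms(2) by (auto intro!: exI[of _ "\<lambda>j _. if j = i then 1 else 0"])
next
  case False
  then have "w i = 0" if "w \<in> Z" for w
    using that open_in_cspace_subset[OF assms(2)] unfolding cspace_def by blast
  then show ?thesis
    by (rule holo_on_cong[OF holo_on_const[OF assms, of 0]])
qed

lemma holo_on_mult:
  fixes I :: "'i::countable set"
  assumes I: "finite I" and f: "holo_on I Z f" and g: "holo_on I Z g"
  shows "holo_on I Z (\<lambda>w. f w * g w)"
  unfolding holo_on_iff[OF I]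
proof (intro conjI ballI)
  show "open_in_cspace I Z" using f by (rule holo_on_open)
  fix z assume z: "z \<in> Z"
  obtain A where A: "\<And>i. i \<in> I \<Longrightarrow> continuous (at z within Z) (A i)"
    "\<And>w. w \<in> Z \<Longrightarrow> f w - f z = (\<Sum>i\<in>I. A i w * (w i - z i))"
    using f z unfolding holo_on_iff[OF I] by blast
  obtain B where B: "\<And>i. i \<in> I \<Longrightarrow> continuous (at z within Z) (B i)"
    "\<And>w. w \<in> Z \<Longrightarrow> g w - g z = (\<Sum>i\<in>I. B i w * (w i - z i))"
    using g z unfolding holo_on_iff[OF I] by blast
  have f_cont: "continuous (at z within Z) f"
    using holo_on_imp_continuous_on[OF I f] z by (simp add: continuous_on_eq_continuous_within)
  have "continuous (at z within Z) (\<lambda>w. f w * B i w + A i w * g z)" if "i \<in> I" for i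
    using f_cont A(1)[OF that] B(1)[OF that] by (intro continuous_intros)
  moreover have "f w * g w - f z * g z = (\<Sum>i\<in>I. (f w * B i w + A i w * g z) * (w i - z i))"
    if w: "w \<in> Z" for w
  proof -
    \<comment> \<open>This splitting leaves \<open>f w\<close>, not \<open>f z\<close>, in a
      coefficient; hence the continuity of \<open>f\<close> above.\<close>
    have "f w * g w - f z * g z = f w * (g w - g z) + (f w - f z) * g z"
      by (simp add: algebra_simps)
    also have "\<dots> = (\<Sum>i\<in>I. (f w * B i w + A i w * g z) * (w i - z i))"
      unfolding A(2)[OF w] B(2)[OF w] sum_distrib_left sum_distrib_right sum.distrib[symmetric]
      by (intro sum.cong refl) (simp add: algebra_simps)
    finally show ?thesis .
  qed
  ultimately show "\<exists>A. (\<forall>i\<in>I. continuous (at z within Z) (A i)) \<and>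
      (\<forall>w\<in>Z. f w * g w - f z * g z = (\<Sum>i\<in>I. A i w * (w i - z i)))"
    by (intro exI[of _ "\<lambda>i w. f w * B i w + A i w * g z"]) blast
qed

lemma holo_on_inverse:
  fixes I :: "'i::countable set"
  assumes I: "finite I" and f: "holo_on I Z f" and nz: "\<And>w. w \<in> Z \<Longrightarrow> f w \<noteq> 0"
  shows "holo_on I Z (\<lambda>w. inverse (f w))"
  unfolding holo_on_iff[OF I]
proof (intro conjI ballI)
  show "open_in_cspace I Z" using f by (rule holo_on_open)
  fix z assume z: "z \<in> Z"
  obtain A where A: "\<And>i. i \<in> I \<Longrightarrow> continuous (at z within Z) (A i)"
    "\<And>w. w \<in> Z \<Longrightarrow> f w - f z = (\<Sum>i\<in>I. A i w * (w i - z i))"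
    using f z unfolding holo_on_iff[OF I] by blast
  have "continuous (at z within Z) f"
    using holo_on_imp_continuous_on[OF I f] z by (simp add: continuous_on_eq_continuous_within)
  then have "continuous (at z within Z) (\<lambda>w. - (inverse (f z) * (inverse (f w) * A i w)))"
    if "i \<in> I" for i
    using z nz A(1)[OF that] by (intro continuous_intros continuous_at_within_inverse) auto
  moreover have "inverse (f w) - inverse (f z)
      = (\<Sum>i\<in>I. - (inverse (f z) * (inverse (f w) * A i w)) * (w i - z i))"
    if w: "w \<in> Z" for w
  proof -
    have "inverse (f w) - inverse (f z) = - (inverse (f z) * inverse (f w)) * (f w - f z)"
      using nz[OF w] nz[OF z] by (simp add: field_simps)
    also have "\<dots> = (\<Sum>i\<in>I. - (inverse (f z) * (inverse (f w) * A i w)) * (w i - z i))"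
      unfolding A(2)[OF w] sum_distrib_left
      by (intro sum.cong refl) (simp add: algebra_simps)
    finally show ?thesis .
  qed
  ultimately show "\<exists>A. (\<forall>i\<in>I. continuous (at z within Z) (A i)) \<and>
      (\<forall>w\<in>Z. inverse (f w) - inverse (f z) = (\<Sum>i\<in>I. A i w * (w i - z i)))"
    by (intro exI[of _ "\<lambda>i w. - (inverse (f z) * (inverse (f w) * A i w))"]) blast
qed

lemma holo_on_divide:
  fixes I :: "'i::countable set"
  assumes "finite I" "holo_on I Z f" "holo_on I Z g" "\<And>w. w \<in> Z \<Longrightarrow> g w \<noteq> 0"
  shows "holo_on I Z (\<lambda>w. f w / g w)"
  unfolding divide_inverse
  by (rule holo_on_mult[OF assms(1,2) holo_on_inverse[OF assms(1,3,4)]])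

lemma holo_map_on_open: "holo_map_on I Z f \<Longrightarrow> open_in_cspace I Z"
  by (simp add: holo_map_on_def holo_on_def)

lemma holo_map_on_imp_continuous_on:
  fixes I :: "'i::countable set"
  assumes "finite I" "holo_map_on I Z f"
  shows "continuous_on Z f"
proof (rule continuous_on_coordinatewise_then_product)
  fix j
  show "continuous_on Z (\<lambda>z. f z j)"
    using assms(2) by (intro holo_on_imp_continuous_on[OF assms(1)]) (simp add: holo_map_on_def)
qed

lemma open_in_cspace_preimage:
  assumes "continuous_on Z f" "open_in_cspace I Z" "f ` Z \<subseteq> cspace J" "open_in_cspace J N"
  shows "open_in_cspace I {w \<in> Z. f w \<in> N}"
proof -
  have "openin (top_of_set Z) (Z \<inter> f -` N)"
    using assms by (intro continuous_openin_preimage[of _ _ "cspace J"]) auto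
  moreover have "Z \<inter> f -` N = {w \<in> Z. f w \<in> N}" by auto
  ultimately show ?thesis
    using openin_trans[OF _ assms(2)] by simp
qed

lemma open_in_cspace_preimage_open:
  assumes "continuous_on Z f" "open_in_cspace I Z" "open T"
  shows "open_in_cspace I {w \<in> Z. f w \<in> T}"
proof -
  have "openin (top_of_set Z) (Z \<inter> f -` T)"
    using assms by (intro continuous_openin_preimage_gen) auto
  moreover have "Z \<inter> f -` T = {w \<in> Z. f w \<in> T}" by auto
  ultimately show ?thesis
    using openin_trans[OF _ assms(2)] by simp
qed

text \<open>In Caratheodory's form the chain rule is a product of coefficient matrices: those of
  \<open>g\<close>, evaluated at \<open>f w\<close>, times those of \<open>f\<close>.\<close>

lemma holo_on_compose:
  fixes I :: "'i::countable set" and J :: "'j::countable set"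
  assumes I: "finite I" and J: "finite J"
    and f: "holo_map_on I Z f" "f ` Z \<subseteq> cspace J" and g: "holo_on J N g"
  shows "holo_on I {w \<in> Z. f w \<in> N} (\<lambda>w. g (f w))"
  unfolding holo_on_iff[OF I]
proof (intro conjI ballI)
  let ?Z = "{w \<in> Z. f w \<in> N}"
  have f_cont: "continuous_on Z f"
    using I f(1) by (rule holo_map_on_imp_continuous_on)
  show open_Z: "open_in_cspace I ?Z"
    by (rule open_in_cspace_preimage[OF f_cont holo_map_on_open[OF f(1)] f(2) holo_on_open[OF g]])
  fix z assume z: "z \<in> ?Z"
  obtain B where B: "\<And>j. j \<in> J \<Longrightarrow> continuous (at (f z) within N) (B j)"
    "\<And>y. y \<in> N \<Longrightarrow> g y - g (f z) = (\<Sum>j\<in>J. B j y * (y j - f z j))"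
    using g z unfolding holo_on_iff[OF J] by blast
  have "\<forall>j. \<exists>A. (\<forall>i\<in>I. continuous (at z within Z) (A i)) \<and>
      (\<forall>w\<in>Z. f w j - f z j = (\<Sum>i\<in>I. A i w * (w i - z i)))"
    using f(1) z unfolding holo_map_on_def holo_on_iff[OF I] by simp
  from choice[OF this] obtain A where A': "\<forall>j. (\<forall>i\<in>I. continuous (at z within Z) (A j i)) \<and>
      (\<forall>w\<in>Z. f w j - f z j = (\<Sum>i\<in>I. A j i w * (w i - z i)))" ..
  have A: "\<And>j i. i \<in> I \<Longrightarrow> continuous (at z within Z) (A j i)"
    "\<And>j w. w \<in> Z \<Longrightarrow> f w j - f z j = (\<Sum>i\<in>I. A j i w * (w i - z i))"
    using A' by simp_all
  have "continuous (at z within ?Z) (\<lambda>w. \<Sum>j\<in>J. B j (f w) * A j i w)" if "i \<in> I" for i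
  proof -
    have "continuous (at z within ?Z) (\<lambda>w. B j (f w))" if "j \<in> J" for j
    proof (rule continuous_within_compose2[where f = f and g = "B j"])
      show "continuous (at z within ?Z) f"
        using f_cont z by (metis (no_types, lifting) continuous_on_eq_continuous_within
            continuous_on_subset mem_Collect_eq subsetI)
      show "continuous (at (f z) within f ` ?Z) (B j)"
        using B(1)[OF that] by (rule continuous_within_subset) auto
    qed
    moreover have "continuous (at z within ?Z) (A j i)" for j
      using A(1)[OF that] by (rule continuous_within_subset) auto
    ultimately show ?thesis
      by (intro continuous_intros)
  qed
  moreover have "g (f w) - g (f z) = (\<Sum>i\<in>I. (\<Sum>j\<in>J. B j (f w) * A j i w) * (w i - z i))"
    if w: "w \<in> ?Z" for w
  proof -
    have "g (f w) - g (f z) = (\<Sum>j\<in>J. B j (f w) * (f w j - f z j))"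
      using B(2) w by auto
    also have "\<dots> = (\<Sum>j\<in>J. \<Sum>i\<in>I. B j (f w) * A j i w * (w i - z i))"
      using A(2) w by (simp add: sum_distrib_left mult.assoc)
    also have "\<dots> = (\<Sum>i\<in>I. (\<Sum>j\<in>J. B j (f w) * A j i w) * (w i - z i))"
      by (subst sum.swap) (simp add: sum_distrib_right)
    finally show ?thesis .
  qed
  ultimately show "\<exists>A. (\<forall>i\<in>I. continuous (at z within ?Z) (A i)) \<and>
      (\<forall>w\<in>?Z. g (f w) - g (f z) = (\<Sum>i\<in>I. A i w * (w i - z i)))"
    by (intro exI[of _ "\<lambda>i w. \<Sum>j\<in>J. B j (f w) * A j i w"]) blast
qed

section \<open>Bounded flags as cones over shorter bounded flags\<close>

lemma subspace_cspace: "cvec.subspace (cspace I)"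
  by (auto simp: cvec.subspace_def cspace_def cscale_def)

text \<open>Turns membership in a coordinate subspace into the vanishing of coordinates.\<close>

lemma coord_subspace_eq_cspace:
  assumes "finite I"
  shows "coord_subspace I = cspace I"
proof
  show "coord_subspace I \<subseteq> cspace I"
    unfolding coord_subspace_def
    by (intro cvec.span_minimal subspace_cspace) (auto simp: basis_vec_def cspace_def)
  show "cspace I \<subseteq> coord_subspace I"
  proof
    fix x assume x: "x \<in> cspace I"
    have "x = (\<Sum>i\<in>I. cscale (x i) (basis_vec i))"
    proof
      fix j
      have "(\<Sum>i\<in>I. cscale (x i) (basis_vec i)) j = (\<Sum>i\<in>I. if j = i then x i else 0)"
        using assms by (induction I rule: finite_induct) (auto simp: cscale_def basis_vec_def)
      then show "x j = (\<Sum>i\<in>I. cscale (x i) (basis_vec i)) j"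
        using x assms by (simp add: cspace_def)
    qed
    also have "\<dots> \<in> coord_subspace I"
      unfolding coord_subspace_def
      by (intro cvec.span_sum cvec.span_scale cvec.span_base) auto
    finally show "x \<in> coord_subspace I" .
  qed
qed

lemma bounded_flags_iff:
  "U \<in> bounded_flags a b \<longleftrightarrow> U 0 = {0} \<and> (\<forall>i>b - a. U i = cspace {a..b}) \<and>
     (\<forall>i. cvec.subspace (U i)) \<and> (\<forall>i\<le>b - a. U i \<subset> U (Suc i)) \<and>
     (\<forall>i\<in>{1..b - a}. cspace {a..<a + i - 1} \<subset> U i)"
  by (auto simp: bounded_flags_def complete_flags_def coord_subspace_eq_cspace)

lemma bounded_flagsD:
  assumes "U \<in> bounded_flags a b"
  shows "U 0 = {0}" and "cvec.subspace (U i)"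
    and "i > b - a \<Longrightarrow> U i = cspace {a..b}"
    and "i \<le> b - a \<Longrightarrow> U i \<subset> U (Suc i)"
    and "i \<in> {1..b - a} \<Longrightarrow> cspace {a..<a + i - 1} \<subset> U i"
  using assms unfolding bounded_flags_iff by simp_all

lemma zero_coordinate_eq: "x(a := 0) = x - cscale (x a) (basis_vec a)"
  by (auto simp: fun_eq_iff cscale_def basis_vec_def)

text \<open>Zeroing the coordinate \<open>a\<close> subtracts a multiple of
  \<open>basis_vec a\<close>, which stays inside a subspace containing that vector.\<close>

lemma zero_coordinate_mem_iff:
  assumes "cvec.subspace S" "basis_vec a \<in> S"
  shows "x(a := 0) \<in> S \<longleftrightarrow> x \<in> S"
proof -
  have *: "cscale (x a) (basis_vec a) \<in> S"
    using assms by (rule cvec.subspace_scale)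
  have "x = (x - cscale (x a) (basis_vec a)) + cscale (x a) (basis_vec a)"
    by simp
  then show ?thesis
    unfolding zero_coordinate_eq
    using * assms(1) cvec.subspace_diff cvec.subspace_add by metis
qed

text \<open>Index 0 is set apart because the slice of \<open>U 1\<close> at \<open>a\<close> is the
  whole line whenever that line lies in the hyperplane \<open>x a = 0\<close>.\<close>

definition tail_flag :: "nat \<Rightarrow> (nat \<Rightarrow> (nat \<Rightarrow> complex) set) \<Rightarrow> nat \<Rightarrow> (nat \<Rightarrow> complex) set" where
  "tail_flag a U = (\<lambda>i. if i = 0 then {0} else {x \<in> U (Suc i). x a = 0})"

text \<open>When the vectors of \<open>V\<close> vanish at \<open>a\<close>, the set at an index
  from 2 on is the direct sum of the line of \<open>basis_vec a\<close> and
  \<open>V (i - 1)\<close>.\<close>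

definition cone_flag ::
    "nat \<Rightarrow> (nat \<Rightarrow> complex) set \<Rightarrow> (nat \<Rightarrow> (nat \<Rightarrow> complex) set) \<Rightarrow> nat \<Rightarrow> (nat \<Rightarrow> complex) set" where
  "cone_flag a L V = (\<lambda>i. if i = 0 then {0} else if i = 1 then L else {x. x(a := 0) \<in> V (i - 1)})"

text \<open>Boundedness enters here: from index 2 on, the coordinate subspace below
  \<open>U i\<close> includes the coordinate \<open>a\<close>.\<close>

lemma bounded_flag_basis_mem:
  assumes "U \<in> bounded_flags a b" "a < b" "i \<ge> 2"
  shows "basis_vec a \<in> U i"
proof (cases "i \<le> b - a")
  case True
  then have "cspace {a..<a + i - 1} \<subset> U i"
    using assms by (auto simp: bounded_flags_iff)
  moreover have "basis_vec a \<in> cspace {a..<a + i - 1}"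
    using assms by (auto simp: basis_vec_def cspace_def)
  ultimately show ?thesis by auto
next
  case False
  then have "U i = cspace {a..b}"
    using assms by (auto simp: bounded_flags_iff)
  then show ?thesis using assms by (auto simp: basis_vec_def cspace_def)
qed

lemma bounded_flag_subspace: "U \<in> bounded_flags a b \<Longrightarrow> cvec.subspace (U i)"
  by (simp add: bounded_flags_iff)

lemma bounded_flag_subset_cspace:
  assumes U: "U \<in> bounded_flags a b"
  shows "U i \<subseteq> cspace {a..b}"
proof (cases "i \<le> b - a")
  case True
  have "U i \<subseteq> U (i + m)" if "i + m \<le> Suc (b - a)" for m
    using that
  proof (induction m)
    case (Suc m)
    then have "U (i + m) \<subset> U (Suc (i + m))"
      using U unfolding bounded_flags_iff by simp
    with Suc show ?case by simp
  qed simp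
  from this[of "Suc (b - a) - i"] True have "U i \<subseteq> U (Suc (b - a))" by simp
  then show ?thesis using U by (simp add: bounded_flags_iff)
next
  case False
  then show ?thesis using U by (simp add: bounded_flags_iff)
qed

text \<open>The point is strictness after slicing. Where both members contain
  \<open>basis_vec a\<close>, a new vector stays new after its coordinate \<open>a\<close> is
  zeroed. The bottom step is different, as \<open>U 1\<close> need not contain
  \<open>basis_vec a\<close>: there a nonzero vector of the slice of \<open>U 2\<close> must be
  produced.\<close>

lemma tail_flag_bounded:
  assumes U: "U \<in> bounded_flags a b" and ab: "a < b"
  shows "tail_flag a U \<in> bounded_flags (Suc a) b"
  unfolding bounded_flags_iff
proof (intro conjI allI impI ballI)
  note ba = bounded_flag_basis_mem[OF U ab]
  note sub = bounded_flag_subspace[OF U]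
  show "tail_flag a U 0 = {0}" by (simp add: tail_flag_def)
  show "tail_flag a U i = cspace {Suc a..b}" if "i > b - Suc a" for i
  proof -
    have "i \<noteq> 0" "b - a < Suc i" using that ab by auto
    moreover from this(2) have "U (Suc i) = cspace {a..b}" by (rule bounded_flagsD(3)[OF U])
    ultimately have "i \<noteq> 0" "U (Suc i) = cspace {a..b}" by simp_all
    then have "tail_flag a U i = {x \<in> cspace {a..b}. x a = 0}" by (simp add: tail_flag_def)
    also have "\<dots> = cspace {Suc a..b}"
    proof -
      have "{a..b} = insert a {Suc a..b}" using ab by auto
      then show ?thesis by (auto simp: cspace_def)
    qed
    finally show ?thesis .
  qed
  show "cvec.subspace (tail_flag a U i)" for i
    using sub[of "Suc i"] by (auto simp: tail_flag_def cvec.subspace_def cscale_def)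
  show "tail_flag a U i \<subset> tail_flag a U (Suc i)" if i: "i \<le> b - Suc a" for i
  proof (cases "i = 0")
    case True
    have lt: "U 0 \<subset> U 1" "U 1 \<subset> U 2"
      using bounded_flagsD(4)[OF U, of 0] bounded_flagsD(4)[OF U, of 1] ab by (simp_all add: numeral_2_eq_2)
    obtain x where x: "x \<in> U 1" "x \<noteq> 0"
      using lt(1) bounded_flagsD(1)[OF U] by auto
    obtain y where y: "y \<in> U 2" "y \<notin> U 1" using lt by auto
    \<comment> \<open>Eliminates the coordinate \<open>a\<close> between \<open>x\<close> and
      \<open>y\<close>. The result is nonzero, since otherwise \<open>y\<close> would be a multiple
      of \<open>x\<close> and lie in \<open>U 1\<close>.\<close>
    define w where "w = (if x a = 0 then x else cscale (x a) y - cscale (y a) x)"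
    have "w a = 0" by (simp add: w_def cscale_def)
    moreover have "w \<in> U 2"
      using x y lt sub[of 2] by (auto simp: w_def cvec.subspace_scale cvec.subspace_diff)
    moreover have "w \<noteq> 0"
    proof
      assume w: "w = 0"
      then have nz: "x a \<noteq> 0" using x by (auto simp: w_def)
      then have "cscale (x a) y = cscale (y a) x" using w by (simp add: w_def)
      then have "cscale (x a) y \<in> U 1"
        using x sub[of 1] by (simp add: cvec.subspace_scale)
      then have "cscale (inverse (x a)) (cscale (x a) y) \<in> U 1"
        by (rule cvec.subspace_scale[OF sub])
      then show False using nz y by simp
    qed
    moreover have "0 \<in> U 2" using sub cvec.subspace_0 by blast
    ultimately show ?thesis
      using True by (auto simp: tail_flag_def numeral_2_eq_2 psubset_eq)
  next
    case False
    then have lt: "U (Suc i) \<subset> U (Suc (Suc i))"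
      using bounded_flagsD(4)[OF U, of "Suc i"] ab i by auto
    then obtain y where y: "y \<in> U (Suc (Suc i))" "y \<notin> U (Suc i)" by auto
    then have "y(a := 0) \<in> U (Suc (Suc i))" "y(a := 0) \<notin> U (Suc i)"
      using zero_coordinate_mem_iff[OF sub ba] False by auto
    then have "y(a := 0) \<in> tail_flag a U (Suc i)" "y(a := 0) \<notin> tail_flag a U i"
      using False by (auto simp: tail_flag_def)
    moreover have "tail_flag a U i \<subseteq> tail_flag a U (Suc i)"
      using lt False by (auto simp: tail_flag_def)
    ultimately show ?thesis by blast
  qed
  show "cspace {Suc a..<Suc a + i - 1} \<subset> tail_flag a U i" if i: "i \<in> {1..b - Suc a}" for i
  proof -
    have "Suc i \<in> {1..b - a}" using ab i by auto
    then have "cspace {a..<a + Suc i - 1} \<subset> U (Suc i)"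
      by (rule bounded_flagsD(5)[OF U])
    then have lt: "cspace {a..<a + i} \<subset> U (Suc i)" by simp
    then obtain y where y: "y \<in> U (Suc i)" "y \<notin> cspace {a..<a + i}" by auto
    then have "y(a := 0) \<in> U (Suc i)"
      using zero_coordinate_mem_iff[OF sub ba] i by auto
    then have "y(a := 0) \<in> tail_flag a U i"
      using i by (auto simp: tail_flag_def)
    moreover have "y(a := 0) \<notin> cspace {Suc a..<a + i}"
    proof -
      \<comment> \<open>As \<open>i\<close> is at least 1, \<open>a\<close> lies in the interval, so
        \<open>j\<close> differs from \<open>a\<close> and the coordinate survives the
        zeroing.\<close>
      obtain j where "y j \<noteq> 0" "j \<notin> {a..<a + i}"
        using y(2) by (auto simp: cspace_def)
      then show ?thesis
        using i by (auto simp: cspace_def intro!: exI[of _ j])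
    qed
    moreover have "cspace {Suc a..<a + i} \<subseteq> tail_flag a U i"
      using lt i by (auto simp: tail_flag_def cspace_def)
    ultimately show ?thesis by auto
  qed
qed

lemma bounded_flag_2:
  assumes U: "U \<in> bounded_flags a b" and ab: "a < b"
  shows "U 2 = {x. x(a := 0) \<in> tail_flag a U 1}"
  using zero_coordinate_mem_iff[OF bounded_flag_subspace[OF U] bounded_flag_basis_mem[OF U ab], of 2]
  by (auto simp: tail_flag_def numeral_2_eq_2)

section \<open>Lines in planes and generators of the first line\<close>

lemma span_singleton_iff: "x \<in> cvec.span {y} \<longleftrightarrow> (\<exists>c. x = cscale c y)"
  by (auto simp: cvec.span_singleton)

lemma span_pair_iff: "x \<in> cvec.span {p, q} \<longleftrightarrow> (\<exists>c d. x = cscale c p + cscale d q)"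
  by (simp add: cvec.span_breakdown_eq[of x p "{q}"] span_singleton_iff diff_eq_eq add.commute)

text \<open>Cramer's rule instead of a dimension count: if the coefficients of \<open>x\<close> and
  of another vector of \<open>S\<close> had nonzero determinant, both \<open>p\<close> and
  \<open>q\<close> would lie in \<open>S\<close>.\<close>

lemma plane_proper_subspace_is_line:
  assumes "cvec.subspace S" "x \<in> S" "x \<noteq> 0" "S \<subset> cvec.span {p, q}"
  shows "S = cvec.span {x}"
proof
  show "cvec.span {x} \<subseteq> S"
    using assms by (intro cvec.span_minimal) auto
  obtain c d where x: "x = cscale c p + cscale d q"
    using assms(2,4) span_pair_iff by blast
  show "S \<subseteq> cvec.span {x}"
  proof
    fix y assume y: "y \<in> S"
    obtain c' d' where y': "y = cscale c' p + cscale d' q"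
      using y assms(4) span_pair_iff by blast
    define D where "D = c * d' - c' * d"
    have "D = 0"
    proof (rule ccontr)
      assume D: "D \<noteq> 0"
      have "p = cscale (inverse D) (cscale d' x - cscale d y)"
        "q = cscale (inverse D) (cscale c y - cscale c' x)"
        using D unfolding x y' cscale_def by (auto simp: fun_eq_iff field_simps D_def)
      then have "p \<in> S" "q \<in> S"
        using y assms(1,2) by (simp_all only: cvec.subspace_scale cvec.subspace_diff)
      then have "cvec.span {p, q} \<subseteq> S"
        using assms(1) by (intro cvec.span_minimal) auto
      with assms(4) show False by auto
    qed
    show "y \<in> cvec.span {x}"
    proof (cases "c = 0")
      case False
      then have "y = cscale (c' / c) x"
        using \<open>D = 0\<close> unfolding x y' cscale_def D_def by (auto simp: fun_eq_iff field_simps)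
      then show ?thesis by (auto simp: span_singleton_iff)
    next
      case True
      then have "d \<noteq> 0" using x assms(3) by (auto simp: cscale_def fun_eq_iff)
      then have "y = cscale (d' / d) x"
        using \<open>D = 0\<close> True unfolding x y' cscale_def D_def by (auto simp: fun_eq_iff field_simps)
      then show ?thesis by (auto simp: span_singleton_iff)
    qed
  qed
qed

lemma span_basis_vec_and:
  assumes "x(a := 0) \<in> cvec.span {y}"
  shows "x \<in> cvec.span {basis_vec a, y}"
proof -
  have "x = cscale (x a) (basis_vec a) + x(a := 0)"
    by (simp add: zero_coordinate_eq)
  moreover have "x(a := 0) \<in> cvec.span {basis_vec a, y}"
    using assms cvec.span_mono[of "{y}" "{basis_vec a, y}"] by auto
  moreover have "cscale (x a) (basis_vec a) \<in> cvec.span {basis_vec a, y}"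
    by (intro cvec.span_scale cvec.span_base) simp
  ultimately show ?thesis
    using cvec.span_add by metis
qed

text \<open>Flags are only required to increase strictly, so that \<open>U 1\<close> is a line has
  to be derived. By descending induction on \<open>a\<close>, the tail line and
  \<open>basis_vec a\<close> span a set containing \<open>U 2\<close>, and \<open>U 1\<close> is
  nonzero and proper in it.\<close>

lemma bounded_flag_line_exists:
  assumes "U \<in> bounded_flags a b" "a \<le> b"
  shows "\<exists>x. x \<noteq> 0 \<and> U 1 = cvec.span {x}"
  using assms(2,1)
proof (induction a arbitrary: U rule: inc_induct)
  case base
  then have "U 1 = cspace {b}" by (auto simp: bounded_flags_iff)
  also have "\<dots> = cvec.span {basis_vec b}"
    using coord_subspace_eq_cspace[of "{b}"] by (simp add: coord_subspace_def)
  finally show ?case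
    by (intro exI[of _ "basis_vec b"]) (auto simp: basis_vec_def fun_eq_iff)
next
  case (step a)
  note U = step.prems
  obtain y where y: "y \<noteq> 0" "tail_flag a U 1 = cvec.span {y}"
    using step.IH[OF tail_flag_bounded[OF U \<open>a < b\<close>]] by blast
  have lt: "U 0 \<subset> U 1" "U 1 \<subset> U 2"
    using bounded_flagsD(4)[OF U, of 0] bounded_flagsD(4)[OF U, of 1] \<open>a < b\<close>
    by (simp_all add: numeral_2_eq_2)
  obtain x where x: "x \<in> U 1" "x \<noteq> 0"
    using lt(1) bounded_flagsD(1)[OF U] by auto
  have "U 2 \<subseteq> cvec.span {basis_vec a, y}"
    using bounded_flag_2[OF U] step.hyps y span_basis_vec_and by auto
  then have "U 1 = cvec.span {x}"
    using lt(2) x bounded_flag_subspace[OF U]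
    by (intro plane_proper_subspace_is_line) auto
  with x show ?case by blast
qed

text \<open>The choice is arbitrary up to a nonzero scalar; ratios of coordinates do not see that
  scalar.\<close>

definition flag_gen :: "(nat \<Rightarrow> (nat \<Rightarrow> complex) set) \<Rightarrow> nat \<Rightarrow> complex" where
  "flag_gen U = (SOME x. x \<noteq> 0 \<and> U 1 = cvec.span {x})"

lemma flag_gen:
  assumes "U \<in> bounded_flags a b" "a \<le> b"
  shows "flag_gen U \<noteq> 0" "U 1 = cvec.span {flag_gen U}" "flag_gen U \<in> cspace {a..b}"
proof -
  show *: "flag_gen U \<noteq> 0" "U 1 = cvec.span {flag_gen U}"
    using someI_ex[OF bounded_flag_line_exists[OF assms]] unfolding flag_gen_def by blast+
  have "flag_gen U \<in> U 1"
    unfolding *(2) by (rule cvec.span_base) simp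
  then show "flag_gen U \<in> cspace {a..b}"
    by (rule subsetD[OF bounded_flag_subset_cspace[OF assms(1)]])
qed

lemma cone_flag_bounded:
  assumes V: "V \<in> bounded_flags (Suc a) b" and ab: "a < b"
    and x: "x \<noteq> 0" "x(a := 0) \<in> V 1"
  shows "cone_flag a (cvec.span {x}) V \<in> bounded_flags a b"
  unfolding bounded_flags_iff
proof (intro conjI allI impI ballI)
  let ?U = "cone_flag a (cvec.span {x}) V"
  have V1: "V i \<subset> V (Suc i)" if "i \<le> b - Suc a" for i
    using that by (rule bounded_flagsD(4)[OF V])
  have Va: "y a = 0" if "y \<in> V i" for y i
    using bounded_flag_subset_cspace[OF V, of i] that by (auto simp: cspace_def)
  show "?U 0 = {0}" by (simp add: cone_flag_def)
  show "?U i = cspace {a..b}" if i: "i > b - a" for i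
  proof -
    have "V (i - 1) = cspace {Suc a..b}"
      using ab i by (intro bounded_flagsD(3)[OF V]) auto
    then have "?U i = {y. y(a := 0) \<in> cspace {Suc a..b}}"
      using ab i by (auto simp: cone_flag_def)
    also have "\<dots> = cspace {a..b}"
      using ab by (auto simp: cspace_def Suc_le_eq)
    finally show ?thesis .
  qed
  show "cvec.subspace (?U i)" for i
  proof -
    have sub: "cvec.subspace {y. y(a := 0) \<in> V j}" for j
    proof -
      have "(y + z)(a := 0) = y(a := 0) + z(a := 0)" "(cscale c y)(a := 0) = cscale c (y(a := 0))" 
        "0(a := 0) = (0 :: nat \<Rightarrow> complex)" for y z :: "nat \<Rightarrow> complex" and c
        by (auto simp: fun_eq_iff cscale_def)
      then show ?thesis
        using bounded_flag_subspace[OF V, of j] by (simp add: cvec.subspace_def)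
    qed
    then show ?thesis
      by (simp add: cone_flag_def)
  qed
  show "?U i \<subset> ?U (Suc i)" if i: "i \<le> b - a" for i
  proof -
    consider "i = 0" | "i = 1" | "i \<ge> 2" by linarith
    then show ?thesis
    proof cases
      case 1
      have "x \<in> cvec.span {x}" "0 \<in> cvec.span {x}"
        by (auto intro: cvec.span_base cvec.span_zero)
      then show ?thesis using x 1 by (auto simp: cone_flag_def)
    next
      case 2
      have sub: "cvec.span {x} \<subseteq> {y. y(a := 0) \<in> V 1}"
      proof
        fix y assume "y \<in> cvec.span {x}"
        then obtain c where "y = cscale c x" by (auto simp: span_singleton_iff)
        then have "y(a := 0) = cscale c (x(a := 0))" by (auto simp: fun_eq_iff cscale_def)
        then show "y \<in> {y. y(a := 0) \<in> V 1}"
          using x bounded_flag_subspace[OF V, of 1] by (simp add: cvec.subspace_scale)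
      qed
      obtain y where y: "y \<in> V 1" "y \<noteq> 0"
        using V1[of 0] bounded_flagsD(1)[OF V] by auto
      have ya: "y a = 0" using Va y by auto
      \<comment> \<open>Strictness from index 1 to 2: a line cannot contain both
        \<open>basis_vec a\<close> and a nonzero vector vanishing at \<open>a\<close>.\<close>
      have "\<not> (basis_vec a \<in> cvec.span {x} \<and> y \<in> cvec.span {x})"
      proof
        assume "basis_vec a \<in> cvec.span {x} \<and> y \<in> cvec.span {x}"
        then obtain c d where c: "basis_vec a = cscale c x" and d: "y = cscale d x"
          by (auto simp: span_singleton_iff)
        from c have "c * x a = 1" by (auto simp: fun_eq_iff basis_vec_def cscale_def) (metis)
        moreover from d ya have "d * x a = 0" by (auto simp: cscale_def)
        ultimately have "d = 0" by auto
        with d y(2) show False by (auto simp: cscale_def fun_eq_iff)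
      qed
      moreover have "y(a := 0) = y" using ya by auto
      then have "y \<in> {z. z(a := 0) \<in> V 1}" using y by simp
      moreover have "(basis_vec a)(a := 0) = 0" by (auto simp: basis_vec_def fun_eq_iff)
      then have "basis_vec a \<in> {z. z(a := 0) \<in> V 1}"
        using bounded_flag_subspace[OF V, of 1] cvec.subspace_0 by simp
      ultimately have "\<not> {z. z(a := 0) \<in> V 1} \<subseteq> cvec.span {x}"
        by blast
      with sub show ?thesis using 2 by (auto simp: cone_flag_def)
    next
      case 3
      then have "V (i - 1) \<subset> V i" using V1[of "i - 1"] i ab by auto
      then obtain y where y: "V (i - 1) \<subseteq> V i" "y \<in> V i" "y \<notin> V (i - 1)" by auto
      moreover have "y(a := 0) = y" using Va[OF y(2)] by auto
      ultimately have "y \<in> {z. z(a := 0) \<in> V i}" "y \<notin> {z. z(a := 0) \<in> V (i - 1)}" by simp_all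
      then have "{z. z(a := 0) \<in> V (i - 1)} \<subset> {z. z(a := 0) \<in> V i}"
        using y(1) by blast
      then show ?thesis using 3 by (simp add: cone_flag_def)
    qed
  qed
  show "cspace {a..<a + i - 1} \<subset> ?U i" if i: "i \<in> {1..b - a}" for i
  proof (cases "i = 1")
    case True
    have "cspace {} = {0 :: nat \<Rightarrow> complex}" by (auto simp: cspace_def)
    moreover have "x \<in> cvec.span {x}" "0 \<in> cvec.span {x}"
      by (auto intro: cvec.span_base cvec.span_zero)
    ultimately show ?thesis using True x by (auto simp: cone_flag_def)
  next
    case False
    then have "i - 1 \<in> {1..b - Suc a}" using i by auto
    then have "cspace {Suc a..<Suc a + (i - 1) - 1} \<subset> V (i - 1)"
      by (rule bounded_flagsD(5)[OF V])
    then have lt: "cspace {Suc a..<a + (i - 1)} \<subset> V (i - 1)" by simp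
    then obtain y where y: "y \<in> V (i - 1)" "y \<notin> cspace {Suc a..<a + (i - 1)}" by auto
    have ya: "y(a := 0) = y" "y a = 0" using Va[OF y(1)] by auto
    have "y \<in> ?U i" using False i y ya by (auto simp: cone_flag_def)
    moreover have "y \<notin> cspace {a..<a + i - 1}"
      using y(2) ya(2) i unfolding cspace_def by auto (metis Suc_leI le_neq_implies_less)
    moreover have "cspace {a..<a + i - 1} \<subseteq> ?U i"
    proof
      fix z assume "z \<in> cspace {a..<a + i - 1}"
      then have "z(a := 0) \<in> cspace {Suc a..<a + (i - 1)}"
        using i by (auto simp: cspace_def)
      then show "z \<in> ?U i" using lt False i by (auto simp: cone_flag_def)
    qed
    ultimately show ?thesis by blast
  qed
qed

text \<open>With \<open>cone_tail_flag\<close> this makes cones and tails inverse to each other, the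
  line \<open>U 1\<close> being the only extra datum.\<close>

lemma tail_cone_flag:
  assumes "V \<in> bounded_flags (Suc a) b"
  shows "tail_flag a (cone_flag a L V) = V"
proof
  fix i
  show "tail_flag a (cone_flag a L V) i = V i"
  proof (cases "i = 0")
    case True
    then show ?thesis using bounded_flagsD(1)[OF assms] by (simp add: tail_flag_def)
  next
    case False
    have "y a = 0" if "y \<in> V i" for y
      using bounded_flag_subset_cspace[OF assms, of i] that by (auto simp: cspace_def)
    moreover have "y(a := 0) = y" if "y a = 0" for y :: "nat \<Rightarrow> complex"
      using that by (simp add: fun_upd_idem)
    moreover have "tail_flag a (cone_flag a L V) i = {y. y(a := 0) \<in> V i \<and> y a = 0}"
      using False by (simp add: tail_flag_def cone_flag_def)
    ultimately show ?thesis by auto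
  qed
qed

lemma cone_tail_flag:
  assumes U: "U \<in> bounded_flags a b" and ab: "a < b"
  shows "cone_flag a (U 1) (tail_flag a U) = U"
proof
  fix i :: nat
  consider "i = 0" | "i = 1" | "i \<ge> 2" by linarith
  then show "cone_flag a (U 1) (tail_flag a U) i = U i"
  proof cases
    case 3
    then show ?thesis
      using zero_coordinate_mem_iff[OF bounded_flag_subspace[OF U] bounded_flag_basis_mem[OF U ab 3]]
      by (auto simp: cone_flag_def tail_flag_def)
  qed (use U in \<open>auto simp: cone_flag_def bounded_flags_iff\<close>)
qed

lemma bounded_flag_eqI:
  assumes "U \<in> bounded_flags a b" "U' \<in> bounded_flags a b" "a < b"
    "U 1 = U' 1" "tail_flag a U = tail_flag a U'"
  shows "U = U'"
  using cone_tail_flag assms by metis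

text \<open>\<open>U 1\<close> lies in the plane \<open>U 2\<close>, whose slice at \<open>a\<close>
  is the tail line. The scalar \<open>t\<close> and the coordinate at \<open>a\<close> are
  homogeneous coordinates of \<open>U 1\<close> in this plane.\<close>

lemma flag_gen_tail:
  assumes U: "U \<in> bounded_flags a b" and ab: "a < b"
  shows "\<exists>t. (flag_gen U)(a := 0) = cscale t (flag_gen (tail_flag a U))"
proof -
  have "U 1 \<subset> U 2"
    using bounded_flagsD(4)[OF U, of 1] ab by (simp add: numeral_2_eq_2)
  then have "flag_gen U \<in> U 2"
    using flag_gen(2)[OF U] ab cvec.span_base by auto
  then have "(flag_gen U)(a := 0) \<in> tail_flag a U 1"
    using bounded_flag_2[OF U ab] by auto
  then show ?thesis
    using flag_gen(2)[OF tail_flag_bounded[OF U ab]] ab by (auto simp: span_singleton_iff)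
qed

section \<open>Functions holomorphic in the frames\<close>

lemma finite_frame_coords [simp]: "finite (frame_coords a b)"
  by (simp add: frame_coords_def)

text \<open>Taking \<open>F\<close> constant, the condition says that \<open>S\<close> is open in the quotient topology of the frames.\<close>

definition frame_holo :: "nat \<Rightarrow> nat \<Rightarrow> (nat \<Rightarrow> (nat \<Rightarrow> complex) set) set \<Rightarrow>
    ((nat \<Rightarrow> (nat \<Rightarrow> complex) set) \<Rightarrow> complex) \<Rightarrow> bool" where
  "frame_holo a b S F \<longleftrightarrow> S \<subseteq> bounded_flags a b \<and>
     (\<forall>U\<in>S. \<forall>v. is_frame a b v U \<longrightarrow>
        (\<exists>N G. v \<in> N \<and> holo_on (frame_coords a b) N G \<and>
           (\<forall>v'\<in>N. \<forall>U'\<in>bounded_flags a b. is_frame a b v' U' \<longrightarrow> U' \<in> S \<and> F U' = G v')))"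

lemma frame_holoI:
  assumes "S \<subseteq> bounded_flags a b"
    and "\<And>U v. U \<in> S \<Longrightarrow> is_frame a b v U \<Longrightarrow>
      \<exists>N G. v \<in> N \<and> holo_on (frame_coords a b) N G \<and>
        (\<forall>v'\<in>N. \<forall>U'\<in>bounded_flags a b. is_frame a b v' U' \<longrightarrow> U' \<in> S \<and> F U' = G v')"
  shows "frame_holo a b S F"
  unfolding frame_holo_def using assms by simp

lemma frame_holoE:
  assumes "frame_holo a b S F" "U \<in> S" "is_frame a b v U"
  obtains N G where "v \<in> N" "holo_on (frame_coords a b) N G"
    "\<And>v' U'. v' \<in> N \<Longrightarrow> U' \<in> bounded_flags a b \<Longrightarrow> is_frame a b v' U' \<Longrightarrow> U' \<in> S \<and> F U' = G v'"
proof -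
  obtain N G where "v \<in> N" "holo_on (frame_coords a b) N G"
    and NG: "\<forall>v'\<in>N. \<forall>U'\<in>bounded_flags a b. is_frame a b v' U' \<longrightarrow> U' \<in> S \<and> F U' = G v'"
    using assms unfolding frame_holo_def by meson
  from this(1,2) NG[rule_format] show thesis by (rule that)
qed

lemma frame_holo_cong:
  assumes "frame_holo a b S F" "\<And>U. U \<in> S \<Longrightarrow> F' U = F U"
  shows "frame_holo a b S F'"
proof (rule frame_holoI)
  show "S \<subseteq> bounded_flags a b" using assms(1) by (simp add: frame_holo_def)
  fix U v assume "U \<in> S" "is_frame a b v U"
  then obtain N G where *: "v \<in> N" "holo_on (frame_coords a b) N G"
    "\<And>v' U'. v' \<in> N \<Longrightarrow> U' \<in> bounded_flags a b \<Longrightarrow> is_frame a b v' U' \<Longrightarrow> U' \<in> S \<and> F U' = G v'"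
    by (rule frame_holoE[OF assms(1)]) auto
  then show "\<exists>N G. v \<in> N \<and> holo_on (frame_coords a b) N G \<and>
      (\<forall>v'\<in>N. \<forall>U'\<in>bounded_flags a b. is_frame a b v' U' \<longrightarrow> U' \<in> S \<and> F' U' = G v')"
    using assms(2) by (intro exI[of _ N] exI[of _ G]) simp
qed

text \<open>The second hypothesis contributes the openness of \<open>T\<close>; the function that is
  kept is that of the first.\<close>

lemma frame_holo_Int:
  assumes "frame_holo a b S F" "frame_holo a b T F'"
  shows "frame_holo a b (S \<inter> T) F"
proof (rule frame_holoI)
  show "S \<inter> T \<subseteq> bounded_flags a b" using assms by (auto simp: frame_holo_def)
  fix U v assume U: "U \<in> S \<inter> T" "is_frame a b v U"
  obtain N G where 1: "v \<in> N" "holo_on (frame_coords a b) N G"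
    "\<And>v' U'. v' \<in> N \<Longrightarrow> U' \<in> bounded_flags a b \<Longrightarrow> is_frame a b v' U' \<Longrightarrow> U' \<in> S \<and> F U' = G v'"
    using U by (auto intro: frame_holoE[OF assms(1)])
  obtain N' G' where 2: "v \<in> N'" "holo_on (frame_coords a b) N' G'"
    "\<And>v' U'. v' \<in> N' \<Longrightarrow> U' \<in> bounded_flags a b \<Longrightarrow> is_frame a b v' U' \<Longrightarrow> U' \<in> T \<and> F' U' = G' v'"
    using U by (auto intro: frame_holoE[OF assms(2)])
  have "holo_on (frame_coords a b) (N \<inter> N') G"
    using openin_Int[OF holo_on_open[OF 1(2)] holo_on_open[OF 2(2)]]
    by (rule holo_on_subset[OF 1(2)]) simp
  then show "\<exists>N G. v \<in> N \<and> holo_on (frame_coords a b) N G \<and>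
      (\<forall>v'\<in>N. \<forall>U'\<in>bounded_flags a b. is_frame a b v' U' \<longrightarrow> U' \<in> S \<inter> T \<and> F U' = G v')"
    using 1(1) 2(1) 1(3) 2(3) by (intro exI[of _ "N \<inter> N'"] exI[of _ G]) blast
qed

section \<open>Passing between frames and charts\<close>

lemma induced_flag_chartsD:
  assumes "(W, \<phi>) \<in> induced_flag_charts a b X d"
  shows "W \<subseteq> X" "inj_on \<phi> W" "open_in_cspace {..<d} (\<phi> ` W)"
    and "z \<in> \<phi> ` W \<Longrightarrow> \<exists>Z v. z \<in> Z \<and> Z \<subseteq> \<phi> ` W \<and> holo_map_on {..<d} Z v \<and>
        (\<forall>w\<in>Z. is_frame a b (v w) (inv_into W \<phi> w))"
    and "U \<in> W \<Longrightarrow> is_frame a b v U \<Longrightarrow>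
        \<exists>N G. v \<in> N \<and> holo_map_on (frame_coords a b) N G \<and>
           (\<forall>v'\<in>N. \<forall>U'\<in>X. is_frame a b v' U' \<longrightarrow> U' \<in> W \<and> \<phi> U' = G v')"
  using assms unfolding induced_flag_charts_def mem_Collect_eq case_prod_conv by (elim conjE, blast)+

text \<open>The inverse of a chart lifts locally to a holomorphic map \<open>v\<close> into the
  frames, and near a frame \<open>F\<close> is a holomorphic function \<open>G\<close> of it; in
  coordinates \<open>F\<close> is \<open>G\<close> after \<open>v\<close>. As \<open>holo_on\<close>
  includes openness, sets open for frames turn out to be open in every chart.\<close>

lemma frame_holo_in_chart:
  assumes ch: "(W, \<phi>) \<in> induced_flag_charts a b (bounded_flags a b) d"
    and F: "frame_holo a b S F"
  shows "holo_on {..<d} (\<phi> ` (S \<inter> W)) (\<lambda>z. F (inv_into W \<phi> z))"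
proof (rule holo_on_local)
  note D = induced_flag_chartsD[OF ch]
  fix z assume z: "z \<in> \<phi> ` (S \<inter> W)"
  then obtain U where U: "U \<in> S" "U \<in> W" "z = \<phi> U" by auto
  then have inv_z: "inv_into W \<phi> z = U" using D(2) by simp
  have "z \<in> \<phi> ` W" using z by auto
  from D(4)[OF this] obtain Z v where Z: "z \<in> Z" "Z \<subseteq> \<phi> ` W" and v: "holo_map_on {..<d} Z v"
    and fr: "\<And>w. w \<in> Z \<Longrightarrow> is_frame a b (v w) (inv_into W \<phi> w)"
    by auto
  have "is_frame a b (v z) U" using fr[OF Z(1)] inv_z by simp
  then obtain N G where N: "v z \<in> N" "holo_on (frame_coords a b) N G"
    and NG: "\<And>v' U'. v' \<in> N \<Longrightarrow> U' \<in> bounded_flags a b \<Longrightarrow> is_frame a b v' U' \<Longrightarrow> U' \<in> S \<and> F U' = G v'"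
    by (rule frame_holoE[OF F U(1)]) auto
  have "v ` Z \<subseteq> cspace (frame_coords a b)"
    using fr by (auto simp: is_frame_def)
  then have "holo_on {..<d} {w \<in> Z. v w \<in> N} (\<lambda>w. G (v w))"
    by (intro holo_on_compose[OF _ _ v _ N(2)]) auto
  moreover have good: "inv_into W \<phi> w \<in> S" "F (inv_into W \<phi> w) = G (v w)" "w \<in> \<phi> ` (S \<inter> W)"
    if w: "w \<in> {w \<in> Z. v w \<in> N}" for w
  proof -
    have wW: "w \<in> \<phi> ` W" using w Z by auto
    have inW: "inv_into W \<phi> w \<in> W" "\<phi> (inv_into W \<phi> w) = w"
      by (rule inv_into_into[OF wW], rule f_inv_into_f[OF wW])
    show S: "inv_into W \<phi> w \<in> S" and "F (inv_into W \<phi> w) = G (v w)"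
      using NG[of "v w" "inv_into W \<phi> w"] fr w inW(1) D(1) by auto
    from S inW show "w \<in> \<phi> ` (S \<inter> W)" by force
  qed
  ultimately show "\<exists>Z f'. z \<in> Z \<and> Z \<subseteq> \<phi> ` (S \<inter> W) \<and> holo_on {..<d} Z f' \<and>
      (\<forall>w\<in>Z. F (inv_into W \<phi> w) = f' w)"
    using Z(1) N(1) by (intro exI[of _ "{w \<in> Z. v w \<in> N}"] exI[of _ "\<lambda>w. G (v w)"]) auto
qed

text \<open>The complementary half of the chart condition, component by component; fed into
  \<open>frame_holo_in_chart\<close> it yields the transition maps.\<close>

lemma chart_frame_holo:
  assumes ch: "(W, \<phi>) \<in> induced_flag_charts a b (bounded_flags a b) d"
  shows "frame_holo a b W (\<lambda>U. \<phi> U j)"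
proof (rule frame_holoI)
  note D = induced_flag_chartsD[OF ch]
  show "W \<subseteq> bounded_flags a b" by (rule D(1))
  fix U v assume "U \<in> W" "is_frame a b v U"
  from D(5)[OF this] obtain N G where NG: "v \<in> N" "holo_map_on (frame_coords a b) N G"
    "\<And>v' U'. v' \<in> N \<Longrightarrow> U' \<in> bounded_flags a b \<Longrightarrow> is_frame a b v' U' \<Longrightarrow> U' \<in> W \<and> \<phi> U' = G v'"
    by auto
  then show "\<exists>N G. v \<in> N \<and> holo_on (frame_coords a b) N G \<and>
      (\<forall>v'\<in>N. \<forall>U'\<in>bounded_flags a b. is_frame a b v' U' \<longrightarrow> U' \<in> W \<and> \<phi> U' j = G v')"
    by (intro exI[of _ N] exI[of _ "\<lambda>v. G v j"]) (simp add: holo_map_on_def)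
qed

text \<open>The component with index \<open>d\<close>, which vanishes, provides the neighbourhood when \<open>d = 0\<close>.\<close>

lemma frame_holo_map:
  fixes d :: nat
  assumes F: "\<And>j. j \<le> d \<Longrightarrow> frame_holo a b W (\<lambda>U. \<phi> U j)"
    and cs: "\<And>U. U \<in> W \<Longrightarrow> \<phi> U \<in> cspace {..<d}"
    and U: "U \<in> W" "is_frame a b v U"
  shows "\<exists>N G. v \<in> N \<and> holo_map_on (frame_coords a b) N G \<and>
           (\<forall>v'\<in>N. \<forall>U'\<in>bounded_flags a b. is_frame a b v' U' \<longrightarrow> U' \<in> W \<and> \<phi> U' = G v')"
proof -
  have "\<exists>N G. v \<in> N \<and> holo_on (frame_coords a b) N G \<and>
      (\<forall>v'\<in>N. \<forall>U'\<in>bounded_flags a b. is_frame a b v' U' \<longrightarrow> U' \<in> W \<and> \<phi> U' j = G v')" if "j \<le> d" for j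
    using F[OF that] U unfolding frame_holo_def by simp
  then obtain N G where N: "\<And>j. j \<le> d \<Longrightarrow> v \<in> N j"
    and G: "\<And>j. j \<le> d \<Longrightarrow> holo_on (frame_coords a b) (N j) (G j)"
    and NG: "\<And>j v' U'. j \<le> d \<Longrightarrow> v' \<in> N j \<Longrightarrow> U' \<in> bounded_flags a b \<Longrightarrow> is_frame a b v' U'
       \<Longrightarrow> U' \<in> W \<and> \<phi> U' j = G j v'"
    by metis
  define N' where "N' = (\<Inter>j\<in>{..d}. N j)"
  define G' where "G' v' j = (if j < d then G j v' else 0)" for v' j
  have op: "open_in_cspace (frame_coords a b) N'"
    unfolding N'_def by (rule openin_INT2) (auto intro!: holo_on_open[OF G])
  have "holo_on (frame_coords a b) N' (\<lambda>v'. G' v' j)" for j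
  proof (cases "j < d")
    case True
    then have "holo_on (frame_coords a b) N' (G j)"
      by (intro holo_on_subset[OF G op]) (auto simp: N'_def)
    with True show ?thesis by (simp add: G'_def)
  next
    case False
    then show ?thesis by (simp add: G'_def holo_on_const[OF _ op])
  qed
  moreover have "U' \<in> W \<and> \<phi> U' = G' v'"
    if v': "v' \<in> N'" and U': "U' \<in> bounded_flags a b" "is_frame a b v' U'" for v' U'
  proof -
    have 1: "U' \<in> W \<and> \<phi> U' j = G j v'" if "j \<le> d" for j
      using that v' by (intro NG U') (auto simp: N'_def)
    then have "U' \<in> W" by auto
    moreover have "\<phi> U' j = G' v' j" for j
      using 1[of j] cs[OF \<open>U' \<in> W\<close>] by (auto simp: G'_def cspace_def)
    ultimately show ?thesis by auto
  qed
  ultimately show ?thesis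
    using N by (intro exI[of _ N'] exI[of _ G']) (simp add: holo_map_on_def N'_def)
qed

section \<open>The one-dimensional case\<close>

lemma bounded_flags_same: "U \<in> bounded_flags b b \<longleftrightarrow> U = (\<lambda>i. if i = 0 then {0} else cspace {b})"
proof
  assume "U \<in> bounded_flags b b"
  then show "U = (\<lambda>i. if i = 0 then {0} else cspace {b})"
    by (intro ext) (simp add: bounded_flags_iff)
next
  assume U: "U = (\<lambda>i. if i = 0 then {0} else cspace {b})"
  have "basis_vec b \<in> cspace {b}" "0 \<in> cspace {b}" "basis_vec b \<noteq> 0"
    by (auto simp: basis_vec_def cspace_def fun_eq_iff)
  then have "{0} \<subset> cspace {b}" by blast
  then show "U \<in> bounded_flags b b"
    using U by (simp add: bounded_flags_iff subspace_cspace)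
qed

lemma is_frame_same: "U \<in> bounded_flags b b \<Longrightarrow> is_frame b b v U \<longleftrightarrow> v = 0"
  by (auto simp: is_frame_def bounded_flags_same frame_coords_def cspace_def)

text \<open>There is a single flag, so constants suffice. The case recurs below because the
  generator of a line cannot be read off from an empty frame.\<close>

lemma frame_holo_same:
  assumes "S \<subseteq> bounded_flags b b"
  shows "frame_holo b b S F"
proof (rule frame_holoI[OF assms])
  fix U v assume "U \<in> S" and v: "is_frame b b v U"
  then have U: "U \<in> bounded_flags b b" using assms by auto
  then have S: "U' \<in> S \<and> F U' = F U" if "U' \<in> bounded_flags b b" for U'
    using that \<open>U \<in> S\<close> by (simp add: bounded_flags_same)
  have "holo_on (frame_coords b b) (cspace (frame_coords b b)) (\<lambda>_. F U)"
    by (intro holo_on_const) auto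
  then show "\<exists>N G. v \<in> N \<and> holo_on (frame_coords b b) N G \<and>
      (\<forall>v'\<in>N. \<forall>U'\<in>bounded_flags b b. is_frame b b v' U' \<longrightarrow> U' \<in> S \<and> F U' = G v')"
    using S v by (intro exI[of _ "cspace (frame_coords b b)"] exI[of _ "\<lambda>_. F U"]) (simp add: is_frame_def)
qed

section \<open>Generators compared with the first row of a frame\<close>

lemma span_singleton_eq:
  assumes "x \<in> cvec.span {g}" "x \<noteq> 0"
  shows "cvec.span {x} = cvec.span {g}"
proof -
  obtain c where c: "x = cscale c g" using assms(1) by (auto simp: span_singleton_iff)
  then have "c \<noteq> 0" using assms(2) by (auto simp: cscale_def fun_eq_iff)
  then have "g = cscale (inverse c) x" using c by (simp add: cscale_def fun_eq_iff)
  then have "g \<in> cvec.span {x}" by (metis span_singleton_iff)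
  then show ?thesis using assms(1) by (simp add: cvec.span_eq)
qed

text \<open>Both vectors generate \<open>U 1\<close>. The factor depends on flag and frame without
  any regularity, so only expressions from which it cancels are useful.\<close>

lemma frame_first_row:
  assumes U: "U \<in> bounded_flags a b" and ab: "a < b" and v: "is_frame a b v U"
  shows "\<exists>c. c \<noteq> 0 \<and> (\<forall>j. v (1, j) = c * flag_gen U j)"
proof -
  have "U 1 = cvec.span {\<lambda>j. v (1, j)}"
    using v ab by (auto simp: is_frame_def)
  then have "flag_gen U \<in> cvec.span {\<lambda>j. v (1, j)}"
    using flag_gen(2)[OF U] ab cvec.span_base by auto
  then obtain d where d: "flag_gen U = cscale d (\<lambda>j. v (1, j))"
    by (auto simp: span_singleton_iff)
  have "d \<noteq> 0"
    using d flag_gen(1)[OF U] ab by (auto simp: cscale_def fun_eq_iff)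
  then have "v (1, j) = inverse d * flag_gen U j" for j
    using d by (simp add: cscale_def fun_eq_iff)
  then show ?thesis using \<open>d \<noteq> 0\<close> by (intro exI[of _ "inverse d"]) simp
qed

text \<open>The factor of \<open>frame_first_row\<close> cancels, leaving a quotient of two entries
  of the frame.\<close>

lemma frame_holo_gen_ratio:
  assumes "a \<le> b"
  shows "frame_holo a b {U \<in> bounded_flags a b. flag_gen U q \<noteq> 0} (\<lambda>U. flag_gen U p / flag_gen U q)"
proof (cases "a = b")
  case True
  then show ?thesis by (auto intro: frame_holo_same)
next
  case False
  then have ab: "a < b" using assms by simp
  show ?thesis
  proof (rule frame_holoI)
    fix U v assume "U \<in> {U \<in> bounded_flags a b. flag_gen U q \<noteq> 0}" and v: "is_frame a b v U"
    then have U: "U \<in> bounded_flags a b" "flag_gen U q \<noteq> 0" by auto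
    define N where "N = {v \<in> cspace (frame_coords a b). v (1, q) \<in> - {0}}"
    have "open_in_cspace (frame_coords a b) N"
      unfolding N_def
      by (intro open_in_cspace_preimage_open continuous_on_product_coordinates) 
        (auto intro: continuous_on_subset[OF continuous_on_product_coordinates])
    then have "holo_on (frame_coords a b) N (\<lambda>v. v (1, p) / v (1, q))"
      by (intro holo_on_divide holo_on_coordinate) (auto simp: N_def)
    moreover have "v \<in> N"
      using frame_first_row[OF U(1) ab v] U(2) v by (auto simp: N_def is_frame_def)
    moreover have "U' \<in> {U \<in> bounded_flags a b. flag_gen U q \<noteq> 0} \<and>
        flag_gen U' p / flag_gen U' q = v' (1, p) / v' (1, q)"
      if "v' \<in> N" "U' \<in> bounded_flags a b" "is_frame a b v' U'" for v' U'
      using frame_first_row[OF that(2) ab that(3)] that(1,2) by (auto simp: N_def)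
    ultimately show "\<exists>N G. v \<in> N \<and> holo_on (frame_coords a b) N G \<and>
        (\<forall>v'\<in>N. \<forall>U'\<in>bounded_flags a b. is_frame a b v' U' \<longrightarrow>
           U' \<in> {U \<in> bounded_flags a b. flag_gen U q \<noteq> 0} \<and> flag_gen U' p / flag_gen U' q = G v')"
      by (intro exI[of _ N] exI[of _ "\<lambda>v. v (1, p) / v (1, q)"]) simp
  qed auto
qed

text \<open>The condition below is homogeneous, so it does not depend on the chosen generator.\<close>

lemma frame_holo_gen_less:
  fixes r s :: nat and c d c' d' :: complex
  assumes "a \<le> b"
  defines "S \<equiv> {U \<in> bounded_flags a b. cmod (flag_gen U r * c - flag_gen U s * d)
                  < cmod (flag_gen U r * c' - flag_gen U s * d')}"
  shows "frame_holo a b S (\<lambda>_. 0)"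
proof (cases "a = b")
  case True
  then show ?thesis by (auto intro: frame_holo_same simp: S_def)
next
  case False
  then have ab: "a < b" using assms by simp
  define H :: "(nat \<times> nat \<Rightarrow> complex) \<Rightarrow> real" where
    "H v = cmod (v (1, r) * c' - v (1, s) * d') - cmod (v (1, r) * c - v (1, s) * d)" for v
  have key: "H v > 0 \<longleftrightarrow> U \<in> S" if U: "U \<in> bounded_flags a b" and v: "is_frame a b v U" for U v
  proof -
    obtain e where e: "e \<noteq> 0" "\<And>j. v (1, j) = e * flag_gen U j"
      using frame_first_row[OF U ab v] by auto
    \<comment> \<open>Passing from the generator to the first row multiplies both sides of the
      inequality by the same positive number.\<close>
    have "H v = cmod e * (cmod (flag_gen U r * c' - flag_gen U s * d') - cmod (flag_gen U r * c - flag_gen U s * d))"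
      unfolding H_def e(2) by (simp add: right_diff_distrib mult.assoc flip: norm_mult)
    then show ?thesis using e(1) U by (auto simp: S_def zero_less_mult_iff)
  qed
  show ?thesis
  proof (rule frame_holoI)
    show "S \<subseteq> bounded_flags a b" by (auto simp: S_def)
    fix U v assume U: "U \<in> S" and v: "is_frame a b v U"
    define N where "N = {v \<in> cspace (frame_coords a b). H v \<in> {0<..}}"
    have "continuous_on (cspace (frame_coords a b)) H"
      unfolding H_def
      by (intro continuous_intros continuous_on_subset[OF continuous_on_product_coordinates]) auto
    then have "open_in_cspace (frame_coords a b) N"
      unfolding N_def by (intro open_in_cspace_preimage_open) auto
    then have "holo_on (frame_coords a b) N (\<lambda>_. 0)"
      by (intro holo_on_const) auto
    moreover have "v \<in> N"
      using key[OF _ v] U v by (auto simp: N_def is_frame_def S_def)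
    ultimately show "\<exists>N G. v \<in> N \<and> holo_on (frame_coords a b) N G \<and>
        (\<forall>v'\<in>N. \<forall>U'\<in>bounded_flags a b. is_frame a b v' U' \<longrightarrow> U' \<in> S \<and> 0 = G v')"
      using key by (intro exI[of _ N] exI[of _ "\<lambda>_. 0"]) (auto simp: N_def)
  qed
qed

section \<open>Frames of the tail flag\<close>

lemma zero_coordinate_span:
  "(\<lambda>x. x(a := 0)) ` cvec.span S = cvec.span ((\<lambda>x. x(a := 0)) ` S)"
proof -
  have "module_hom cscale cscale (\<lambda>x. x(a := 0))"
    unfolding module_hom_iff
    using cvec.module_axioms by (auto simp: cscale_def fun_eq_iff)
  then show ?thesis by (rule module_hom.span_image[symmetric])
qed

lemma span_Un_cong:
  assumes "cvec.span A = cvec.span B"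
  shows "cvec.span (A \<union> R) = cvec.span (B \<union> R)"
  unfolding cvec.span_Un assms ..

text \<open>
  The truncations of the first two rows of a frame of \<open>U\<close> span the line \<open>tail_flag a U 1\<close>; \<open>m\<close> is
  the index of one that is not zero.
\<close>

definition tail_frame :: "nat \<Rightarrow> nat \<Rightarrow> nat \<Rightarrow> (nat \<times> nat \<Rightarrow> complex) \<Rightarrow> nat \<times> nat \<Rightarrow> complex" where
  "tail_frame a b m v = (\<lambda>(i, j). if (i, j) \<in> frame_coords (Suc a) b
     then (if i = 1 then v (m, j) else v (Suc i, j)) else 0)"

text \<open>Since \<open>basis_vec a\<close> belongs to \<open>U (Suc i)\<close>, slicing at
  \<open>a\<close> and projecting along \<open>a\<close> give the same set; projection, being
  linear, commutes with spans.\<close>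

lemma tail_flag_eq_image:
  assumes U: "U \<in> bounded_flags a b" and ab: "a < b" and i: "i \<ge> 1"
  shows "tail_flag a U i = (\<lambda>x. x(a := 0)) ` U (Suc i)"
proof -
  have "basis_vec a \<in> U (Suc i)"
    using bounded_flag_basis_mem[OF U ab] i by auto
  note mem = zero_coordinate_mem_iff[OF bounded_flag_subspace[OF U] this]
  show ?thesis
  proof
    show "tail_flag a U i \<subseteq> (\<lambda>x. x(a := 0)) ` U (Suc i)"
    proof
      fix x assume "x \<in> tail_flag a U i"
      then have "x \<in> U (Suc i)" "x(a := 0) = x" using i by (auto simp: tail_flag_def)
      then show "x \<in> (\<lambda>x. x(a := 0)) ` U (Suc i)" by (metis imageI)
    qed
    show "(\<lambda>x. x(a := 0)) ` U (Suc i) \<subseteq> tail_flag a U i"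
      using mem i by (auto simp: tail_flag_def)
  qed
qed

text \<open>The truncated rows \<open>1..Suc i\<close> span the \<open>i\<close>-th member of the
  tail but are one too many. The redundancy sits in the first two, which are proportional; one
  nonzero row replaces the pair and the later rows move up by one. The condition on \<open>j\<close>
  makes the kept row nonzero after truncation.\<close>

lemma is_frame_tail:
  assumes U: "U \<in> bounded_flags a b" and v: "is_frame a b v U" and ab: "Suc a < b"
    and m: "m = 1 \<or> m = 2" and j: "j \<noteq> a" "v (m, j) \<noteq> 0"
  shows "is_frame (Suc a) b (tail_frame a b m v) (tail_flag a U)"
proof -
  define r where "r l = (\<lambda>j. v (l, j))(a := 0)" for l
  have v0: "v (l, i) = 0" if "(l, i) \<notin> frame_coords a b" for l i
    using that v by (auto simp: is_frame_def cspace_def)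
  have row: "(\<lambda>j. tail_frame a b m v (l, j)) = (if l = 1 then r m else r (Suc l))"
    if "l \<in> {1..b - Suc a}" for l
    using that ab v0 by (auto simp: tail_frame_def r_def frame_coords_def fun_eq_iff)
  have tail: "tail_flag a U i = cvec.span (r ` {1..Suc i})" if i: "i \<in> {1..b - Suc a}" for i
  proof -
    have "U (Suc i) = cvec.span ((\<lambda>l j. v (l, j)) ` {1..Suc i})"
      using v i ab by (auto simp: is_frame_def)
    then have "tail_flag a U i = cvec.span ((\<lambda>x. x(a := 0)) ` (\<lambda>l j. v (l, j)) ` {1..Suc i})"
      using tail_flag_eq_image[OF U, of i] i ab zero_coordinate_span by simp
    then show ?thesis by (simp add: image_image r_def)
  qed
  have "{1..Suc 1} = {1, 2::nat}" by auto
  with tail[of 1] ab have tail1: "tail_flag a U 1 = cvec.span {r 1, r 2}" by simp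
  have V: "tail_flag a U \<in> bounded_flags (Suc a) b" using tail_flag_bounded[OF U] ab by simp
  have gen: "cvec.span {r 1, r 2} = cvec.span {flag_gen (tail_flag a U)}"
    using flag_gen(2)[OF V] ab tail1 by simp
  have "r m \<in> cvec.span {r 1, r 2}" using m by (auto intro: cvec.span_base)
  moreover have "r m \<noteq> 0" using j by (auto simp: r_def fun_eq_iff)
  ultimately have rm: "cvec.span {r m} = cvec.span {r 1, r 2}"
    unfolding gen by (rule span_singleton_eq)
  show ?thesis
    unfolding is_frame_def
  proof (intro conjI allI impI)
    show "tail_frame a b m v \<in> cspace (frame_coords (Suc a) b)"
      by (auto simp: tail_frame_def cspace_def)
    fix i assume i: "i \<le> b - Suc a"
    show "tail_flag a U i = cvec.span ((\<lambda>l j. tail_frame a b m v (l, j)) ` {1..i})"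
    proof (cases "i = 0")
      case True
      then show ?thesis by (simp add: tail_flag_def)
    next
      case False
      have "(\<lambda>l j. tail_frame a b m v (l, j)) ` {1..i} = (\<lambda>l. if l = 1 then r m else r (Suc l)) ` {1..i}"
        using row i by (intro image_cong) auto
      also have "\<dots> = (\<lambda>l. if l = 1 then r m else r (Suc l)) ` insert 1 {2..i}"
        using False by (intro arg_cong[where f = "image _"]) auto
      also have "(\<lambda>l. if l = 1 then r m else r (Suc l)) ` insert 1 {2..i} = {r m} \<union> r ` Suc ` {2..i}"
      proof -
        have e: "(\<lambda>l. if l = 1 then r m else r (Suc l)) ` {2..i} = r ` Suc ` {2..i}"
          unfolding image_image by (intro image_cong) auto
        show ?thesis unfolding image_insert e by simp
      qed
      finally have 1: "(\<lambda>l j. tail_frame a b m v (l, j)) ` {1..i} = {r m} \<union> r ` {3..Suc i}"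
        by (simp add: image_Suc_atLeastAtMost numeral_3_eq_3 numeral_2_eq_2)
      have "{1..Suc i} = {1, 2} \<union> {3..Suc i}" using False by auto
      then have 2: "r ` {1..Suc i} = {r 1, r 2} \<union> r ` {3..Suc i}" by simp
      show ?thesis
        unfolding 1 span_Un_cong[OF rm] 2[symmetric] using False i by (intro tail) simp
    qed
  qed
qed

lemma holo_map_on_tail_frame:
  assumes "open_in_cspace (frame_coords a b) N"
  shows "holo_map_on (frame_coords a b) N (tail_frame a b m)"
  unfolding holo_map_on_def
proof
  fix p :: "nat \<times> nat"
  show "holo_on (frame_coords a b) N (\<lambda>v. tail_frame a b m v p)"
    using holo_on_coordinate[OF _ assms] holo_on_const[OF _ assms, of 0]
    by (cases p; cases "p \<in> frame_coords (Suc a) b"; cases "fst p = 1") (simp_all add: tail_frame_def)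
qed

text \<open>The row to keep is chosen near a given frame: as long as its entry at \<open>j\<close>
  stays nonzero, the same \<open>m\<close> works. If both candidates vanished away from
  \<open>a\<close>, the tail line would be zero.\<close>

lemma tail_frame_exists:
  assumes U: "U \<in> bounded_flags a b" and v: "is_frame a b v U" and ab: "a < b"
  shows "\<exists>N m. v \<in> N \<and> open_in_cspace (frame_coords a b) N \<and>
    (\<forall>v'\<in>N. \<forall>U'\<in>bounded_flags a b. is_frame a b v' U' \<longrightarrow>
       is_frame (Suc a) b (tail_frame a b m v') (tail_flag a U'))"
proof (cases "b = Suc a")
  case True
  \<comment> \<open>Here the tail lives in a one-dimensional space and its frame is empty, so any
    row index would do.\<close>
  have "is_frame (Suc a) b (tail_frame a b 1 v') (tail_flag a U')" for v' U'
    using True by (auto simp: is_frame_def tail_frame_def frame_coords_def cspace_def tail_flag_def)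
  then show ?thesis
    using v by (intro exI[of _ "cspace (frame_coords a b)"] exI[of _ 1]) (simp add: is_frame_def)
next
  case False
  then have ab': "Suc a < b" using ab by simp
  have "\<exists>m j. (m = 1 \<or> m = 2) \<and> j \<noteq> a \<and> v (m, j) \<noteq> 0"
  proof (rule ccontr)
    assume "\<not> ?thesis"
    then have z: "(\<lambda>j. v (m, j))(a := 0) = 0" if "m = 1 \<or> m = 2" for m
      using that by (auto simp: fun_eq_iff)
    have "U 2 = cvec.span ((\<lambda>l j. v (l, j)) ` {1..2})"
      using v ab' by (auto simp: is_frame_def)
    moreover have "{1..2} = {1, 2::nat}" by auto
    ultimately have "tail_flag a U 1 = cvec.span ((\<lambda>x. x(a := 0)) ` {\<lambda>j. v (1, j), \<lambda>j. v (2, j)})"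
      using tail_flag_eq_image[OF U ab, of 1] zero_coordinate_span by (simp add: numeral_2_eq_2)
    also have "(\<lambda>x. x(a := 0)) ` {\<lambda>j. v (1, j), \<lambda>j. v (2, j)} = {0}"
      using z[of 1] z[of 2] by simp
    finally have "tail_flag a U 1 = {0}" by simp
    moreover have "flag_gen (tail_flag a U) \<in> tail_flag a U 1" "flag_gen (tail_flag a U) \<noteq> 0"
      using flag_gen[OF tail_flag_bounded[OF U ab]] ab' cvec.span_base by auto
    ultimately show False by simp
  qed
  then obtain m j where mj: "m = 1 \<or> m = 2" "j \<noteq> a" "v (m, j) \<noteq> 0" by auto
  define N where "N = {v \<in> cspace (frame_coords a b). v (m, j) \<in> - {0}}"
  have "open_in_cspace (frame_coords a b) N"
    unfolding N_def
    by (intro open_in_cspace_preimage_open) 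
      (auto intro: continuous_on_subset[OF continuous_on_product_coordinates])
  moreover have "is_frame (Suc a) b (tail_frame a b m v') (tail_flag a U')"
    if "v' \<in> N" "U' \<in> bounded_flags a b" "is_frame a b v' U'" for v' U'
    using is_frame_tail[OF that(2,3) ab' mj(1,2)] that(1) by (simp add: N_def)
  moreover have "v \<in> N" using v mj by (simp add: N_def is_frame_def)
  ultimately show ?thesis by (intro exI[of _ N] exI[of _ m]) simp
qed

text \<open>Composition with a local \<open>tail_frame\<close>, which merely copies entries. For
  constant \<open>F\<close> it expresses continuity of \<open>tail_flag a\<close>.\<close>

lemma frame_holo_tail:
  assumes F: "frame_holo (Suc a) b S F" and ab: "a < b"
  shows "frame_holo a b {U \<in> bounded_flags a b. tail_flag a U \<in> S} (\<lambda>U. F (tail_flag a U))"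
proof (rule frame_holoI)
  fix U v assume "U \<in> {U \<in> bounded_flags a b. tail_flag a U \<in> S}" and v: "is_frame a b v U"
  then have U: "U \<in> bounded_flags a b" "tail_flag a U \<in> S" by auto
  obtain N m where N: "v \<in> N" "open_in_cspace (frame_coords a b) N"
    and fr: "\<And>v' U'. v' \<in> N \<Longrightarrow> U' \<in> bounded_flags a b \<Longrightarrow> is_frame a b v' U' \<Longrightarrow>
       is_frame (Suc a) b (tail_frame a b m v') (tail_flag a U')"
    using tail_frame_exists[OF U(1) v ab] by auto
  obtain N0 G where N0: "tail_frame a b m v \<in> N0" "holo_on (frame_coords (Suc a) b) N0 G"
    and NG: "\<And>v' U'. v' \<in> N0 \<Longrightarrow> U' \<in> bounded_flags (Suc a) b \<Longrightarrow> is_frame (Suc a) b v' U' \<Longrightarrow> U' \<in> S \<and> F U' = G v'"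
    by (rule frame_holoE[OF F U(2) fr[OF N(1) U(1) v]]) auto
  have "tail_frame a b m ` N \<subseteq> cspace (frame_coords (Suc a) b)"
    by (auto simp: tail_frame_def cspace_def)
  then have "holo_on (frame_coords a b) {v' \<in> N. tail_frame a b m v' \<in> N0} (\<lambda>v'. G (tail_frame a b m v'))"
    by (intro holo_on_compose[OF _ _ holo_map_on_tail_frame[OF N(2)] _ N0(2)]) auto
  moreover have "U' \<in> {U \<in> bounded_flags a b. tail_flag a U \<in> S} \<and> F (tail_flag a U') = G (tail_frame a b m v')"
    if "v' \<in> {v' \<in> N. tail_frame a b m v' \<in> N0}" "U' \<in> bounded_flags a b" "is_frame a b v' U'" for v' U'
    using NG[of "tail_frame a b m v'" "tail_flag a U'"] fr[OF _ that(2,3)] tail_flag_bounded[OF that(2) ab] that(1,2)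
    by simp
  ultimately show "\<exists>N G. v \<in> N \<and> holo_on (frame_coords a b) N G \<and>
      (\<forall>v'\<in>N. \<forall>U'\<in>bounded_flags a b. is_frame a b v' U' \<longrightarrow>
         U' \<in> {U \<in> bounded_flags a b. tail_flag a U \<in> S} \<and> F (tail_flag a U') = G v')"
    using N(1) N0(1)
    by (intro exI[of _ "{v' \<in> N. tail_frame a b m v' \<in> N0}"] exI[of _ "\<lambda>v'. G (tail_frame a b m v')"]) blast
qed auto

text \<open>The first row of \<open>w\<close> is dropped: \<open>x\<close> and \<open>u\<close> are
  to span the plane of \<open>basis_vec a\<close> and the tail line, so \<open>w\<close> enters from
  its second row on, shifted by one.\<close>

definition cone_frame ::
    "nat \<Rightarrow> nat \<Rightarrow> (nat \<Rightarrow> complex) \<Rightarrow> (nat \<Rightarrow> complex) \<Rightarrow> (nat \<times> nat \<Rightarrow> complex) \<Rightarrow> nat \<times> nat \<Rightarrow> complex" where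
  "cone_frame a b x u w = (\<lambda>(i, j). if (i, j) \<in> frame_coords a b
     then (if i = 1 then x j else if i = 2 then u j else w (i - 1, j)) else 0)"

text \<open>From index 2 on, the cone is spanned by \<open>basis_vec a\<close>, \<open>y\<close> and
  the rows of \<open>w\<close> after the first, and \<open>x\<close>, \<open>u\<close> may replace
  the first two. The generator \<open>y\<close> is a separate parameter because \<open>w\<close> has
  no rows when \<open>b = Suc a\<close>.\<close>

lemma is_frame_cone:
  assumes V: "V \<in> bounded_flags (Suc a) b" and w: "is_frame (Suc a) b w V" and ab: "a < b"
    and y: "V 1 = cvec.span {y}"
    and xu: "cvec.span {x, u} = cvec.span {basis_vec a, y}" "x \<in> cspace {a..b}" "u \<in> cspace {a..b}"
  shows "is_frame a b (cone_frame a b x u w) (cone_flag a (cvec.span {x}) V)"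
  unfolding is_frame_def
proof (intro conjI allI impI)
  show "cone_frame a b x u w \<in> cspace (frame_coords a b)"
    by (auto simp: cone_frame_def cspace_def)
  fix i assume i: "i \<le> b - a"
  define r where "r l = (\<lambda>j. w (l, j))" for l
  have w0: "w (l, i) = 0" if "(l, i) \<notin> frame_coords (Suc a) b" for l i
    using that w by (auto simp: is_frame_def cspace_def)
  have row: "(\<lambda>j. cone_frame a b x u w (l, j)) = (if l = 1 then x else if l = 2 then u else r (l - 1))"
    if l: "l \<in> {1..b - a}" for l
  proof
    fix j
    have "x j = 0" "u j = 0" "r (l - 1) j = 0" if "j \<notin> {a..b}"
      using that xu w0[of "l - 1" j] by (auto simp: cspace_def r_def frame_coords_def)
    then show "cone_frame a b x u w (l, j) = (if l = 1 then x else if l = 2 then u else r (l - 1)) j"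
      using l by (auto simp: cone_frame_def r_def frame_coords_def)
  qed
  consider "i = 0" | "i = 1" | "i \<ge> 2" by linarith
  then show "cone_flag a (cvec.span {x}) V i = cvec.span ((\<lambda>l j. cone_frame a b x u w (l, j)) ` {1..i})"
  proof cases
    case 1
    then show ?thesis by (simp add: cone_flag_def)
  next
    case 2
    then show ?thesis using row[of 1] i by (simp add: cone_flag_def)
  next
    case 3
    define R where "R = r ` {2..i - 1}"
    have Vi: "V (i - 1) = cvec.span (r ` {1..i - 1})"
      using w i 3 by (auto simp: is_frame_def r_def)
    have r1: "cvec.span {r 1} = cvec.span {y}" if "i \<ge> 3 \<or> b \<noteq> Suc a"
    proof -
      have "1 \<le> b - Suc a" using that i ab by auto
      then have "V 1 = cvec.span {r 1}" using w by (auto simp: is_frame_def r_def)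
      with y show ?thesis by simp
    qed
    \<comment> \<open>An index \<open>i\<close> with \<open>2 \<le> i \<le> b - a\<close> excludes a
      one-dimensional tail, so \<open>w\<close> does have a first row.\<close>
    have "b \<noteq> Suc a" using i 3 by auto
    note r1 = r1[OF disjI2[OF this]]
    have "{1..i - 1} = insert 1 {2..i - 1}" using 3 by auto
    then have "r ` {1..i - 1} = {r 1} \<union> R" by (simp add: R_def)
    then have Vi': "V (i - 1) = cvec.span ({y} \<union> R)"
      using Vi span_Un_cong[OF r1] by simp
    have y_a: "z a = 0" if "z \<in> V (i - 1)" for z
      using bounded_flag_subset_cspace[OF V, of "i - 1"] that by (auto simp: cspace_def)
    have "cone_flag a (cvec.span {x}) V i = {z. z(a := 0) \<in> V (i - 1)}"
      using 3 by (simp add: cone_flag_def)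
    also have "\<dots> = cvec.span (insert (basis_vec a) ({y} \<union> R))"
    proof -
      \<comment> \<open>The scalar \<open>k\<close> is forced to be \<open>z a\<close>, because
        vectors of \<open>V (i - 1)\<close> vanish at \<open>a\<close>.\<close>
      have "z(a := 0) \<in> V (i - 1) \<longleftrightarrow> (\<exists>k. z - cscale k (basis_vec a) \<in> V (i - 1))" for z
      proof
        assume "\<exists>k. z - cscale k (basis_vec a) \<in> V (i - 1)"
        then obtain k where k: "z - cscale k (basis_vec a) \<in> V (i - 1)" by auto
        from y_a[OF k] have "k = z a" by (simp add: cscale_def basis_vec_def)
        with k show "z(a := 0) \<in> V (i - 1)" by (simp add: zero_coordinate_eq)
      qed (auto simp: zero_coordinate_eq)
      then show ?thesis unfolding cvec.span_insert Vi'[symmetric] by simp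
    qed
    also have "insert (basis_vec a) ({y} \<union> R) = {basis_vec a, y} \<union> R" by simp
    also have "cvec.span \<dots> = cvec.span ({x, u} \<union> R)"
      by (rule span_Un_cong[OF xu(1)[symmetric]])
    also have "{x, u} \<union> R = (\<lambda>l j. cone_frame a b x u w (l, j)) ` {1..i}"
    proof -
      have "(\<lambda>l j. cone_frame a b x u w (l, j)) ` {1..i}
          = (\<lambda>l. if l = 1 then x else if l = 2 then u else r (l - 1)) ` {1..i}"
        using row i by (intro image_cong) auto
      also have "\<dots> = (\<lambda>l. if l = 1 then x else if l = 2 then u else r (l - 1)) ` ({1, 2} \<union> Suc ` {2..i - 1})"
        using 3 by (intro arg_cong[where f = "image _"]) (auto simp: image_Suc_atLeastAtMost)
      also have "(\<lambda>l. if l = 1 then x else if l = 2 then u else r (l - 1)) ` ({1, 2} \<union> Suc ` {2..i - 1})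
          = {x, u} \<union> R"
      proof -
        have "(\<lambda>l. if l = 1 then x else if l = 2 then u else r (l - 1)) ` Suc ` {2..i - 1} = R"
          unfolding R_def image_image by (intro image_cong) auto
        then show ?thesis unfolding image_Un by (simp add: insert_commute)
      qed
      finally show ?thesis by (rule sym)
    qed
    finally show ?thesis .
  qed
qed

section \<open>Charts of the cone construction\<close>

text \<open>
  The point of the plane spanned by \<open>basis_vec a\<close> and \<open>y\<close> whose coordinate \<open>q\<close> is \<open>1\<close> and whose other
  coordinate among \<open>a\<close> and \<open>j\<close> is \<open>\<zeta>\<close>; here \<open>q\<close> is \<open>a\<close> or \<open>j\<close>, according to the two affine charts.
\<close>

definition cone_vec :: "nat \<Rightarrow> nat \<Rightarrow> nat \<Rightarrow> (nat \<Rightarrow> complex) \<Rightarrow> complex \<Rightarrow> nat \<Rightarrow> complex" where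
  "cone_vec a j q y \<zeta> = (\<lambda>i. if i = a then (if q = a then 1 else \<zeta>)
     else (if q = a then \<zeta> else 1) * (y i / y j))"

definition cone_point :: "nat \<Rightarrow> nat \<Rightarrow> nat \<Rightarrow> (nat \<Rightarrow> (nat \<Rightarrow> complex) set) \<Rightarrow> complex \<Rightarrow>
    nat \<Rightarrow> (nat \<Rightarrow> complex) set" where
  "cone_point a j q V \<zeta> = cone_flag a (cvec.span {cone_vec a j q (flag_gen V) \<zeta>}) V"

text \<open>The reason for dividing by \<open>y j\<close>: the first row of a frame may replace the
  chosen generator.\<close>

lemma cone_vec_cscale: "c \<noteq> 0 \<Longrightarrow> cone_vec a j q (cscale c y) \<zeta> = cone_vec a j q y \<zeta>"
  by (auto simp: cone_vec_def cscale_def fun_eq_iff)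

lemma cone_vec_zero_coordinate:
  assumes "y a = 0"
  shows "(cone_vec a j q y \<zeta>)(a := 0) = cscale ((if q = a then \<zeta> else 1) / y j) y"
  using assms by (auto simp: cone_vec_def cscale_def fun_eq_iff)

lemma cone_flag_gen:
  assumes V: "V \<in> bounded_flags (Suc a) b" and ab: "a < b"
    and x: "x \<noteq> 0" "x(a := 0) = cscale t (flag_gen V)"
  shows "cone_flag a (cvec.span {x}) V \<in> bounded_flags a b"
    and "\<exists>c. c \<noteq> 0 \<and> flag_gen (cone_flag a (cvec.span {x}) V) = cscale c x"
proof -
  let ?U = "cone_flag a (cvec.span {x}) V"
  have "x(a := 0) \<in> V 1"
    using flag_gen(2)[OF V] ab x(2) by (auto simp: span_singleton_iff)
  with V ab x(1) show U: "?U \<in> bounded_flags a b" by (rule cone_flag_bounded)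
  have gen: "flag_gen ?U \<noteq> 0" "?U 1 = cvec.span {flag_gen ?U}"
    using flag_gen[OF U] ab by auto
  have "?U 1 = cvec.span {x}" by (simp add: cone_flag_def)
  then have "flag_gen ?U \<in> cvec.span {x}"
    using gen(2) cvec.span_base[of "flag_gen ?U" "{flag_gen ?U}"] by simp
  then obtain c where c: "flag_gen ?U = cscale c x" by (auto simp: span_singleton_iff)
  then have "c \<noteq> 0" using gen(1) by (auto simp: cscale_def fun_eq_iff)
  with c show "\<exists>c. c \<noteq> 0 \<and> flag_gen ?U = cscale c x" by auto
qed

lemma flag_gen_Suc_zero:
  assumes "V \<in> bounded_flags (Suc a) b" "a < b"
  shows "flag_gen V a = 0"
  using flag_gen(3)[OF assms(1)] assms(2) by (auto simp: cspace_def)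

text \<open>One half of inverting the affine charts; \<open>cone_point_tail\<close> is the other.
  The indices \<open>p\<close> and \<open>q\<close> are those of numerator and denominator of the
  new coordinate, and the cone vector has entry \<open>\<zeta>\<close> at \<open>p\<close> and 1 at
  \<open>q\<close>, which treats both charts at once.\<close>

lemma cone_point:
  assumes V: "V \<in> bounded_flags (Suc a) b" and ab: "a < b" and j: "flag_gen V j \<noteq> 0"
    and pq: "p = j \<and> q = a \<or> p = a \<and> q = j"
  shows "cone_point a j q V \<zeta> \<in> bounded_flags a b"
    and "tail_flag a (cone_point a j q V \<zeta>) = V"
    and "flag_gen (cone_point a j q V \<zeta>) q \<noteq> 0"
    and "flag_gen (cone_point a j q V \<zeta>) p / flag_gen (cone_point a j q V \<zeta>) q = \<zeta>"
proof -
  let ?x = "cone_vec a j q (flag_gen V) \<zeta>"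
  have gen_a: "flag_gen V a = 0" by (rule flag_gen_Suc_zero[OF V ab])
  then have ja: "j \<noteq> a" using j by auto
  then have x: "?x q = 1" "?x p = \<zeta>" using pq j by (auto simp: cone_vec_def)
  then have "?x \<noteq> 0" by (metis zero_fun_apply zero_neq_one)
  note C = cone_flag_gen[OF V ab this cone_vec_zero_coordinate[of "flag_gen V" a j q \<zeta>, OF gen_a]]
  show "cone_point a j q V \<zeta> \<in> bounded_flags a b"
    unfolding cone_point_def by (rule C(1))
  show "tail_flag a (cone_point a j q V \<zeta>) = V"
    unfolding cone_point_def by (rule tail_cone_flag[OF V])
  obtain c where c: "c \<noteq> 0" "flag_gen (cone_point a j q V \<zeta>) = cscale c ?x"
    using C(2) unfolding cone_point_def by auto
  then show "flag_gen (cone_point a j q V \<zeta>) q \<noteq> 0"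
    and "flag_gen (cone_point a j q V \<zeta>) p / flag_gen (cone_point a j q V \<zeta>) q = \<zeta>"
    using x by (auto simp: cscale_def)
qed

lemma cone_point_tail:
  assumes U: "U \<in> bounded_flags a b" and ab: "a < b" and j: "flag_gen (tail_flag a U) j \<noteq> 0"
    and pq: "p = j \<and> q = a \<or> p = a \<and> q = j" and q: "flag_gen U q \<noteq> 0"
  shows "cone_point a j q (tail_flag a U) (flag_gen U p / flag_gen U q) = U"
proof -
  let ?V = "tail_flag a U"
  let ?x = "cone_vec a j q (flag_gen ?V) (flag_gen U p / flag_gen U q)"
  have "flag_gen ?V a = 0" by (rule flag_gen_Suc_zero[OF tail_flag_bounded[OF U ab] ab])
  then have ja: "j \<noteq> a" using j by auto
  obtain t where t: "(flag_gen U)(a := 0) = cscale t (flag_gen ?V)"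
    using flag_gen_tail[OF U ab] by auto
  have t': "flag_gen U i = t * flag_gen ?V i" if "i \<noteq> a" for i
    using fun_cong[OF t, of i] that by (simp add: cscale_def)
  \<comment> \<open>The cone vector is the generator divided by its coordinate \<open>q\<close>:
    away from \<open>a\<close> the coordinates are those of the tail generator times
    \<open>t\<close>.\<close>
  have "flag_gen U i = flag_gen U q * ?x i" for i
    using pq q j ja t'[of i] t'[of j] by (auto simp: cone_vec_def field_simps)
  then have "flag_gen U = cscale (flag_gen U q) ?x"
    unfolding cscale_def by (rule ext)
  then have "flag_gen U \<in> cvec.span {?x}" unfolding span_singleton_iff by (rule exI)
  then have "cvec.span {flag_gen U} = cvec.span {?x}"
    using flag_gen(1)[OF U] ab by (intro span_singleton_eq) auto
  then have "U 1 = cvec.span {?x}" using flag_gen(2)[OF U] ab by simp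
  then show ?thesis
    unfolding cone_point_def using cone_tail_flag[OF U ab] by simp
qed

lemma holo_map_on_zero_coordinate:
  fixes k :: nat
  assumes "open_in_cspace {..<d} Z"
  shows "holo_map_on {..<d} Z (\<lambda>z. z(k := 0))"
  unfolding holo_map_on_def
proof
  fix i
  show "holo_on {..<d} Z (\<lambda>z. (z(k := 0)) i)"
    using holo_on_coordinate[OF _ assms] holo_on_const[OF _ assms, of 0] by (cases "i = k") simp_all
qed

text \<open>Supplies the second row of the frame. The cone vector has coefficient 1 at
  \<open>basis_vec a\<close> in one chart and \<open>1 / y j\<close> at \<open>y\<close> in the
  other; the vector with this nonzero coefficient is recovered from the remaining one.\<close>

lemma span_cone_vec:
  assumes "y a = 0" "y j \<noteq> 0"
  shows "cvec.span {cone_vec a j q y \<zeta>, if q = a then y else basis_vec a} = cvec.span {basis_vec a, y}"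
proof -
  define x where "x = cone_vec a j q y \<zeta>"
  have x: "x = cscale (if q = a then 1 else \<zeta>) (basis_vec a) + cscale ((if q = a then \<zeta> else 1) / y j) y"
    using assms(1) by (auto simp: x_def cone_vec_def cscale_def basis_vec_def fun_eq_iff)
  then have xs: "x \<in> cvec.span {basis_vec a, y}" by (metis span_pair_iff)
  show ?thesis
  proof (cases "q = a")
    case True
    then have "basis_vec a = cscale 1 x + cscale (- \<zeta> / y j) y"
      unfolding x by (auto simp: cscale_def fun_eq_iff)
    then have "basis_vec a \<in> cvec.span {x, y}" by (metis span_pair_iff)
    then show ?thesis
      unfolding x_def[symmetric] using xs True by (simp add: cvec.span_eq cvec.span_base)
  next
    case False
    then have "y = cscale (y j) x + cscale (- \<zeta> * y j) (basis_vec a)"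
      unfolding x using assms(2) by (auto simp: cscale_def fun_eq_iff field_simps)
    then have "y \<in> cvec.span {x, basis_vec a}" by (metis span_pair_iff)
    then show ?thesis
      unfolding x_def[symmetric] using xs False by (simp add: cvec.span_eq cvec.span_base)
  qed
qed

text \<open>Both halves of the chart condition are inherited from the chart
  \<open>\<phi>\<^sub>0\<close> of the tail: the inverse lifts to frames through
  \<open>cone_frame\<close>, and the components are pulled back along \<open>tail_flag\<close>, with
  one coordinate ratio added. The new coordinate takes the index \<open>b - Suc a\<close>, the
  dimension of the tail manifold.\<close>

lemma cone_chart:
  assumes ab: "a < b"
    and ch: "(W\<^sub>0, \<phi>\<^sub>0) \<in> induced_flag_charts (Suc a) b (bounded_flags (Suc a) b) (b - Suc a)"
    and j: "j \<in> {Suc a..b}" and pq: "p = j \<and> q = a \<or> p = a \<and> q = j"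
    and W: "W = {U \<in> bounded_flags a b. tail_flag a U \<in> W\<^sub>0 \<and> flag_gen (tail_flag a U) j \<noteq> 0 \<and>
                 flag_gen U q \<noteq> 0}"
    and \<phi>: "\<And>U. U \<in> W \<Longrightarrow>
               \<phi> U = (\<phi>\<^sub>0 (tail_flag a U))(b - Suc a := flag_gen U p / flag_gen U q)"
  shows "(W, \<phi>) \<in> induced_flag_charts a b (bounded_flags a b) (b - a)"
proof -
  define k where "k = b - Suc a"
  have k: "b - a = Suc k" using ab by (simp add: k_def)
  note D = induced_flag_chartsD[OF ch, folded k_def]
  note \<phi> = \<phi>[folded k_def]
  define W' where "W' = W\<^sub>0 \<inter> {V \<in> bounded_flags (Suc a) b. flag_gen V j \<noteq> 0}"
  \<comment> \<open>The candidate for the inverse chart: the coordinates below \<open>k\<close> give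
    the tail and the last one gives the line. \<open>R\<close> turns out to be the image of
    \<open>\<phi>\<close>.\<close>
  define \<Psi> where "\<Psi> z = cone_point a j q (inv_into W\<^sub>0 \<phi>\<^sub>0 (z(k := 0))) (z k)" for z
  define R where "R = {z \<in> cspace {..<Suc k}. z(k := 0) \<in> \<phi>\<^sub>0 ` W'}"
  have \<phi>\<^sub>0_cspace: "\<phi>\<^sub>0 V \<in> cspace {..<k}" if "V \<in> W\<^sub>0" for V
    using open_in_cspace_subset[OF D(3)] that by auto
  have \<phi>_upd: "(\<phi> U)(k := 0) = \<phi>\<^sub>0 (tail_flag a U)" "\<phi> U k = flag_gen U p / flag_gen U q"
    if "U \<in> W" for U
  proof -
    have "\<phi>\<^sub>0 (tail_flag a U) k = 0"
      using \<phi>\<^sub>0_cspace[of "tail_flag a U"] that W by (auto simp: cspace_def)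
    then show "(\<phi> U)(k := 0) = \<phi>\<^sub>0 (tail_flag a U)" "\<phi> U k = flag_gen U p / flag_gen U q"
      using \<phi>[OF that] by (auto simp: fun_eq_iff)
  qed
  have tailW: "tail_flag a U \<in> W'" if "U \<in> W" for U
    using that D(1) by (auto simp: W W'_def)
  have \<Psi>_\<phi>: "\<Psi> (\<phi> U) = U" if "U \<in> W" for U
    using cone_point_tail[OF _ ab _ pq, of U] that tailW[OF that] D(2)
    by (simp add: \<Psi>_def \<phi>_upd W W'_def)
  have \<phi>_R: "\<phi> U \<in> R" if "U \<in> W" for U
  proof -
    have "\<phi> U \<in> cspace {..<Suc k}"
      using \<phi>\<^sub>0_cspace[of "tail_flag a U"] that W by (simp add: \<phi>[OF that] cspace_def)
    then show ?thesis
      using tailW[OF that] by (simp add: R_def \<phi>_upd[OF that])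
  qed
  have \<Psi>_W: "\<Psi> z \<in> W" and tail_\<Psi>: "tail_flag a (\<Psi> z) = inv_into W\<^sub>0 \<phi>\<^sub>0 (z(k := 0))"
    and \<phi>_\<Psi>: "\<phi> (\<Psi> z) = z" if z: "z \<in> R" for z
  proof -
    obtain V where V: "V \<in> W'" "z(k := 0) = \<phi>\<^sub>0 V" using z by (auto simp: R_def)
    then have inv: "inv_into W\<^sub>0 \<phi>\<^sub>0 (z(k := 0)) = V" using D(2) by (simp add: W'_def)
    have V': "V \<in> bounded_flags (Suc a) b" "flag_gen V j \<noteq> 0" "V \<in> W\<^sub>0"
      using V by (auto simp: W'_def)
    note C = cone_point[OF V'(1) ab V'(2) pq, of "z k"]
    show *: "\<Psi> z \<in> W" "tail_flag a (\<Psi> z) = inv_into W\<^sub>0 \<phi>\<^sub>0 (z(k := 0))"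
      using C V' by (auto simp: \<Psi>_def inv W)
    have "\<phi> (\<Psi> z) = (\<phi>\<^sub>0 V)(k := z k)"
      using \<phi>[OF *(1)] C by (simp add: \<Psi>_def inv)
    then show "\<phi> (\<Psi> z) = z" by (simp flip: V(2))
  qed
  have image: "\<phi> ` W = R"
    using \<phi>_R \<Psi>_W \<phi>_\<Psi> by force
  have inj: "inj_on \<phi> W"
    by (rule inj_on_inverseI[of W \<Psi> \<phi>, OF \<Psi>_\<phi>])
  have inv: "inv_into W \<phi> z = \<Psi> z" if "z \<in> R" for z
    using inv_into_f_f[OF inj \<Psi>_W[OF that]] \<phi>_\<Psi>[OF that] by simp
  have gen_holo: "frame_holo (Suc a) b {V \<in> bounded_flags (Suc a) b. flag_gen V j \<noteq> 0}
      (\<lambda>V. flag_gen V i / flag_gen V j)" for i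
    using ab by (intro frame_holo_gen_ratio) simp
  \<comment> \<open>Openness is extracted from holomorphy of a coordinate ratio, with an arbitrary
    numerator.\<close>
  have "open_in_cspace {..<k} (\<phi>\<^sub>0 ` W')"
    using holo_on_open[OF frame_holo_in_chart[OF ch gen_holo]] by (simp add: W'_def k_def Int_commute)
  moreover have upd_holo: "holo_map_on {..<Suc k} (cspace {..<Suc k}) (\<lambda>z. z(k := 0))"
    by (rule holo_map_on_zero_coordinate) simp
  moreover have upd_cspace: "(\<lambda>z. z(k := 0)) ` cspace {..<Suc k} \<subseteq> cspace {..<k}"
    by (auto simp: cspace_def less_Suc_eq)
  ultimately have open_R: "open_in_cspace {..<Suc k} R"
    unfolding R_def
    by (intro open_in_cspace_preimage[OF holo_map_on_imp_continuous_on]) auto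
  have lift: "\<exists>Z v. z \<in> Z \<and> Z \<subseteq> \<phi> ` W \<and> holo_map_on {..<Suc k} Z v \<and>
        (\<forall>w\<in>Z. is_frame a b (v w) (inv_into W \<phi> w))" if z: "z \<in> \<phi> ` W" for z
  proof -
    have "z(k := 0) \<in> \<phi>\<^sub>0 ` W\<^sub>0" using z unfolding image R_def W'_def by auto
    from D(4)[OF this] obtain Z\<^sub>0 v\<^sub>0 where Z\<^sub>0: "z(k := 0) \<in> Z\<^sub>0" and v\<^sub>0: "holo_map_on {..<k} Z\<^sub>0 v\<^sub>0"
      and fr: "\<And>w. w \<in> Z\<^sub>0 \<Longrightarrow> is_frame (Suc a) b (v\<^sub>0 w) (inv_into W\<^sub>0 \<phi>\<^sub>0 w)"
      by auto
    define Z where "Z = {w \<in> R. w(k := 0) \<in> Z\<^sub>0}"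
    have "(\<lambda>z. z(k := 0)) ` R \<subseteq> cspace {..<k}"
      using upd_cspace by (auto simp: R_def)
    moreover have "holo_on {..<k} Z\<^sub>0 (\<lambda>w. v\<^sub>0 w i)" for i
      using v\<^sub>0 unfolding holo_map_on_def by (rule spec)
    ultimately have v\<^sub>0_holo: "holo_on {..<Suc k} Z (\<lambda>w. v\<^sub>0 (w(k := 0)) i)" for i
      unfolding Z_def
      by (intro holo_on_compose[OF _ _ holo_map_on_zero_coordinate[OF open_R]]) simp_all
    have open_Z: "open_in_cspace {..<Suc k} Z"
      by (rule holo_on_open[OF v\<^sub>0_holo])
    \<comment> \<open>A generator of the tail line that, unlike \<open>flag_gen\<close>, varies
      holomorphically with \<open>w\<close>: the first row of the lifted frame, or the basis vector
      when that frame is empty.\<close>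
    define y where "y w = (if b = Suc a then basis_vec b else (\<lambda>i. v\<^sub>0 (w(k := 0)) (1, i)))" for w
    define v where "v w = cone_frame a b (cone_vec a j q (y w) (w k)) (if q = a then y w else basis_vec a)
        (v\<^sub>0 (w(k := 0)))" for w
    have y_gen: "\<exists>c. c \<noteq> 0 \<and> y w = cscale c (flag_gen (tail_flag a (\<Psi> w)))" if w: "w \<in> Z" for w
    proof (cases "b = Suc a")
      case True
      have V: "tail_flag a (\<Psi> w) \<in> bounded_flags (Suc a) b"
        using w tailW[OF \<Psi>_W] by (auto simp: Z_def W'_def)
      have "flag_gen (tail_flag a (\<Psi> w)) b \<noteq> 0"
        using w tailW[OF \<Psi>_W] j True by (auto simp: Z_def W'_def)
      moreover have "flag_gen (tail_flag a (\<Psi> w)) i = 0" if "i \<noteq> b" for i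
        using flag_gen(3)[OF V] True that by (auto simp: cspace_def)
      ultimately show ?thesis
        using True by (intro exI[of _ "inverse (flag_gen (tail_flag a (\<Psi> w)) b)"])
          (auto simp: y_def cscale_def basis_vec_def fun_eq_iff)
    next
      case False
      have V: "tail_flag a (\<Psi> w) \<in> bounded_flags (Suc a) b"
        using w tailW[OF \<Psi>_W] by (auto simp: Z_def W'_def)
      have "is_frame (Suc a) b (v\<^sub>0 (w(k := 0))) (tail_flag a (\<Psi> w))"
        using w fr tail_\<Psi> by (simp add: Z_def)
      from frame_first_row[OF V _ this] False ab show ?thesis
        by (auto simp: y_def cscale_def fun_eq_iff)
    qed
    have y_j: "y w j \<noteq> 0" if w: "w \<in> Z" for w
      using y_gen[OF w] w tailW[OF \<Psi>_W] by (auto simp: Z_def W'_def cscale_def)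
    have y_holo: "holo_on {..<Suc k} Z (\<lambda>w. y w i)" for i
      using v\<^sub>0_holo holo_on_const[OF _ open_Z] by (cases "b = Suc a") (simp_all add: y_def)
    have "holo_on {..<Suc k} Z (\<lambda>w. v w (l, i))" for l i
    proof -
      have 1: "holo_on {..<Suc k} Z (\<lambda>w. cone_vec a j q (y w) (w k) i)"
      proof -
        have "holo_on {..<Suc k} Z (\<lambda>w. y w i / y w j)"
          using y_holo y_j by (intro holo_on_divide) auto
        moreover have "holo_on {..<Suc k} Z (\<lambda>w. w k)"
          by (intro holo_on_coordinate open_Z) simp
        ultimately show ?thesis
          using holo_on_const[OF _ open_Z, of 1] holo_on_mult[of "{..<Suc k}" Z "\<lambda>w. w k" "\<lambda>w. y w i / y w j"]
          by (cases "i = a"; cases "q = a") (simp_all add: cone_vec_def)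
      qed
      have 2: "holo_on {..<Suc k} Z (\<lambda>w. (if q = a then y w else basis_vec a) i)"
        using y_holo holo_on_const[OF _ open_Z] by (cases "q = a") simp_all
      show ?thesis
        using 1 2 v\<^sub>0_holo holo_on_const[OF _ open_Z, of 0]
        by (cases "(l, i) \<in> frame_coords a b"; cases "l = 1"; cases "l = 2")
          (simp_all add: v_def cone_frame_def)
    qed
    then have "holo_map_on {..<Suc k} Z v"
      by (auto simp: holo_map_on_def)
    moreover have "is_frame a b (v w) (inv_into W \<phi> w)" if w: "w \<in> Z" for w
    proof -
      have wR: "w \<in> R" using w by (simp add: Z_def)
      define V where "V = tail_flag a (\<Psi> w)"
      have V: "V \<in> bounded_flags (Suc a) b" using tailW[OF \<Psi>_W[OF wR]] by (simp add: W'_def V_def)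
      obtain c where c: "c \<noteq> 0" "y w = cscale c (flag_gen V)" using y_gen[OF w] by (auto simp: V_def)
      have y_cs: "y w \<in> cspace {Suc a..b}"
        using flag_gen(3)[OF V] ab c by (auto simp: cspace_def cscale_def)
      then have y_a: "y w a = 0" by (auto simp: cspace_def)
      have y_ne: "y w \<noteq> 0" using y_j[OF w] by (metis zero_fun_apply)
      have "V 1 = cvec.span {flag_gen V}" using flag_gen(2)[OF V] ab by simp
      also have "\<dots> = cvec.span {y w}"
        by (rule span_singleton_eq[symmetric]) (use c y_ne in \<open>auto simp: span_singleton_iff\<close>)
      finally have V1: "V 1 = cvec.span {y w}" .
      have "cone_vec a j q (y w) (w k) \<in> cspace {a..b}" "(if q = a then y w else basis_vec a) \<in> cspace {a..b}"
        using y_cs ab by (auto simp: cspace_def cone_vec_def basis_vec_def)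
      moreover have "is_frame (Suc a) b (v\<^sub>0 (w(k := 0))) V"
        using w fr tail_\<Psi>[OF wR] by (simp add: V_def Z_def)
      ultimately have "is_frame a b (v w) (cone_flag a (cvec.span {cone_vec a j q (y w) (w k)}) V)"
        unfolding v_def using V ab V1 span_cone_vec[OF y_a y_j[OF w]] by (intro is_frame_cone) auto
      \<comment> \<open>Invariance under scaling replaces \<open>y w\<close> by the chosen generator
        in the cone vector.\<close>
      then show ?thesis
        using cone_vec_cscale[OF c(1)] tail_\<Psi>[OF wR] unfolding inv[OF wR] \<Psi>_def cone_point_def c(2) V_def
        by simp
    qed
    ultimately show ?thesis
      using z Z\<^sub>0 unfolding image by (intro exI[of _ Z] exI[of _ v]) (auto simp: Z_def)
  qed
  have F1: "frame_holo (Suc a) b W' (\<lambda>V. \<phi>\<^sub>0 V i)" for i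
    unfolding W'_def by (rule frame_holo_Int[OF chart_frame_holo[OF ch] gen_holo])
  have W_eq: "W = {U \<in> bounded_flags a b. tail_flag a U \<in> W'} \<inter> {U \<in> bounded_flags a b. flag_gen U q \<noteq> 0}"
    using tail_flag_bounded[OF _ ab] by (auto simp: W W'_def)
  have ratio: "frame_holo a b {U \<in> bounded_flags a b. flag_gen U q \<noteq> 0} (\<lambda>U. flag_gen U p / flag_gen U q)"
    using ab by (intro frame_holo_gen_ratio) simp
  have "frame_holo a b W (\<lambda>U. \<phi> U i)" for i
  proof (cases "i = k")
    case True
    \<comment> \<open>The intersection is turned around because \<open>frame_holo_Int\<close> keeps
      the function on its first set.\<close>
    have "frame_holo a b W (\<lambda>U. flag_gen U p / flag_gen U q)"
      unfolding W_eq Int_commute[of _ "{U \<in> bounded_flags a b. flag_gen U q \<noteq> 0}"]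
      by (rule frame_holo_Int[OF ratio frame_holo_tail[OF F1 ab]])
    then show ?thesis by (rule frame_holo_cong) (simp add: True \<phi>_upd)
  next
    case False
    have "frame_holo a b W (\<lambda>U. \<phi>\<^sub>0 (tail_flag a U) i)"
      unfolding W_eq by (rule frame_holo_Int[OF frame_holo_tail[OF F1 ab] ratio])
    then show ?thesis by (rule frame_holo_cong) (simp add: False \<phi>)
  qed
  moreover have "\<phi> U \<in> cspace {..<Suc k}" if "U \<in> W" for U
    using \<phi>_R[OF that] by (simp add: R_def)
  ultimately have G: "\<exists>N G. v \<in> N \<and> holo_map_on (frame_coords a b) N G \<and>
           (\<forall>v'\<in>N. \<forall>U'\<in>bounded_flags a b. is_frame a b v' U' \<longrightarrow> U' \<in> W \<and> \<phi> U' = G v')"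
    if "U \<in> W" "is_frame a b v U" for U v
    using that by (rule frame_holo_map)
  have "W \<subseteq> bounded_flags a b" by (auto simp: W)
  then show ?thesis
    unfolding induced_flag_charts_def k mem_Collect_eq case_prod_conv
    using inj open_R[folded image] lift G by (intro conjI ballI allI impI)
qed

section \<open>The complex manifold of bounded flags\<close>

lemma bounded_flag_manifold_simps [simp]:
  "pts (bounded_flag_manifold a b) = bounded_flags a b"
  "cdim (bounded_flag_manifold a b) = b - a"
  "charts (bounded_flag_manifold a b) = induced_flag_charts a b (bounded_flags a b) (b - a)"
  by (simp_all add: bounded_flag_manifold_def)

text \<open>Injectivity of the charts gives closure under intersections, as images then commute with
  them.\<close>

lemma openin_manifold_topology:
  assumes inj: "\<And>W \<phi>. (W, \<phi>) \<in> charts M \<Longrightarrow> inj_on \<phi> W"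
  shows "openin (manifold_topology M) S \<longleftrightarrow> S \<subseteq> pts M \<and>
     (\<forall>(W, \<phi>)\<in>charts M. open_in_cspace (model_coords M) (\<phi> ` (S \<inter> W)))"
proof -
  let ?P = "\<lambda>S. S \<subseteq> pts M \<and> (\<forall>(W, \<phi>)\<in>charts M. open_in_cspace (model_coords M) (\<phi> ` (S \<inter> W)))"
  have "istopology ?P"
    unfolding istopology_def
  proof (intro conjI allI impI)
    fix S T assume S: "?P S" and T: "?P T"
    show "S \<inter> T \<subseteq> pts M" using S by auto
    show "\<forall>(W, \<phi>)\<in>charts M. open_in_cspace (model_coords M) (\<phi> ` (S \<inter> T \<inter> W))"
    proof (rule ballI, rule case_prodI2)
      fix c W \<phi> assume c: "c \<in> charts M" "c = (W, \<phi>)"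
      have "S \<inter> T \<inter> W = (S \<inter> W) \<inter> (T \<inter> W)" by auto
      also have "\<phi> ` \<dots> = \<phi> ` (S \<inter> W) \<inter> \<phi> ` (T \<inter> W)"
        using inj[of W \<phi>] c by (intro inj_on_image_Int[of \<phi> W]) auto
      finally have eq: "\<phi> ` (S \<inter> T \<inter> W) = \<phi> ` (S \<inter> W) \<inter> \<phi> ` (T \<inter> W)" .
      show "open_in_cspace (model_coords M) (\<phi> ` (S \<inter> T \<inter> W))"
        unfolding eq using S T c by (intro openin_Int) auto
    qed
  next
    fix K assume K: "\<forall>S\<in>K. ?P S"
    show "\<Union>K \<subseteq> pts M" using K by auto
    show "\<forall>(W, \<phi>)\<in>charts M. open_in_cspace (model_coords M) (\<phi> ` (\<Union>K \<inter> W))"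
    proof (rule ballI, rule case_prodI2)
      fix c W \<phi> assume c: "c \<in> charts M" "c = (W, \<phi>)"
      have eq: "\<phi> ` (\<Union>K \<inter> W) = (\<Union>S\<in>K. \<phi> ` (S \<inter> W))" by auto
      show "open_in_cspace (model_coords M) (\<phi> ` (\<Union>K \<inter> W))"
        unfolding eq using K c by (intro openin_Union) auto
    qed
  qed
  then show ?thesis
    unfolding manifold_topology_def by (simp add: topology_inverse')
qed

lemma openin_bounded_flag_manifold:
  "openin (manifold_topology (bounded_flag_manifold a b)) S \<longleftrightarrow> S \<subseteq> bounded_flags a b \<and>
     (\<forall>(W, \<phi>)\<in>induced_flag_charts a b (bounded_flags a b) (b - a).
        open_in_cspace {..<b - a} (\<phi> ` (S \<inter> W)))"
  by (subst openin_manifold_topology) (auto dest: induced_flag_chartsD(2))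

lemma openin_if_frame_holo:
  assumes "frame_holo a b S F"
  shows "openin (manifold_topology (bounded_flag_manifold a b)) S"
  unfolding openin_bounded_flag_manifold
  using assms holo_on_open[OF frame_holo_in_chart[OF _ assms]] by (auto simp: frame_holo_def)

text \<open>Near a frame the chart is a continuous function of the frame.\<close>

lemma chart_preimage_frame_holo:
  assumes ch: "(W, \<phi>) \<in> induced_flag_charts a b (bounded_flags a b) d" and T: "open T"
  shows "frame_holo a b {U \<in> W. \<phi> U \<in> T} (\<lambda>_. 0)"
proof (rule frame_holoI)
  note D = induced_flag_chartsD[OF ch]
  show "{U \<in> W. \<phi> U \<in> T} \<subseteq> bounded_flags a b" using D(1) by auto
  fix U v assume U: "U \<in> {U \<in> W. \<phi> U \<in> T}" and v: "is_frame a b v U"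
  then have "U \<in> W" by simp
  from D(5)[OF this v] obtain N G where N: "v \<in> N" "holo_map_on (frame_coords a b) N G"
    and NG: "\<And>v' U'. v' \<in> N \<Longrightarrow> U' \<in> bounded_flags a b \<Longrightarrow> is_frame a b v' U' \<Longrightarrow> U' \<in> W \<and> \<phi> U' = G v'"
    by auto
  define N' where "N' = {v \<in> N. G v \<in> T}"
  have "open_in_cspace (frame_coords a b) N'"
    unfolding N'_def using T
    by (intro open_in_cspace_preimage_open holo_map_on_imp_continuous_on[OF _ N(2)] holo_map_on_open[OF N(2)]) auto
  then have "holo_on (frame_coords a b) N' (\<lambda>_. 0)" by (intro holo_on_const) auto
  moreover have "v \<in> N'"
    using NG[OF N(1) _ v] U D(1) N(1) by (auto simp: N'_def)
  moreover have "U' \<in> {U \<in> W. \<phi> U \<in> T}" if "v' \<in> N'" "U' \<in> bounded_flags a b" "is_frame a b v' U'" for v' U'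
    using NG[OF _ that(2,3)] that(1) by (simp add: N'_def)
  ultimately show "\<exists>N G. v \<in> N \<and> holo_on (frame_coords a b) N G \<and>
      (\<forall>v'\<in>N. \<forall>U'\<in>bounded_flags a b. is_frame a b v' U' \<longrightarrow> U' \<in> {U \<in> W. \<phi> U \<in> T} \<and> 0 = G v')"
    by (intro exI[of _ N'] exI[of _ "\<lambda>_. 0"]) blast
qed

text \<open>The transition map passes through frames: lift by the first chart, then evaluate the
  second on frames. No two explicit cone charts have to be compared.\<close>

lemma chart_transition:
  assumes "(W, \<phi>) \<in> induced_flag_charts a b (bounded_flags a b) d"
    and "(W', \<phi>') \<in> induced_flag_charts a b (bounded_flags a b) d'"
  shows "holo_map_on {..<d} (\<phi> ` (W \<inter> W')) (\<lambda>z. \<phi>' (inv_into W \<phi> z))"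
  unfolding holo_map_on_def
  using frame_holo_in_chart[OF assms(1) chart_frame_holo[OF assms(2)]] by (simp add: Int_commute)

lemma point_chart:
  "(bounded_flags b b, \<lambda>_ _. 0) \<in> induced_flag_charts b b (bounded_flags b b) (b - b)"
proof -
  define U where "U = (\<lambda>i :: nat. if i = 0 then {0} else cspace {b})"
  have B: "bounded_flags b b = {U}" using bounded_flags_same by (auto simp: U_def)
  have cs: "cspace {..<0} = {\<lambda>_ :: nat. 0 :: complex}" by (auto simp: cspace_def)
  have op: "open_in_cspace {..<0} {\<lambda>_ :: nat. 0 :: complex}"
    unfolding cs[symmetric] by simp
  have fr: "is_frame b b 0 U" by (simp add: is_frame_same B)
  have F: "frame_holo b b {U} (\<lambda>_. 0)" by (rule frame_holo_same) (simp add: B)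
  have G: "\<exists>N G. v \<in> N \<and> holo_map_on (frame_coords b b) N G \<and>
      (\<forall>v'\<in>N. \<forall>U'\<in>bounded_flags b b. is_frame b b v' U' \<longrightarrow> U' \<in> {U} \<and> (\<lambda>_ :: nat. 0) = G v')"
    if "is_frame b b v U" for v
    by (rule frame_holo_map[of 0 b b "{U}" "\<lambda>_ _. 0" U v]) (use that F in \<open>auto simp: cspace_def\<close>)
  have "holo_map_on {..<0} {\<lambda>_ :: nat. 0 :: complex} (\<lambda>_. 0 :: nat \<times> nat \<Rightarrow> complex)"
    using holo_on_const[OF _ op, of 0] by (simp add: holo_map_on_def)
  then have Z: "\<exists>Z v. (\<lambda>_ :: nat. 0) \<in> Z \<and> Z \<subseteq> (\<lambda>_ _. 0) ` {U} \<and> holo_map_on {..<0} Z v \<and>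
      (\<forall>w\<in>Z. is_frame b b (v w) (inv_into {U} (\<lambda>_ _. 0) w))"
    using fr by (intro exI[of _ "{\<lambda>_. 0}"] exI[of _ "\<lambda>_. 0"]) (auto simp: inv_into_def)
  show ?thesis
    unfolding induced_flag_charts_def mem_Collect_eq case_prod_conv diff_self_eq_0 B[symmetric]
    unfolding B using op Z G[unfolded B] by simp
qed

text \<open>Besides coverage, finiteness is recorded for the sake of second countability. A flag is
  covered because its tail generator has a nonzero coordinate \<open>j\<close>, and one of the
  coordinates \<open>a\<close> and \<open>j\<close> of its own generator is then nonzero.\<close>

lemma bounded_flag_atlas:
  assumes "a \<le> b"
  shows "\<exists>C. finite C \<and> C \<subseteq> induced_flag_charts a b (bounded_flags a b) (b - a) \<and>
             (\<Union>(W, \<phi>)\<in>C. W) = bounded_flags a b"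
  using assms
proof (induction a rule: inc_induct)
  case base
  show ?case
    using point_chart[of b] by (intro exI[of _ "{(bounded_flags b b, \<lambda>_ _. 0)}"]) simp
next
  case (step a)
  then have ab: "a < b" by simp
  from step.IH obtain C where C: "finite C" "C \<subseteq> induced_flag_charts (Suc a) b (bounded_flags (Suc a) b) (b - Suc a)"
    "(\<Union>(W, \<phi>)\<in>C. W) = bounded_flags (Suc a) b" by auto
  define A where "A = (\<lambda>((W, \<phi>), j, p, q).
     ({U \<in> bounded_flags a b. tail_flag a U \<in> W \<and> flag_gen (tail_flag a U) j \<noteq> 0 \<and> flag_gen U q \<noteq> 0},
      \<lambda>U. (\<phi> (tail_flag a U))(b - Suc a := flag_gen U p / flag_gen U q)))"
  \<comment> \<open>The triples \<open>(j, p, q)\<close> of the two affine charts for each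
    \<open>j\<close>.\<close>
  define J where "J = (\<Union>j\<in>{Suc a..b}. {(j, j, a), (j, a, j)})"
  have "A x \<in> induced_flag_charts a b (bounded_flags a b) (b - a)" if x: "x \<in> C \<times> J" for x
  proof -
    obtain W \<phi> j p q where xe: "x = ((W, \<phi>), j, p, q)" by (metis surj_pair)
    with x C(2) have "(W, \<phi>) \<in> induced_flag_charts (Suc a) b (bounded_flags (Suc a) b) (b - Suc a)"
      "j \<in> {Suc a..b}" "p = j \<and> q = a \<or> p = a \<and> q = j"
      by (auto simp: J_def)
    from cone_chart[OF ab this refl refl] show ?thesis unfolding xe A_def by simp
  qed
  moreover have "(\<Union>(W, \<phi>)\<in>A ` (C \<times> J). W) = bounded_flags a b"
  proof
    show "(\<Union>(W, \<phi>)\<in>A ` (C \<times> J). W) \<subseteq> bounded_flags a b"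
      by (auto simp: A_def)
    show "bounded_flags a b \<subseteq> (\<Union>(W, \<phi>)\<in>A ` (C \<times> J). W)"
    proof
      fix U assume U: "U \<in> bounded_flags a b"
      note V = tail_flag_bounded[OF U ab]
      have "tail_flag a U \<in> (\<Union>(W, \<phi>)\<in>C. W)" unfolding C(3) by (rule V)
      then obtain W \<phi> where W: "(W, \<phi>) \<in> C" "tail_flag a U \<in> W" by auto
      obtain j where j: "flag_gen (tail_flag a U) j \<noteq> 0"
        using flag_gen(1)[OF V] ab by (auto simp: fun_eq_iff)
      then have jr: "j \<in> {Suc a..b}" using flag_gen(3)[OF V] ab by (auto simp: cspace_def)
      \<comment> \<open>Vanishing of both would force the scalar \<open>t\<close>, and with it the
        whole generator, to vanish.\<close>
      have "flag_gen U a \<noteq> 0 \<or> flag_gen U j \<noteq> 0"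
      proof (rule ccontr)
        assume *: "\<not> ?thesis"
        obtain t where t: "(flag_gen U)(a := 0) = cscale t (flag_gen (tail_flag a U))"
          using flag_gen_tail[OF U ab] by auto
        have "t = 0" using fun_cong[OF t, of j] jr j * by (auto simp: cscale_def)
        then have "flag_gen U i = 0" for i
          using fun_cong[OF t, of i] * by (cases "i = a") (auto simp: cscale_def)
        then show False using flag_gen(1)[OF U] ab by (auto simp: fun_eq_iff)
      qed
      moreover have "(j, j, a) \<in> J" "(j, a, j) \<in> J" using jr by (auto simp: J_def)
      ultimately obtain p q where "(j, p, q) \<in> J" "flag_gen U q \<noteq> 0" by blast
      then have "((W, \<phi>), j, p, q) \<in> C \<times> J"
        "U \<in> (case A ((W, \<phi>), j, p, q) of (W, \<phi>) \<Rightarrow> W)"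
        using U W j by (simp_all add: A_def)
      then show "U \<in> (\<Union>(W, \<phi>)\<in>A ` (C \<times> J). W)"
        by (intro UN_I[of "A ((W, \<phi>), j, p, q)"] imageI)
    qed
  qed
  moreover have "finite (A ` (C \<times> J))"
    using C(1) by (auto simp: J_def)
  ultimately show ?case
    by (intro exI[of _ "A ` (C \<times> J)"]) auto
qed

text \<open>The forward direction needs a chart at every flag: there the set contains the chart
  preimage of an open set. It allows open sets to be pulled back along
  \<open>tail_flag\<close>.\<close>

lemma openin_iff_frame_holo:
  assumes ab: "a \<le> b"
  shows "openin (manifold_topology (bounded_flag_manifold a b)) S \<longleftrightarrow> frame_holo a b S (\<lambda>_. 0)"
proof
  assume S: "openin (manifold_topology (bounded_flag_manifold a b)) S"
  show "frame_holo a b S (\<lambda>_. 0)"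
  proof (rule frame_holoI)
    show "S \<subseteq> bounded_flags a b" using S by (simp add: openin_bounded_flag_manifold)
    fix U v assume U: "U \<in> S" and v: "is_frame a b v U"
    obtain C where C: "C \<subseteq> induced_flag_charts a b (bounded_flags a b) (b - a)"
      "(\<Union>(W, \<phi>)\<in>C. W) = bounded_flags a b"
      using bounded_flag_atlas[OF ab] by auto
    have "U \<in> (\<Union>(W, \<phi>)\<in>C. W)" unfolding C(2) using U \<open>S \<subseteq> bounded_flags a b\<close> by auto
    then obtain W \<phi> where ch: "(W, \<phi>) \<in> induced_flag_charts a b (bounded_flags a b) (b - a)" and UW: "U \<in> W"
      using C(1) by auto
    note D = induced_flag_chartsD[OF ch]
    have "open_in_cspace {..<b - a} (\<phi> ` (S \<inter> W))"
      using S ch by (auto simp: openin_bounded_flag_manifold)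
    then obtain T where T: "open T" "\<phi> ` (S \<inter> W) = cspace {..<b - a} \<inter> T"
      by (auto simp: openin_open)
    have sub: "U' \<in> S" if "U' \<in> W" "\<phi> U' \<in> T" for U'
    proof -
      have "\<phi> U' \<in> \<phi> ` (S \<inter> W)"
        using that T(2) open_in_cspace_subset[OF D(3)] by auto
      then show ?thesis using D(2) that(1) by (auto simp: inj_on_def)
    qed
    have "U \<in> {U \<in> W. \<phi> U \<in> T}" using U UW T(2) by auto
    then obtain N G where N: "v \<in> N" "holo_on (frame_coords a b) N G"
      and NG: "\<And>v' U'. v' \<in> N \<Longrightarrow> U' \<in> bounded_flags a b \<Longrightarrow> is_frame a b v' U' \<Longrightarrow>
        U' \<in> {U \<in> W. \<phi> U \<in> T} \<and> 0 = G v'"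
      using v by (rule frame_holoE[OF chart_preimage_frame_holo[OF ch T(1)]]) auto
    have "U' \<in> S \<and> 0 = G v'" if "v' \<in> N" "U' \<in> bounded_flags a b" "is_frame a b v' U'" for v' U'
      using NG[OF that] sub by simp
    with N show "\<exists>N G. v \<in> N \<and> holo_on (frame_coords a b) N G \<and>
        (\<forall>v'\<in>N. \<forall>U'\<in>bounded_flags a b. is_frame a b v' U' \<longrightarrow> U' \<in> S \<and> 0 = G v')"
      by blast
  qed
qed (rule openin_if_frame_holo)

lemma topspace_bounded_flag_manifold:
  "topspace (manifold_topology (bounded_flag_manifold a b)) = bounded_flags a b"
proof
  let ?X = "manifold_topology (bounded_flag_manifold a b)"
  show "topspace ?X \<subseteq> bounded_flags a b"
    using openin_topspace[of ?X] unfolding openin_bounded_flag_manifold by (rule conjunct1)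
  have "openin ?X (bounded_flags a b)"
    unfolding openin_bounded_flag_manifold
  proof (intro conjI ballI case_prodI2)
    fix c W \<phi> assume "c \<in> induced_flag_charts a b (bounded_flags a b) (b - a)" "c = (W, \<phi>)"
    then have ch: "(W, \<phi>) \<in> induced_flag_charts a b (bounded_flags a b) (b - a)" by simp
    have "bounded_flags a b \<inter> W = W" using induced_flag_chartsD(1)[OF ch] by auto
    then show "open_in_cspace {..<b - a} (\<phi> ` (bounded_flags a b \<inter> W))"
      using induced_flag_chartsD(3)[OF ch] by simp
  qed simp
  then show "bounded_flags a b \<subseteq> topspace ?X" by (rule openin_subset)
qed

text \<open>The preimages of a countable basis of the ambient function space under finitely many
  charts form a basis.\<close>

lemma second_countable_bounded_flag_manifold:
  assumes "a \<le> b"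
  shows "second_countable (manifold_topology (bounded_flag_manifold a b))"
proof -
  let ?X = "manifold_topology (bounded_flag_manifold a b)"
  obtain C where C: "finite C" "C \<subseteq> induced_flag_charts a b (bounded_flags a b) (b - a)"
    "(\<Union>(W, \<phi>)\<in>C. W) = bounded_flags a b"
    using bounded_flag_atlas[OF assms] by auto
  obtain B :: "(nat \<Rightarrow> complex) set set" where B: "countable B" "topological_basis B"
    using ex_countable_basis by auto
  define \<B> where "\<B> = (\<lambda>((W, \<phi>), T). {U \<in> W. \<phi> U \<in> T}) ` (C \<times> B)"
  have "countable \<B>"
    unfolding \<B>_def by (intro countable_image countable_SIGMA countable_finite[OF C(1)] B(1))
  moreover have "openin ?X V" if V: "V \<in> \<B>" for V
  proof -
    obtain W \<phi> T where V: "(W, \<phi>) \<in> C" "T \<in> B" "V = {U \<in> W. \<phi> U \<in> T}"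
      using V by (auto simp: \<B>_def)
    have "open T" using B(2) V(2) by (rule topological_basis_open)
    then show ?thesis
      unfolding V(3) using C(2) V(1) by (intro openin_if_frame_holo[OF chart_preimage_frame_holo]) auto
  qed
  moreover have "\<exists>V\<in>\<B>. U \<in> V \<and> V \<subseteq> S" if S: "openin ?X S" and U: "U \<in> S" for S U
  proof -
    have "U \<in> bounded_flags a b" using S U by (auto simp: openin_bounded_flag_manifold)
    then obtain W \<phi> where W: "(W, \<phi>) \<in> C" "U \<in> W" unfolding C(3)[symmetric] by auto
    then have ch: "(W, \<phi>) \<in> induced_flag_charts a b (bounded_flags a b) (b - a)" using C(2) by auto
    note D = induced_flag_chartsD[OF ch]
    have "open_in_cspace {..<b - a} (\<phi> ` (S \<inter> W))"
      using S ch by (auto simp: openin_bounded_flag_manifold)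
    then obtain T where T: "open T" "\<phi> ` (S \<inter> W) = cspace {..<b - a} \<inter> T"
      by (auto simp: openin_open)
    have "\<phi> U \<in> T" using T(2) U W(2) by auto
    then obtain T' where T': "T' \<in> B" "\<phi> U \<in> T'" "T' \<subseteq> T"
      using topological_basisE[OF B(2) T(1)] by metis
    have "{U \<in> W. \<phi> U \<in> T'} \<subseteq> S"
    proof
      fix U' assume U': "U' \<in> {U \<in> W. \<phi> U \<in> T'}"
      then have "\<phi> U' \<in> \<phi> ` (S \<inter> W)"
        using T'(3) T(2) open_in_cspace_subset[OF D(3)] by auto
      then show "U' \<in> S" using D(2) U' by (auto simp: inj_on_def)
    qed
    moreover have "{U \<in> W. \<phi> U \<in> T'} \<in> \<B>"
      unfolding \<B>_def by (rule image_eqI[of _ _ "((W, \<phi>), T')"]) (use W T' in auto)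
    ultimately show ?thesis using W(2) T'(2) by (intro bexI[of _ "{U \<in> W. \<phi> U \<in> T'}"]) auto
  qed
  ultimately show ?thesis
    unfolding second_countable_def by (intro exI[of _ \<B>]) auto
qed

text \<open>Flags with different tails are separated by preimages under \<open>tail_flag\<close>. If
  the tails agree, the first lines differ, so their generators have a nonzero minor, by which the
  lines are separated.\<close>

lemma Hausdorff_bounded_flag_manifold:
  assumes "a \<le> b"
  shows "Hausdorff_space (manifold_topology (bounded_flag_manifold a b))"
  using assms
proof (induction a rule: inc_induct)
  case base
  have "x = y" if "x \<in> topspace (manifold_topology (bounded_flag_manifold b b))"
    "y \<in> topspace (manifold_topology (bounded_flag_manifold b b))" for x y
    using that by (simp add: topspace_bounded_flag_manifold bounded_flags_same)
  then show ?case unfolding Hausdorff_space_def by blast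
next
  case (step a)
  then have ab: "a < b" by simp
  let ?X = "manifold_topology (bounded_flag_manifold a b)"
  let ?Y = "manifold_topology (bounded_flag_manifold (Suc a) b)"
  show ?case
    unfolding Hausdorff_space_def
  proof (intro allI impI)
    fix U U' assume "U \<in> topspace ?X \<and> U' \<in> topspace ?X \<and> U \<noteq> U'"
    then have U: "U \<in> bounded_flags a b" "U' \<in> bounded_flags a b" "U \<noteq> U'"
      by (auto simp: topspace_bounded_flag_manifold)
    show "\<exists>S S'. openin ?X S \<and> openin ?X S' \<and> U \<in> S \<and> U' \<in> S' \<and> disjnt S S'"
    proof (cases "tail_flag a U = tail_flag a U'")
      case False
      have "tail_flag a U \<in> topspace ?Y" "tail_flag a U' \<in> topspace ?Y"
        unfolding topspace_bounded_flag_manifold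
        using tail_flag_bounded[OF U(1) ab] tail_flag_bounded[OF U(2) ab] by auto
      then obtain S S' where S: "openin ?Y S" "openin ?Y S'" "tail_flag a U \<in> S" "tail_flag a U' \<in> S'" "disjnt S S'"
        using step.IH False unfolding Hausdorff_space_def by metis
      have pre: "openin ?X {U \<in> bounded_flags a b. tail_flag a U \<in> T}" if "openin ?Y T" for T
        using that openin_iff_frame_holo[of "Suc a" b T] ab
        by (intro openin_if_frame_holo[OF frame_holo_tail]) auto
      show ?thesis
        using S U pre[OF S(1)] pre[OF S(2)]
        by (intro exI[of _ "{U \<in> bounded_flags a b. tail_flag a U \<in> S}"]
             exI[of _ "{U \<in> bounded_flags a b. tail_flag a U \<in> S'}"]) (auto simp: disjnt_def)
    next
      case True
      then have "U 1 \<noteq> U' 1" using bounded_flag_eqI[OF U(1,2) ab] U(3) by auto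
      define x y where "x = flag_gen U" and "y = flag_gen U'"
      have xy: "x \<noteq> 0" "y \<noteq> 0" "cvec.span {x} \<noteq> cvec.span {y}"
        using flag_gen(1,2)[OF U(1)] flag_gen(1,2)[OF U(2)] ab \<open>U 1 \<noteq> U' 1\<close> by (auto simp: x_def y_def)
      have "\<exists>r s. x r * y s \<noteq> x s * y r"
      proof (rule ccontr)
        assume *: "\<nexists>r s. x r * y s \<noteq> x s * y r"
        obtain s where s: "y s \<noteq> 0" using xy(2) by (auto simp: fun_eq_iff)
        have "x r = x s / y s * y r" for r
          using * s by (auto simp: field_simps)
        then have "x = cscale (x s / y s) y" unfolding cscale_def by (rule ext)
        then have "x \<in> cvec.span {y}" unfolding span_singleton_iff by (rule exI)
        then show False using span_singleton_eq xy by auto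
      qed
      then obtain r s where rs: "x r * y s \<noteq> x s * y r" by auto
      \<comment> \<open>For \<open>x\<close> and \<open>y\<close> inserted in this order: the flags
        whose \<open>r\<close>, \<open>s\<close> minor with \<open>x\<close> is smaller than that
        with \<open>y\<close>. At \<open>U\<close> the former is 0; exchanging \<open>x\<close> and
        \<open>y\<close> reverses the strict inequality, hence disjointness.\<close>
      define S where "S c d c' d' = {U \<in> bounded_flags a b.
        cmod (flag_gen U r * c - flag_gen U s * d) < cmod (flag_gen U r * c' - flag_gen U s * d')}" for c d c' d'
      have op: "openin ?X (S c d c' d')" for c d c' d'
        unfolding S_def using ab by (intro openin_if_frame_holo[OF frame_holo_gen_less]) simp
      have "U \<in> S (x s) (x r) (y s) (y r)" "U' \<in> S (y s) (y r) (x s) (x r)"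
        using U rs unfolding S_def x_def y_def by (simp_all add: mult.commute)
      moreover have "disjnt (S (x s) (x r) (y s) (y r)) (S (y s) (y r) (x s) (x r))"
        by (auto simp: disjnt_def S_def)
      ultimately show ?thesis
        using op[of "x s" "x r" "y s" "y r"] op[of "y s" "y r" "x s" "x r"]
        by (intro exI[of _ "S (x s) (x r) (y s) (y r)"] exI[of _ "S (y s) (y r) (x s) (x r)"] conjI)
    qed
  qed
qed

lemma complex_manifold_bounded_flag_manifold:
  assumes "a \<le> b"
  shows "complex_manifold (bounded_flag_manifold a b)"
  unfolding complex_manifold_def bounded_flag_manifold_simps
proof (intro conjI)
  let ?C = "induced_flag_charts a b (bounded_flags a b) (b - a)"
  show "\<forall>(W, \<phi>)\<in>?C. W \<subseteq> bounded_flags a b \<and> inj_on \<phi> W \<and> open_in_cspace {..<b - a} (\<phi> ` W)"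
  proof (intro ballI case_prodI2)
    fix c W \<phi> assume "c \<in> ?C" "c = (W, \<phi>)"
    then have ch: "(W, \<phi>) \<in> ?C" by simp
    show "W \<subseteq> bounded_flags a b \<and> inj_on \<phi> W \<and> open_in_cspace {..<b - a} (\<phi> ` W)"
      by (intro conjI induced_flag_chartsD(1-3)[OF ch])
  qed
  show "(\<Union>(W, \<phi>)\<in>?C. W) = bounded_flags a b"
  proof
    show "(\<Union>(W, \<phi>)\<in>?C. W) \<subseteq> bounded_flags a b"
      by (rule UN_least) (auto dest: induced_flag_chartsD(1))
    obtain C where "C \<subseteq> ?C" "(\<Union>(W, \<phi>)\<in>C. W) = bounded_flags a b"
      using bounded_flag_atlas[OF assms] by auto
    then show "bounded_flags a b \<subseteq> (\<Union>(W, \<phi>)\<in>?C. W)"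
      using UN_mono[of C ?C "\<lambda>(W, \<phi>). W"] by simp
  qed
  show "\<forall>(W, \<phi>)\<in>?C. \<forall>(W', \<phi>')\<in>?C.
      holo_map_on {..<b - a} (\<phi> ` (W \<inter> W')) (\<lambda>z. \<phi>' (inv_into W \<phi> z))"
    by (auto intro!: chart_transition)
  show "Hausdorff_space (manifold_topology (bounded_flag_manifold a b))"
    using assms by (rule Hausdorff_bounded_flag_manifold)
  show "second_countable (manifold_topology (bounded_flag_manifold a b))"
    using assms by (rule second_countable_bounded_flag_manifold)
qed

section \<open>The tautological line bundle and its projectivization\<close>

text \<open>
  The pair \<open>(V, c)\<close> encodes the vector \<open>c \<cdot> flag_gen V\<close> of the line \<open>V 1\<close>; the generator \<open>flag_gen V\<close> need
  not depend continuously on \<open>V\<close>, only the coordinates of the encoded vector matter.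
\<close>

definition tautological_bundle :: "nat \<Rightarrow> nat \<Rightarrow>
    (nat \<Rightarrow> (nat \<Rightarrow> complex) set, (nat \<Rightarrow> (nat \<Rightarrow> complex) set) \<times> complex) line_bundle" where
  "tautological_bundle a b =
     \<lparr>btotal = bounded_flags a b \<times> UNIV, bproj = fst,
      badd = (\<lambda>e e'. (fst e, snd e + snd e')), bscale = (\<lambda>t e. (fst e, t * snd e)),
      btriv = (\<lambda>j. ({V \<in> bounded_flags a b. flag_gen V j \<noteq> 0}, \<lambda>e. snd e * flag_gen (fst e) j)) ` {a..b}\<rparr>"

lemma tautological_bundle_simps [simp]:
  "btotal (tautological_bundle a b) = bounded_flags a b \<times> UNIV"
  "bproj (tautological_bundle a b) = fst"
  "badd (tautological_bundle a b) e e' = (fst e, snd e + snd e')"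
  "bscale (tautological_bundle a b) t e = (fst e, t * snd e)"
  "btriv (tautological_bundle a b) =
     (\<lambda>j. ({V \<in> bounded_flags a b. flag_gen V j \<noteq> 0}, \<lambda>e. snd e * flag_gen (fst e) j)) ` {a..b}"
  by (simp_all add: tautological_bundle_def)

lemma flag_gen_coordinate_exists:
  assumes "V \<in> bounded_flags a b" "a \<le> b"
  obtains j where "j \<in> {a..b}" "flag_gen V j \<noteq> 0"
proof -
  obtain j where "flag_gen V j \<noteq> 0"
    using flag_gen(1)[OF assms] by (auto simp: fun_eq_iff)
  moreover from this have "j \<in> {a..b}"
    using flag_gen(3)[OF assms] by (auto simp: cspace_def)
  ultimately show thesis using that by auto
qed

text \<open>The trivialization with index \<open>j\<close> is the \<open>j\<close>-th coordinate of
  the encoded vector, so the transition functions are coordinate ratios.\<close>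

lemma holomorphic_line_bundle_tautological:
  assumes ab: "a \<le> b"
  shows "holomorphic_line_bundle (bounded_flag_manifold a b) (tautological_bundle a b)"
proof -
  let ?M = "bounded_flag_manifold a b"
  define Y where "Y j = {V \<in> bounded_flags a b. flag_gen V j \<noteq> 0}" for j
  define \<tau> where "\<tau> j e = snd e * flag_gen (fst e) j"
    for j and e :: "(nat \<Rightarrow> (nat \<Rightarrow> complex) set) \<times> complex"
  have triv: "btriv (tautological_bundle a b) = (\<lambda>j. (Y j, \<tau> j)) ` {a..b}"
    by (simp add: Y_def \<tau>_def[abs_def])
  have ratio: "frame_holo a b (Y j) (\<lambda>V. flag_gen V i / flag_gen V j)" for i j
    unfolding Y_def by (rule frame_holo_gen_ratio[OF ab])
  have 1: "(\<Union>j\<in>{a..b}. Y j) = bounded_flags a b"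
  proof
    show "bounded_flags a b \<subseteq> (\<Union>j\<in>{a..b}. Y j)"
    proof
      fix V assume V: "V \<in> bounded_flags a b"
      obtain j where "j \<in> {a..b}" "flag_gen V j \<noteq> 0"
        by (rule flag_gen_coordinate_exists[OF V ab])
      with V show "V \<in> (\<Union>j\<in>{a..b}. Y j)" by (auto simp: Y_def)
    qed
  qed (auto simp: Y_def)
  have 2: "openin (manifold_topology ?M) (Y j)" for j
    by (rule openin_if_frame_holo[OF ratio])
  have 3: "bij_betw (\<lambda>e. (fst e, \<tau> j e)) {e \<in> bounded_flags a b \<times> UNIV. fst e \<in> Y j} (Y j \<times> UNIV)" for j
    by (rule bij_betwI[where g = "\<lambda>(V, c). (V, c / flag_gen V j)"]) (auto simp: Y_def \<tau>_def)
  have 4: "\<exists>g. holomorphic_function ?M (Y j \<inter> Y j') g \<and>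
      (\<forall>e\<in>bounded_flags a b \<times> UNIV. fst e \<in> Y j \<inter> Y j' \<longrightarrow> \<tau> j' e = g (fst e) * \<tau> j e)" for j j'
  proof (intro exI conjI)
    have fh: "frame_holo a b (Y j \<inter> Y j') (\<lambda>V. flag_gen V j' / flag_gen V j)"
      by (rule frame_holo_Int[OF ratio ratio])
    show "holomorphic_function ?M (Y j \<inter> Y j') (\<lambda>V. flag_gen V j' / flag_gen V j)"
      unfolding holomorphic_function_def
      using openin_if_frame_holo[OF fh] frame_holo_in_chart[OF _ fh] by auto
    show "\<forall>e\<in>bounded_flags a b \<times> UNIV. fst e \<in> Y j \<inter> Y j' \<longrightarrow>
        \<tau> j' e = flag_gen (fst e) j' / flag_gen (fst e) j * \<tau> j e"
      by (auto simp: Y_def \<tau>_def)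
  qed
  show ?thesis
    unfolding holomorphic_line_bundle_def triv
    using 1 2 3 4 by (auto simp: \<tau>_def algebra_simps)
qed

section \<open>First lines of flags as lines in the fibres\<close>

definition flag_line ::
    "nat \<Rightarrow> nat \<Rightarrow> (nat \<Rightarrow> (nat \<Rightarrow> complex) set) \<Rightarrow> complex \<Rightarrow> complex \<Rightarrow>
     (complex \<times> (nat \<Rightarrow> (nat \<Rightarrow> complex) set) \<times> complex) set" where
  "flag_line a b V c t = fibre_line (tautological_bundle (Suc a) b) c (V, t)"

lemma mem_flag_line: "(c', e) \<in> flag_line a b V c t \<longleftrightarrow> (\<exists>s. c' = s * c \<and> e = (V, s * t))"
  by (auto simp: flag_line_def fibre_line_def)

lemma flag_line_cscale:
  assumes "s \<noteq> 0"
  shows "flag_line a b V (s * c) (s * t) = flag_line a b V c t"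
proof -
  have "(c', e) \<in> flag_line a b V (s * c) (s * t) \<longleftrightarrow> (c', e) \<in> flag_line a b V c t" for c' e
  proof
    assume "(c', e) \<in> flag_line a b V c t"
    then obtain r where "c' = r * c" "e = (V, r * t)" by (auto simp: mem_flag_line)
    then show "(c', e) \<in> flag_line a b V (s * c) (s * t)"
      using assms by (auto simp: mem_flag_line intro!: exI[of _ "r / s"])
  qed (auto simp: mem_flag_line mult.assoc[symmetric])
  then show ?thesis by auto
qed

lemma fibre_lines_tautological:
  "fibre_lines (tautological_bundle (Suc a) b) =
     {flag_line a b V c t | V c t. V \<in> bounded_flags (Suc a) b \<and> (c \<noteq> 0 \<or> t \<noteq> 0)}"
  by (auto simp: fibre_lines_def flag_line_def)

text \<open>For a bounded flag with \<open>a < b\<close>: next to \<open>flag_gen U a\<close>, the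
  other homogeneous coordinate of \<open>U 1\<close>, relative to the tail generator. This is the
  scalar by which the bundle encodes a vector of the tail line.\<close>

definition flag_coeff :: "nat \<Rightarrow> (nat \<Rightarrow> (nat \<Rightarrow> complex) set) \<Rightarrow> complex" where
  "flag_coeff a U = (SOME t. (flag_gen U)(a := 0) = cscale t (flag_gen (tail_flag a U)))"

text \<open>This is the first line \<open>U 1\<close>, viewed in the fibre of \<open>\<complex> \<oplus> \<xi>\<close> over \<open>tail_flag a U\<close>.\<close>

definition flag_to_line :: "nat \<Rightarrow> nat \<Rightarrow> (nat \<Rightarrow> (nat \<Rightarrow> complex) set) \<Rightarrow>
    (complex \<times> (nat \<Rightarrow> (nat \<Rightarrow> complex) set) \<times> complex) set" where
  "flag_to_line a b U = flag_line a b (tail_flag a U) (flag_gen U a) (flag_coeff a U)"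

lemma flag_coeff:
  assumes "U \<in> bounded_flags a b" "a < b"
  shows "(flag_gen U)(a := 0) = cscale (flag_coeff a U) (flag_gen (tail_flag a U))"
  using someI_ex[OF flag_gen_tail[OF assms]] unfolding flag_coeff_def .

lemma flag_coeff_coordinate:
  assumes "U \<in> bounded_flags a b" "a < b" "j \<noteq> a"
  shows "flag_gen U j = flag_coeff a U * flag_gen (tail_flag a U) j"
  using fun_cong[OF flag_coeff[OF assms(1,2)], of j] assms(3) by (simp add: cscale_def)

lemma flag_coeff_nonzero:
  assumes U: "U \<in> bounded_flags a b" and ab: "a < b"
  shows "flag_gen U a \<noteq> 0 \<or> flag_coeff a U \<noteq> 0"
proof (rule ccontr)
  assume *: "\<not> ?thesis"
  have "flag_gen U j = 0" for j
    using flag_coeff_coordinate[OF U ab, of j] * by (cases "j = a") auto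
  then show False using flag_gen(1)[OF U] ab by (auto simp: fun_eq_iff)
qed

text \<open>Equal lines have equal base points and proportional homogeneous coordinates, hence equal
  tails and proportional generators. Conversely, every line of the fibre gives a cone.\<close>

lemma bij_betw_flag_to_line:
  assumes ab: "a < b"
  shows "bij_betw (flag_to_line a b) (bounded_flags a b) (fibre_lines (tautological_bundle (Suc a) b))"
  unfolding bij_betw_def
proof
  show "inj_on (flag_to_line a b) (bounded_flags a b)"
  proof (rule inj_onI)
    fix U U' assume U: "U \<in> bounded_flags a b" "U' \<in> bounded_flags a b"
      and eq: "flag_to_line a b U = flag_to_line a b U'"
    have "(flag_gen U a, tail_flag a U, flag_coeff a U) \<in> flag_to_line a b U"
      by (auto simp: flag_to_line_def mem_flag_line intro!: exI[of _ 1])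
    then obtain s where s: "flag_gen U a = s * flag_gen U' a" "tail_flag a U = tail_flag a U'"
      "flag_coeff a U = s * flag_coeff a U'"
      unfolding eq by (auto simp: flag_to_line_def mem_flag_line)
    have "flag_gen U j = s * flag_gen U' j" for j
      using flag_coeff_coordinate[OF U(1) ab, of j] flag_coeff_coordinate[OF U(2) ab, of j] s
      by (cases "j = a") auto
    then have "flag_gen U = cscale s (flag_gen U')" unfolding cscale_def by (rule ext)
    then have "flag_gen U \<in> cvec.span {flag_gen U'}" unfolding span_singleton_iff by (rule exI)
    then have "cvec.span {flag_gen U} = cvec.span {flag_gen U'}"
      using flag_gen(1)[OF U(1)] ab by (intro span_singleton_eq) auto
    then have "U 1 = U' 1" using flag_gen(2)[OF U(1)] flag_gen(2)[OF U(2)] ab by simp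
    then show "U = U'" using bounded_flag_eqI[OF U ab] s(2) by simp
  qed
  show "flag_to_line a b ` bounded_flags a b = fibre_lines (tautological_bundle (Suc a) b)"
  proof
    show "flag_to_line a b ` bounded_flags a b \<subseteq> fibre_lines (tautological_bundle (Suc a) b)"
    proof (rule image_subsetI)
      fix U assume U: "U \<in> bounded_flags a b"
      show "flag_to_line a b U \<in> fibre_lines (tautological_bundle (Suc a) b)"
        unfolding fibre_lines_tautological flag_to_line_def
        using tail_flag_bounded[OF U ab] flag_coeff_nonzero[OF U ab] by blast
    qed
    show "fibre_lines (tautological_bundle (Suc a) b) \<subseteq> flag_to_line a b ` bounded_flags a b"
    proof
      fix l assume "l \<in> fibre_lines (tautological_bundle (Suc a) b)"
      then obtain V c t where l: "l = flag_line a b V c t" and V: "V \<in> bounded_flags (Suc a) b"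
        and ct: "c \<noteq> 0 \<or> t \<noteq> 0"
        unfolding fibre_lines_tautological by blast
      have gen_a: "flag_gen V a = 0" by (rule flag_gen_Suc_zero[OF V ab])
      obtain j where j: "flag_gen V j \<noteq> 0" using flag_gen(1)[OF V] ab by (auto simp: fun_eq_iff)
      then have ja: "j \<noteq> a" using gen_a by auto
      \<comment> \<open>The vector with homogeneous coordinates \<open>c\<close> and
        \<open>t\<close>. The chosen generator of its cone differs from it by a factor
        \<open>s\<close>, which does not change the fibre line.\<close>
      define x where "x = (cscale t (flag_gen V))(a := c)"
      have x: "x a = c" "x j = t * flag_gen V j" using ja by (simp_all add: x_def cscale_def)
      have x0: "x(a := 0) = cscale t (flag_gen V)"
        using gen_a by (auto simp: x_def cscale_def fun_eq_iff)
      have "x \<noteq> 0" using ct x j by (metis mult_eq_0_iff zero_fun_apply)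
      note C = cone_flag_gen[OF V ab this x0]
      define U where "U = cone_flag a (cvec.span {x}) V"
      have U: "U \<in> bounded_flags a b" unfolding U_def by (rule C(1))
      have tail: "tail_flag a U = V" unfolding U_def by (rule tail_cone_flag[OF V])
      obtain s where s: "s \<noteq> 0" "flag_gen U = cscale s x" using C(2) unfolding U_def by auto
      have "flag_coeff a U = s * t"
        using flag_coeff_coordinate[OF U ab ja] j s(2) x(2) by (simp add: tail cscale_def)
      then have "flag_to_line a b U = flag_line a b V (s * c) (s * t)"
        using s(2) x(1) by (simp add: flag_to_line_def tail cscale_def)
      then have "l = flag_to_line a b U" using flag_line_cscale[OF s(1)] l by simp
      with U show "l \<in> flag_to_line a b ` bounded_flags a b" by blast
    qed
  qed
qed

text \<open>On the vector \<open>(1, e)\<close> of the line of \<open>U\<close>, the trivialization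
  takes the value \<open>flag_gen U j / flag_gen U a\<close>; when it is normalized to 1 instead,
  the first entry is the reciprocal ratio. These are the two cases of
  \<open>cone_chart\<close>.\<close>

lemma flag_to_line_chart:
  assumes ab: "a < b"
    and ch: "(W', \<phi>') \<in> proj_charts (bounded_flag_manifold (Suc a) b) (tautological_bundle (Suc a) b)"
  shows "W' \<subseteq> fibre_lines (tautological_bundle (Suc a) b)"
    and "({U \<in> bounded_flags a b. flag_to_line a b U \<in> W'}, \<lambda>U. \<phi>' (flag_to_line a b U))
           \<in> induced_flag_charts a b (bounded_flags a b) (b - a)"
proof -
  let ?\<xi> = "tautological_bundle (Suc a) b"
  define k where "k = b - Suc a"
  have lines: "flag_to_line a b U \<in> fibre_lines ?\<xi>" if "U \<in> bounded_flags a b" for U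
    using bij_betw_flag_to_line[OF ab] that by (auto simp: bij_betw_def)
  obtain W \<phi> j where W: "(W, \<phi>) \<in> induced_flag_charts (Suc a) b (bounded_flags (Suc a) b) (b - Suc a)"
    and j: "j \<in> {Suc a..b}"
    and cases: "(W' = {l \<in> fibre_lines ?\<xi>. \<exists>e. (1, e) \<in> l \<and> fst e \<in> W \<inter> {V \<in> bounded_flags (Suc a) b. flag_gen V j \<noteq> 0}} \<and>
        \<phi>' = (\<lambda>l. let e = (THE e. (1, e) \<in> l) in (\<phi> (fst e))(k := snd e * flag_gen (fst e) j)))
      \<or> (W' = {l \<in> fibre_lines ?\<xi>. \<exists>c e. (c, e) \<in> l \<and> fst e \<in> W \<inter> {V \<in> bounded_flags (Suc a) b. flag_gen V j \<noteq> 0} \<and>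
            snd e * flag_gen (fst e) j = 1} \<and>
        \<phi>' = (\<lambda>l. let (c, e) = (THE p. p \<in> l \<and> snd (snd p) * flag_gen (fst (snd p)) j = 1) in (\<phi> (fst e))(k := c)))"
    using ch unfolding proj_charts_def k_def by auto
  then show "W' \<subseteq> fibre_lines ?\<xi>" by auto
  have ja: "j \<noteq> a" using j by auto
  show "({U \<in> bounded_flags a b. flag_to_line a b U \<in> W'}, \<lambda>U. \<phi>' (flag_to_line a b U))
      \<in> induced_flag_charts a b (bounded_flags a b) (b - a)"
    using cases
  proof (elim disjE conjE)
    assume W': "W' = {l \<in> fibre_lines ?\<xi>. \<exists>e. (1, e) \<in> l \<and> fst e \<in> W \<inter> {V \<in> bounded_flags (Suc a) b. flag_gen V j \<noteq> 0}}"
      and \<phi>': "\<phi>' = (\<lambda>l. let e = (THE e. (1, e) \<in> l) in (\<phi> (fst e))(k := snd e * flag_gen (fst e) j))"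
    \<comment> \<open>The scalar is forced to be \<open>1 / flag_gen U a\<close>, so such a vector
      is unique, which evaluates the \<open>THE\<close> in the chart.\<close>
    have mem: "(1, e) \<in> flag_to_line a b U \<longleftrightarrow>
        flag_gen U a \<noteq> 0 \<and> e = (tail_flag a U, flag_coeff a U / flag_gen U a)" for e U
    proof
      assume "flag_gen U a \<noteq> 0 \<and> e = (tail_flag a U, flag_coeff a U / flag_gen U a)"
      then show "(1, e) \<in> flag_to_line a b U"
        by (auto simp: flag_to_line_def mem_flag_line intro!: exI[of _ "1 / flag_gen U a"])
    next
      assume "(1, e) \<in> flag_to_line a b U"
      then obtain s where s: "1 = s * flag_gen U a" "e = (tail_flag a U, s * flag_coeff a U)"
        by (auto simp: flag_to_line_def mem_flag_line)
      then have "flag_gen U a \<noteq> 0" by auto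
      moreover from this have "s = 1 / flag_gen U a" using s(1) by (simp add: field_simps)
      ultimately show "flag_gen U a \<noteq> 0 \<and> e = (tail_flag a U, flag_coeff a U / flag_gen U a)"
        using s(2) by simp
    qed
    show ?thesis
    proof (rule cone_chart[OF ab W j, of j a])
      show "{U \<in> bounded_flags a b. flag_to_line a b U \<in> W'} = {U \<in> bounded_flags a b.
          tail_flag a U \<in> W \<and> flag_gen (tail_flag a U) j \<noteq> 0 \<and> flag_gen U a \<noteq> 0}"
        using lines tail_flag_bounded[OF _ ab] by (auto simp: W' mem)
      fix U assume "U \<in> {U \<in> bounded_flags a b. flag_to_line a b U \<in> W'}"
      then have U: "U \<in> bounded_flags a b" "flag_gen U a \<noteq> 0" by (auto simp: W' mem)
      have "(THE e. (1, e) \<in> flag_to_line a b U) = (tail_flag a U, flag_coeff a U / flag_gen U a)"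
        using U(2) by (simp add: mem)
      then show "\<phi>' (flag_to_line a b U) = (\<phi> (tail_flag a U))(b - Suc a := flag_gen U j / flag_gen U a)"
        using flag_coeff_coordinate[OF U(1) ab ja] by (simp add: \<phi>' k_def)
    qed simp
  next
    assume W': "W' = {l \<in> fibre_lines ?\<xi>. \<exists>c e. (c, e) \<in> l \<and> fst e \<in> W \<inter> {V \<in> bounded_flags (Suc a) b. flag_gen V j \<noteq> 0} \<and>
            snd e * flag_gen (fst e) j = 1}"
      and \<phi>': "\<phi>' = (\<lambda>l. let (c, e) = (THE p. p \<in> l \<and> snd (snd p) * flag_gen (fst (snd p)) j = 1) in (\<phi> (fst e))(k := c))"
    \<comment> \<open>Now the trivialization is normalized to 1, which forces the scalar
      \<open>1 / flag_gen U j\<close>.\<close>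
    have mem: "(c, e) \<in> flag_to_line a b U \<and> snd e * flag_gen (fst e) j = 1 \<longleftrightarrow>
        flag_gen U j \<noteq> 0 \<and> c = flag_gen U a / flag_gen U j \<and> e = (tail_flag a U, flag_coeff a U / flag_gen U j)"
      if U: "U \<in> bounded_flags a b" for c e U
    proof
      assume "flag_gen U j \<noteq> 0 \<and> c = flag_gen U a / flag_gen U j \<and> e = (tail_flag a U, flag_coeff a U / flag_gen U j)"
      then show "(c, e) \<in> flag_to_line a b U \<and> snd e * flag_gen (fst e) j = 1"
        using flag_coeff_coordinate[OF U ab ja]
        by (auto simp: flag_to_line_def mem_flag_line intro!: exI[of _ "1 / flag_gen U j"])
    next
      assume *: "(c, e) \<in> flag_to_line a b U \<and> snd e * flag_gen (fst e) j = 1"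
      then obtain s where s: "c = s * flag_gen U a" "e = (tail_flag a U, s * flag_coeff a U)"
        by (auto simp: flag_to_line_def mem_flag_line)
      then have s1: "s * flag_gen U j = 1"
        using * flag_coeff_coordinate[OF U ab ja] by (simp add: mult.assoc)
      then have "flag_gen U j \<noteq> 0" by auto
      moreover from this have "s = 1 / flag_gen U j" using s1 by (simp add: field_simps)
      ultimately show "flag_gen U j \<noteq> 0 \<and> c = flag_gen U a / flag_gen U j \<and> e = (tail_flag a U, flag_coeff a U / flag_gen U j)"
        using s by simp
    qed
    show ?thesis
    proof (rule cone_chart[OF ab W j, of a j])
      have "(\<exists>c e. (c, e) \<in> flag_to_line a b U \<and> fst e \<in> W \<inter> {V \<in> bounded_flags (Suc a) b. flag_gen V j \<noteq> 0} \<and>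
          snd e * flag_gen (fst e) j = 1) \<longleftrightarrow>
          tail_flag a U \<in> W \<and> flag_gen (tail_flag a U) j \<noteq> 0 \<and> flag_gen U j \<noteq> 0"
        if U: "U \<in> bounded_flags a b" for U
      proof -
        have "(\<exists>c e. (c, e) \<in> flag_to_line a b U \<and> fst e \<in> W \<inter> {V \<in> bounded_flags (Suc a) b. flag_gen V j \<noteq> 0} \<and>
            snd e * flag_gen (fst e) j = 1) \<longleftrightarrow>
          (\<exists>c e. ((c, e) \<in> flag_to_line a b U \<and> snd e * flag_gen (fst e) j = 1) \<and>
             fst e \<in> W \<inter> {V \<in> bounded_flags (Suc a) b. flag_gen V j \<noteq> 0})"
          by auto
        then show ?thesis
          unfolding mem[OF U] using tail_flag_bounded[OF U ab] by auto
      qed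
      then show "{U \<in> bounded_flags a b. flag_to_line a b U \<in> W'} = {U \<in> bounded_flags a b.
          tail_flag a U \<in> W \<and> flag_gen (tail_flag a U) j \<noteq> 0 \<and> flag_gen U j \<noteq> 0}"
        using lines unfolding W' mem_Collect_eq by (intro Collect_cong) blast
      fix U assume "U \<in> {U \<in> bounded_flags a b. flag_to_line a b U \<in> W'}"
      then have U: "U \<in> bounded_flags a b" and "\<exists>c e. (c, e) \<in> flag_to_line a b U \<and> snd e * flag_gen (fst e) j = 1"
        unfolding W' by auto
      then have nz: "flag_gen U j \<noteq> 0" using mem[OF U] by blast
      have "p \<in> flag_to_line a b U \<and> snd (snd p) * flag_gen (fst (snd p)) j = 1 \<longleftrightarrow>
          p = (flag_gen U a / flag_gen U j, tail_flag a U, flag_coeff a U / flag_gen U j)" for p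
      proof -
        obtain c e where p: "p = (c, e)" by (cases p)
        show ?thesis unfolding p snd_conv mem[OF U] using nz by simp
      qed
      then have "(THE p. p \<in> flag_to_line a b U \<and> snd (snd p) * flag_gen (fst (snd p)) j = 1)
          = (flag_gen U a / flag_gen U j, tail_flag a U, flag_coeff a U / flag_gen U j)"
        by simp
      then show "\<phi>' (flag_to_line a b U) = (\<phi> (tail_flag a U))(b - Suc a := flag_gen U a / flag_gen U j)"
        by (simp add: \<phi>' k_def)
    qed simp
  qed
qed

text \<open>After pulling the charts of the projectivization back to flags, the bijection and its
  inverse are both read in charts as transition maps of a single atlas.\<close>

lemma biholomorphic_projectivization:
  assumes ab: "a < b"
  shows "biholomorphic (bounded_flag_manifold a b)
           (projectivization (bounded_flag_manifold (Suc a) b) (tautological_bundle (Suc a) b))"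
    (is "biholomorphic ?B ?P")
proof -
  let ?f = "flag_to_line a b" and ?X = "bounded_flags a b"
  let ?C = "induced_flag_charts a b ?X (b - a)"
  let ?PC = "proj_charts (bounded_flag_manifold (Suc a) b) (tautological_bundle (Suc a) b)"
  have P: "pts ?P = fibre_lines (tautological_bundle (Suc a) b)" "charts ?P = ?PC"
    "cdim ?P = b - a"
    using ab by (simp_all add: projectivization_def)
  note bij = bij_betw_flag_to_line[OF ab]
  then have inj: "inj_on ?f ?X" and im: "?f ` ?X = pts ?P" by (auto simp: bij_betw_def P)
  have "holomorphic_map ?B ?P ?f"
    unfolding holomorphic_map_def
  proof (intro conjI ballI case_prodI2)
    show "?f ` pts ?B \<subseteq> pts ?P" using im by simp
    fix c c' W \<phi> W' \<phi>' assume "c \<in> charts ?B" "c' \<in> charts ?P" "c = (W, \<phi>)" "c' = (W', \<phi>')"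
    then have ch: "(W, \<phi>) \<in> ?C" and ch': "(W', \<phi>') \<in> ?PC" by (simp_all add: P)
    have "W \<inter> {U \<in> ?X. ?f U \<in> W'} = {U \<in> W. ?f U \<in> W'}"
      using induced_flag_chartsD(1)[OF ch] by auto
    then show "holo_map_on (model_coords ?B) (\<phi> ` {U \<in> W. ?f U \<in> W'}) (\<lambda>z. \<phi>' (?f (inv_into W \<phi> z)))"
      using chart_transition[OF ch flag_to_line_chart(2)[OF ab ch']] by simp
  qed
  moreover have "holomorphic_map ?P ?B (inv_into (pts ?B) ?f)"
    unfolding holomorphic_map_def
  proof (intro conjI ballI case_prodI2)
    show "inv_into (pts ?B) ?f ` pts ?P \<subseteq> pts ?B"
      using im inv_into_into[of _ ?f ?X] by auto
    fix c c' W \<phi> W' \<phi>' assume "c \<in> charts ?P" "c' \<in> charts ?B" "c = (W', \<phi>')" "c' = (W, \<phi>)"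
    then have ch: "(W, \<phi>) \<in> ?C" and ch': "(W', \<phi>') \<in> ?PC" by (simp_all add: P)
    define W2 where "W2 = {U \<in> ?X. ?f U \<in> W'}"
    define \<psi> where "\<psi> U = \<phi>' (?f U)" for U
    have ch2: "(W2, \<psi>) \<in> ?C"
      using flag_to_line_chart(2)[OF ab ch'] by (simp add: W2_def \<psi>_def[abs_def])
    have W': "W' = ?f ` W2"
    proof
      show "W' \<subseteq> ?f ` W2"
      proof
        fix l assume l: "l \<in> W'"
        then have "l \<in> ?f ` ?X" using flag_to_line_chart(1)[OF ab ch'] im P(1) by auto
        with l show "l \<in> ?f ` W2" by (auto simp: W2_def)
      qed
    qed (auto simp: W2_def)
    have g: "inv_into (pts ?B) ?f (?f U) = U" if "U \<in> ?X" for U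
      using inj that by simp
    \<comment> \<open>Rewrites the chart domain and the inverse chart on the projectivization in
      terms of the pulled back chart \<open>(W2, \<psi>)\<close>, so that
      \<open>chart_transition\<close> applies.\<close>
    have set: "\<phi>' ` {l \<in> W'. inv_into (pts ?B) ?f l \<in> W} = \<psi> ` (W2 \<inter> W)"
    proof -
      have "{l \<in> W'. inv_into (pts ?B) ?f l \<in> W} = ?f ` (W2 \<inter> W)"
        unfolding W' using g by (auto simp: W2_def)
      then show ?thesis by (simp add: image_image \<psi>_def)
    qed
    have inj': "inj_on \<phi>' W'"
      using induced_flag_chartsD(2)[OF ch2] unfolding W' by (auto simp: inj_on_def \<psi>_def)
    have eq: "inv_into (pts ?B) ?f (inv_into W' \<phi>' z) = inv_into W2 \<psi> z" if z: "z \<in> \<psi> ` (W2 \<inter> W)" for z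
    proof -
      obtain U where U: "U \<in> W2" "z = \<psi> U" using z by auto
      have "inv_into W' \<phi>' z = ?f U"
        using inv_into_f_f[OF inj', of "?f U"] U unfolding W' by (simp add: \<psi>_def)
      moreover have "inv_into W2 \<psi> z = U"
        using induced_flag_chartsD(2)[OF ch2] U by simp
      ultimately show ?thesis using g U(1) by (simp add: W2_def)
    qed
    have "holo_on {..<b - a} (\<psi> ` (W2 \<inter> W)) (\<lambda>z. \<phi> (inv_into W2 \<psi> z) i)" for i
      using chart_transition[OF ch2 ch] by (simp add: holo_map_on_def)
    then have "holo_on {..<b - a} (\<psi> ` (W2 \<inter> W)) (\<lambda>z. \<phi> (inv_into (pts ?B) ?f (inv_into W' \<phi>' z)) i)" for i
      by (rule holo_on_cong) (simp only: eq)
    then have "holo_map_on {..<b - a} (\<psi> ` (W2 \<inter> W)) (\<lambda>z. \<phi> (inv_into (pts ?B) ?f (inv_into W' \<phi>' z)))"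
      unfolding holo_map_on_def by (rule allI)
    then show "holo_map_on (model_coords ?P) (\<phi>' ` {l \<in> W'. inv_into (pts ?B) ?f l \<in> W})
        (\<lambda>z. \<phi> (inv_into (pts ?B) ?f (inv_into W' \<phi>' z)))"
      unfolding set P .
  qed
  ultimately show ?thesis
    unfolding biholomorphic_def using bij P by (intro exI[of _ ?f]) simp
qed

theorem theorem2p5:
  fixes n :: nat
  assumes "n \<ge> 1"
  shows "bott_tower n (\<lambda>k. bounded_flag_manifold (n - k + 1) (n + 1))"
  unfolding bott_tower_def
proof (intro conjI allI impI ballI)
  show "complex_manifold (bounded_flag_manifold (n - k + 1) (n + 1))" for k
    by (rule complex_manifold_bounded_flag_manifold) simp
  \<comment> \<open>At stage 0 both ends of the coordinate range are \<open>n + 1\<close>, which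
    leaves a single flag.\<close>
  show "\<exists>U. pts (bounded_flag_manifold (n - 0 + 1) (n + 1)) = {U}"
    using bounded_flags_same[of _ "n + 1"] by auto
  fix k assume k: "k \<in> {1..n}"
  \<comment> \<open>Going one stage down raises the lower end by one; with truncated subtraction
    this needs \<open>1 \<le> k \<le> n\<close>.\<close>
  have eq: "n - (k - 1) + 1 = Suc (n - k + 1)" using k by auto
  show "\<exists>\<xi> :: (nat \<Rightarrow> (nat \<Rightarrow> complex) set, (nat \<Rightarrow> (nat \<Rightarrow> complex) set) \<times> complex) line_bundle.
      holomorphic_line_bundle (bounded_flag_manifold (n - (k - 1) + 1) (n + 1)) \<xi> \<and>
      biholomorphic (bounded_flag_manifold (n - k + 1) (n + 1))
        (projectivization (bounded_flag_manifold (n - (k - 1) + 1) (n + 1)) \<xi>)"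
    unfolding eq
  proof (intro exI conjI)
    show "holomorphic_line_bundle (bounded_flag_manifold (Suc (n - k + 1)) (n + 1))
        (tautological_bundle (Suc (n - k + 1)) (n + 1))"
      using k by (intro holomorphic_line_bundle_tautological) auto
    show "biholomorphic (bounded_flag_manifold (n - k + 1) (n + 1))
        (projectivization (bounded_flag_manifold (Suc (n - k + 1)) (n + 1))
          (tautological_bundle (Suc (n - k + 1)) (n + 1)))"
      using k by (intro biholomorphic_projectivization) auto
  qed
qed

end
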